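(* Let $H$ be a real Hilbert space and let $k\in L^1_{\rm loc}([0,\infty))$ be a function satisfying condition (K), with conjugate kernel $\ell$ (see context). Let $\varphi:H\to(-\infty,\infty]$ be a proper lower-semicontinuous convex functional. Let $T\in(0,\infty)$, $u_0\in D(\varphi)$ and let $u\in L^2(0,T;H)$ satisfy - $k*(u-u_0)\in W^{1,2}(0,T;H)$ and $[k*(u-u_0)](0)=0$; - $u(t)\in D(\partial\varphi)$ for a.e. $t\in(0,T)$. Assume that there exists $g\in L^2(0,T;H)$ such that $g(t)\in\partial\varphi(u(t))$ for a.e. $t\in(0,T)$. Then the following holds true: (i) For a.e. $t\in(0,T)$, $$\int_0^t\left(\frac{\mathrm{d}}{\mathrm{d}t}[k*(u-u_0)](\tau),g(\tau)\right)_H\mathrm{d}\tau\ge\big[k*\big(\varphi(u(\cdot))-\varphi(u_0)\big)\big](t).$$ (ii) For a.e. $t\in(0,T)$, $$\left[\ell*\left(\frac{\mathrm{d}}{\mathrm{d}t}[k*(u-u_0)](\cdot),g(\cdot)\right)_H\right](t)\ge\varphi(u(t))-\varphi(u_0).$$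
   Context: Effective domain: $D(\varphi)=\{w\in H:\varphi(w)<\infty\}$; proper means $\varphi\not\equiv\infty$. Subdifferential: for $z\in D(\varphi)$, $\partial\varphi(z)=\{\xi\in H:\varphi(v)-\varphi(z)\ge(\xi,v-z)_H\ \text{for all } v\in D(\varphi)\}$, with domain $D(\partial\varphi)=\{w\in D(\varphi):\partial\varphi(w)\ne\emptyset\}$. Convolution: $(k*w)(t)=\int_0^tk(t-s)w(s)\,\mathrm{d}s$. Condition (K): $k\in L^1_{\rm loc}([0,\infty))$ is nonnegative and nonincreasing (on $(0,\infty)$), and there exists a nonnegative and nonincreasing kernel $\ell\in L^1_{\rm loc}([0,\infty))$ (the conjugate kernel of $k$) such that $(k*\ell)(t)=\int_0^tk(t-s)\ell(s)\,\mathrm{d}s=1$ for $t>0$. *)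

theory Defs
  imports "HOL-Analysis.Analysis"
begin

section \<open>Bochner integration without separability\<close>

text \<open>
  The Bochner integral of the library requires a second countable target space, whereas the
  Hilbert spaces here may be non-separable. The definitions below repeat the construction of the
  library, with Borel measurability replaced by strong measurability.
\<close>

definition strongly_measurable :: "'a measure \<Rightarrow> ('a \<Rightarrow> 'b::real_normed_vector) \<Rightarrow> bool" where
  "strongly_measurable M f \<longleftrightarrow>
     (\<exists>s. (\<forall>i. simple_function M (s i)) \<and> (AE x in M. (\<lambda>i. s i x) \<longlonglongrightarrow> f x))"

definition has_strong_integral ::
  "'a measure \<Rightarrow> ('a \<Rightarrow> 'b::real_normed_vector) \<Rightarrow> 'b \<Rightarrow> bool" where
  "has_strong_integral M f x \<longleftrightarrow>
     strongly_measurable M f \<and>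
     (\<exists>s. (\<forall>i. Bochner_Integration.simple_bochner_integrable M (s i)) \<and>
          (\<lambda>i. \<integral>\<^sup>+ y. ennreal (norm (f y - s i y)) \<partial>M) \<longlonglongrightarrow> 0 \<and>
          (\<lambda>i. Bochner_Integration.simple_bochner_integral M (s i)) \<longlonglongrightarrow> x)"

definition strong_integral :: "'a measure \<Rightarrow> ('a \<Rightarrow> 'b::real_normed_vector) \<Rightarrow> 'b" where
  "strong_integral M f =
     (if \<exists>x. has_strong_integral M f x then THE x. has_strong_integral M f x else 0)"

section \<open>Function spaces on \<open>(0,T)\<close>\<close>

definition L2_on :: "real \<Rightarrow> (real \<Rightarrow> 'b::real_normed_vector) \<Rightarrow> bool" where
  "L2_on T f \<longleftrightarrow>
     strongly_measurable (lebesgue_on {0<..<T}) f \<and>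
     integrable (lebesgue_on {0<..<T}) (\<lambda>t. (norm (f t))\<^sup>2)"

definition test_function :: "real \<Rightarrow> (real \<Rightarrow> real) \<Rightarrow> bool" where
  "test_function T \<psi> \<longleftrightarrow>
     (\<forall>n x. (deriv ^^ n) \<psi> field_differentiable at x) \<and>
     (\<exists>a b. 0 < a \<and> a \<le> b \<and> b < T \<and> (\<forall>x. x \<notin> {a..b} \<longrightarrow> \<psi> x = 0))"

definition is_weak_derivative ::
  "real \<Rightarrow> (real \<Rightarrow> 'b::real_normed_vector) \<Rightarrow> (real \<Rightarrow> 'b) \<Rightarrow> bool" where
  "is_weak_derivative T w v \<longleftrightarrow>
     (\<forall>\<psi>. test_function T \<psi> \<longrightarrow>
        strong_integral (lebesgue_on {0<..<T}) (\<lambda>t. deriv \<psi> t *\<^sub>R w t) =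
        - strong_integral (lebesgue_on {0<..<T}) (\<lambda>t. \<psi> t *\<^sub>R v t))"

definition W12_on :: "real \<Rightarrow> (real \<Rightarrow> 'b::real_normed_vector) \<Rightarrow> bool" where
  "W12_on T w \<longleftrightarrow> L2_on T w \<and> (\<exists>v. L2_on T v \<and> is_weak_derivative T w v)"

text \<open>A representative of the time derivative, which is unique only up to null sets.\<close>

definition weak_derivative ::
  "real \<Rightarrow> (real \<Rightarrow> 'b::real_normed_vector) \<Rightarrow> real \<Rightarrow> 'b" where
  "weak_derivative T w = (SOME v. L2_on T v \<and> is_weak_derivative T w v)"

text \<open>
  The value at \<open>0\<close> of an element of \<open>W12_on T\<close> is that of its continuous representative; the
  pointwise value \<open>w 0\<close> is meaningless (and identically \<open>0\<close> for a convolution).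
\<close>

definition has_initial_value ::
  "real \<Rightarrow> (real \<Rightarrow> 'b::real_normed_vector) \<Rightarrow> 'b \<Rightarrow> bool" where
  "has_initial_value T w x \<longleftrightarrow>
     (\<exists>v. continuous_on {0..T} v \<and> (AE t in lebesgue_on {0<..<T}. v t = w t) \<and> v 0 = x)"

section \<open>Convolutions and condition (K)\<close>

definition conv_integrable :: "(real \<Rightarrow> real) \<Rightarrow> (real \<Rightarrow> real) \<Rightarrow> real \<Rightarrow> bool" where
  "conv_integrable k f t \<longleftrightarrow> integrable (lebesgue_on {0..t}) (\<lambda>s. k (t - s) * f s)"

definition conv :: "(real \<Rightarrow> real) \<Rightarrow> (real \<Rightarrow> real) \<Rightarrow> real \<Rightarrow> real" where
  "conv k f t = (LINT s|lebesgue_on {0..t}. k (t - s) * f s)"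

definition vconv ::
  "(real \<Rightarrow> real) \<Rightarrow> (real \<Rightarrow> 'b::real_normed_vector) \<Rightarrow> real \<Rightarrow> 'b" where
  "vconv k w t = strong_integral (lebesgue_on {0..t}) (\<lambda>s. k (t - s) *\<^sub>R w s)"

definition monotone_kernel :: "(real \<Rightarrow> real) \<Rightarrow> bool" where
  "monotone_kernel k \<longleftrightarrow>
     (\<forall>b>0. integrable (lebesgue_on {0..b}) k) \<and> (\<forall>t>0. 0 \<le> k t) \<and> antimono_on {0<..} k"

definition conjugate_kernel :: "(real \<Rightarrow> real) \<Rightarrow> (real \<Rightarrow> real) \<Rightarrow> bool" where
  "conjugate_kernel k l \<longleftrightarrow> monotone_kernel l \<and> (\<forall>t>0. conv k l t = 1)"

definition condition_K :: "(real \<Rightarrow> real) \<Rightarrow> bool" where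
  "condition_K k \<longleftrightarrow> monotone_kernel k \<and> (\<exists>l. conjugate_kernel k l)"

section \<open>Convex functionals and subdifferentials\<close>

definition effective_domain :: "('b \<Rightarrow> ereal) \<Rightarrow> 'b set" where
  "effective_domain \<phi> = {w. \<phi> w < \<infinity>}"

definition proper_functional :: "('b \<Rightarrow> ereal) \<Rightarrow> bool" where
  "proper_functional \<phi> \<longleftrightarrow> (\<forall>w. \<phi> w \<noteq> -\<infinity>) \<and> (\<exists>w. \<phi> w \<noteq> \<infinity>)"

definition lower_semicontinuous :: "('b::topological_space \<Rightarrow> ereal) \<Rightarrow> bool" where
  "lower_semicontinuous \<phi> \<longleftrightarrow> (\<forall>x. \<phi> x \<le> Liminf (at x) \<phi>)"

definition convex_functional :: "('b::real_vector \<Rightarrow> ereal) \<Rightarrow> bool" where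
  "convex_functional \<phi> \<longleftrightarrow>
     (\<forall>x y. \<forall>a\<ge>0. \<forall>b\<ge>0. a + b = 1 \<longrightarrow>
        \<phi> (a *\<^sub>R x + b *\<^sub>R y) \<le> ereal a * \<phi> x + ereal b * \<phi> y)"

definition subdifferential :: "('b::real_inner \<Rightarrow> ereal) \<Rightarrow> 'b \<Rightarrow> 'b set" where
  "subdifferential \<phi> z =
     {\<xi>. z \<in> effective_domain \<phi> \<and>
          (\<forall>v\<in>effective_domain \<phi>. \<phi> v - \<phi> z \<ge> ereal (\<xi> \<bullet> (v - z)))}"

definition subdifferential_domain :: "('b::real_inner \<Rightarrow> ereal) \<Rightarrow> 'b set" where
  "subdifferential_domain \<phi> = {w \<in> effective_domain \<phi>. subdifferential \<phi> w \<noteq> {}}"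

text \<open>
  \<open>\<phi>(w) - \<phi>(z)\<close> as a real number. It is meant for \<open>w\<close> and \<open>z\<close> in the effective domain of a
  functional that avoids \<open>-\<infinity>\<close>; elsewhere infinite values are read as \<open>0\<close>.
\<close>

definition functional_diff :: "('b \<Rightarrow> ereal) \<Rightarrow> 'b \<Rightarrow> 'b \<Rightarrow> real" where
  "functional_diff \<phi> w z = real_of_ereal (\<phi> w) - real_of_ereal (\<phi> z)"

end

theory Submission
  imports Defs "HOL-Computational_Algebra.Polynomial"
begin

text \<open>
  Put \<open>v = u - u\<^sub>0\<close> and \<open>\<Phi> = \<phi>(u) - \<phi>(u\<^sub>0)\<close>; convolving \<open>k * v = 1 * d\<close> with \<open>l\<close> gives
  \<open>v = l * d\<close>. The kernel \<open>k\<close> is replaced by its moving averages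
  \<open>\<kappa>(t) = (1/\<epsilon>) \<integral>\<^sub>[\<^sub>t\<^sub>,\<^sub>t\<^sub>+\<^sub>\<epsilon>\<^sub>] k\<close>, which are bounded, nonincreasing and satisfy
  \<open>\<kappa> = c - 1 * p\<close> with \<open>p \<ge> 0\<close>. For them the chain rule inequality
  \<open>(c v - p * v, g) \<ge> c \<Phi> - p * \<Phi>\<close> is the subdifferential inequality, integrated against \<open>p\<close>.
  The derivative \<open>\<rho> = c l - p * l\<close> of \<open>\<kappa> * l\<close> is nonnegative because \<open>l\<close> is nonincreasing, and it
  is an approximate identity as \<open>\<epsilon> \<rightarrow> 0\<close>. Since \<open>c v - p * v = \<rho> * d\<close>, the left-hand side tends to
  \<open>(d, g)\<close> in \<open>L\<^sup>1\<close>; after convolution with \<open>l\<close> the right-hand side is \<open>\<rho> * \<Phi> \<rightarrow> \<Phi>\<close>. This is (ii),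
  and convolving (ii) with \<open>k\<close> gives (i).
\<close>

section \<open>Convolution of integrable functions on the line\<close>

text \<open>In the chain rule inequality for the regularised kernel only the side with g converges
  by itself: c \<Phi> - p * \<Phi> has no limit in general, because k * \<Phi> need not be
  differentiable. Hence (ii) has to come before (i). Moving averages are a convenient regularisation
  because the conjugacy identity, read at t and at t + \<epsilon>, gives p * l explicitly, so that
  the sign and the mass of \<rho> can be read off. A second obstacle is that H may be non-separable
  while g(t) varies with the outer time. Vector identities are therefore tested with fixed vectors
  a, and only afterwards is a replaced by g(t), by continuity in a and the separable range of g.
  Functions on (0,T) are extended by zero to the whole line: Fubini and translation invariance then
  apply to \<open>lborel\<close>, and causality takes the place of the limits of integration.
  Integrability of \<Phi> is not assumed but follows from an upper and a lower bound provided by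
  subgradients.\<close>

definition line_conv :: "(real \<Rightarrow> real) \<Rightarrow> (real \<Rightarrow> real) \<Rightarrow> real \<Rightarrow> real" where
  "line_conv f g t = (LINT s|lborel. f (t - s) * g s)"

lemma integrable_reflect_shift:
  fixes f :: "real \<Rightarrow> real"
  shows "integrable lborel (\<lambda>s. f (t - s)) \<longleftrightarrow> integrable lborel f"
  using lborel_integrable_real_affine_iff[of "-1" f t] by simp

lemma integral_reflect_shift:
  fixes f :: "real \<Rightarrow> real"
  shows "(LINT s|lborel. f (t - s)) = (LINT s|lborel. f s)"
  using lborel_integral_real_affine[of "-1" f t] by simp

lemma integrable_shift:
  fixes f :: "real \<Rightarrow> real"
  shows "integrable lborel (\<lambda>s. f (s - t)) \<longleftrightarrow> integrable lborel f"
  using lborel_integrable_real_affine_iff[of 1 f "-t"] by (simp add: algebra_simps)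

lemma integral_shift:
  fixes f :: "real \<Rightarrow> real"
  shows "(LINT s|lborel. f (s - t)) = (LINT s|lborel. f s)"
  using lborel_integral_real_affine[of 1 f "-t"] by (simp add: algebra_simps)

lemma nn_integral_shift:
  assumes "f \<in> borel_measurable borel"
  shows "(\<integral>\<^sup>+s. f (s - t) \<partial>lborel) = (\<integral>\<^sup>+s. f s \<partial>(lborel :: real measure))"
  using nn_integral_real_affine[OF assms, of 1 "-t"] by (simp add: algebra_simps)

text \<open>\<open>P\<close> need not be measurable; it is replaced by the complement of a Borel
  null set, to which the affine change of variables applies.\<close>

lemma AE_reflect_shift:
  assumes "AE s in lborel. P s"
  shows "AE s in lborel. P (t - s :: real)"
proof -
  obtain N where N: "N \<in> null_sets lborel" "\<And>s. s \<notin> N \<Longrightarrow> P s"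
    using assms by (auto simp: eventually_ae_filter)
  have "AE s in lborel. s \<notin> N"
    using N(1) by (rule AE_not_in)
  moreover have "Measurable.pred borel (\<lambda>s. s \<notin> N)"
    using N(1) by auto
  ultimately have "AE s in lborel. t + (-1) * s \<notin> N"
    by (intro AE_borel_affine) auto
  then show ?thesis
    using N(2) by (auto elim!: eventually_mono)
qed

lemma line_conv_commute: "line_conv f g t = line_conv g f t"
  using integral_reflect_shift[of "\<lambda>s. f (t - s) * g s" t]
  by (simp add: line_conv_def mult.commute)

lemma integrable_line_conv_commute:
  fixes f g :: "real \<Rightarrow> real"
  shows "integrable lborel (\<lambda>s. f (t - s) * g s) \<longleftrightarrow> integrable lborel (\<lambda>s. g (t - s) * f s)"
  using integrable_reflect_shift[of "\<lambda>s. f (t - s) * g s" t] by (simp add: mult.commute)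

text \<open>Integrating in \<open>t\<close> first, translation invariance separates the variables
  and leaves the product of the two L^1 norms. Existence almost everywhere, integrability and the
  integral of a convolution are then instances of Fubini.\<close>

lemma integrable_pair_conv:
  fixes f g :: "real \<Rightarrow> real"
  assumes f: "integrable lborel f" and g: "integrable lborel g"
  shows "integrable (lborel \<Otimes>\<^sub>M lborel) (\<lambda>(t, s). f (t - s) * g s)"
proof (rule integrableI_bounded)
  have [measurable]: "f \<in> borel_measurable borel" "g \<in> borel_measurable borel"
    using f g by auto
  show "(\<lambda>(t, s). f (t - s) * g s) \<in> borel_measurable (lborel \<Otimes>\<^sub>M lborel)"
    by measurable
  have norm_meas: "(\<lambda>t. ennreal (norm (f t))) \<in> borel_measurable borel"
    by measurable
  have "(\<integral>\<^sup>+ x. ennreal (norm (case x of (t, s) \<Rightarrow> f (t - s) * g s)) \<partial>(lborel \<Otimes>\<^sub>M lborel))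
      = (\<integral>\<^sup>+ s. (\<integral>\<^sup>+ t. ennreal (norm (f (t - s) * g s)) \<partial>lborel) \<partial>lborel)"
    by (subst lborel_pair.nn_integral_snd[symmetric]) auto
  also have "\<dots> = (\<integral>\<^sup>+ s. (\<integral>\<^sup>+ t. ennreal (norm (f (t - s))) \<partial>lborel) * ennreal (norm (g s)) \<partial>lborel)"
    by (intro nn_integral_cong) (simp add: abs_mult ennreal_mult nn_integral_multc)
  also have "\<dots> = (\<integral>\<^sup>+ t. ennreal (norm (f t)) \<partial>lborel) * (\<integral>\<^sup>+ s. ennreal (norm (g s)) \<partial>lborel)"
    by (simp only: nn_integral_shift[where f="\<lambda>t. ennreal (norm (f t))", OF norm_meas]) (simp add: nn_integral_cmult)
  also have "\<dots> < \<infinity>"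
    using f g by (auto simp: integrable_iff_bounded ennreal_mult_less_top)
  finally show "(\<integral>\<^sup>+ x. ennreal (norm (case x of (t, s) \<Rightarrow> f (t - s) * g s)) \<partial>(lborel \<Otimes>\<^sub>M lborel)) < \<infinity>" .
qed

lemma AE_integrable_conv:
  fixes f g :: "real \<Rightarrow> real"
  assumes "integrable lborel f" "integrable lborel g"
  shows "AE t in lborel. integrable lborel (\<lambda>s. f (t - s) * g s)"
  using lborel_pair.AE_integrable_fst'[OF integrable_pair_conv[OF assms]] by simp

lemma integrable_line_conv:
  assumes "integrable lborel f" "integrable lborel g"
  shows "integrable lborel (line_conv f g)"
  using lborel_pair.integrable_fst'[OF integrable_pair_conv[OF assms]]
  by (simp add: line_conv_def[abs_def])

lemma integral_line_conv:
  assumes "integrable lborel f" "integrable lborel g"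
  shows "(LINT t|lborel. line_conv f g t) = (LINT t|lborel. f t) * (LINT t|lborel. g t)"
proof -
  have "(LINT t|lborel. line_conv f g t) = (LINT s|lborel. LINT t|lborel. f (t - s) * g s)"
    unfolding line_conv_def
    using lborel_pair.Fubini_integral[of "\<lambda>t s. f (t - s) * g s"] integrable_pair_conv[OF assms]
    by simp
  then show ?thesis by (simp add: integral_shift)
qed

lemma borel_measurable_line_conv[measurable]:
  assumes [measurable]: "f \<in> borel_measurable borel" "g \<in> borel_measurable borel"
  shows "line_conv f g \<in> borel_measurable borel"
  unfolding line_conv_def by measurable

lemma integrable_bounded_conv:
  fixes f g :: "real \<Rightarrow> real"
  assumes "f \<in> borel_measurable borel" "\<And>s. \<bar>f s\<bar> \<le> B" "integrable lborel g"
  shows "integrable lborel (\<lambda>s. f (t - s) * g s)"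
proof (rule Bochner_Integration.integrable_bound)
  show "integrable lborel (\<lambda>s. B * g s)"
    using assms(3) by auto
  show "(\<lambda>s. f (t - s) * g s) \<in> borel_measurable lborel"
    using assms by auto
  show "AE s in lborel. norm (f (t - s) * g s) \<le> norm (B * g s)"
    using order_trans[OF assms(2) abs_ge_self] by (auto simp: abs_mult intro!: mult_right_mono)
qed

text \<open>Fubini at one fixed \<open>t\<close>. The pointwise form yields both versions needed
  later: at every \<open>t\<close> for bounded \<open>f\<close>, and at almost every
  \<open>t\<close> for integrable \<open>f\<close>.\<close>

lemma line_conv_assoc_at:
  fixes f g h :: "real \<Rightarrow> real"
  assumes [measurable]: "f \<in> borel_measurable borel" and g: "integrable lborel g" and h: "integrable lborel h"
    and int: "integrable lborel (\<lambda>s. \<bar>f (t - s)\<bar> * line_conv (\<lambda>s. \<bar>g s\<bar>) (\<lambda>s. \<bar>h s\<bar>) s)"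
  shows "line_conv (line_conv f g) h t = line_conv f (line_conv g h) t"
proof -
  have [measurable]: "g \<in> borel_measurable borel" "h \<in> borel_measurable borel"
    using g h by auto
  let ?F = "\<lambda>s r. f (t - s) * (g (s - r) * h r)"
  \<comment> \<open>Integrals that do not exist have the value 0, so \<open>int\<close> controls the
    double integral of the norms only together with this integrability almost everywhere.\<close>
  have ae: "AE s in lborel. integrable lborel (?F s)"
    using AE_integrable_conv[OF g h] by (auto elim!: eventually_mono)
  have "integrable (lborel \<Otimes>\<^sub>M lborel) (\<lambda>(s, r). ?F s r)"
  proof (rule lborel_pair.Fubini_integrable)
    show "integrable lborel (\<lambda>s. LINT r|lborel. norm (case (s, r) of (s, r) \<Rightarrow> ?F s r))"
      using int by (simp add: abs_mult line_conv_def)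
    show "AE s in lborel. integrable lborel (\<lambda>r. case (s, r) of (s, r) \<Rightarrow> ?F s r)"
      using ae by simp
  qed measurable
  from lborel_pair.Fubini_integral[of ?F, OF this]
  have "(LINT r|lborel. LINT s|lborel. ?F s r) = (LINT s|lborel. LINT r|lborel. ?F s r)" .
  moreover have "(LINT s|lborel. ?F s r) = line_conv f g (t - r) * h r" for r
  proof -
    have "(LINT s|lborel. ?F s r) = (LINT s|lborel. (f (t - s) * g (s - r)) * h r)"
      by (simp add: mult.assoc)
    also have "\<dots> = (LINT s|lborel. f (t - s) * g (s - r)) * h r"
      by simp
    also have "(LINT s|lborel. f (t - s) * g (s - r)) = line_conv f g (t - r)"
      using integral_shift[of "\<lambda>s. f (t - r - s) * g s" r] by (simp add: line_conv_def)
    finally show ?thesis .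
  qed
  ultimately show ?thesis
    by (simp add: line_conv_def[of "line_conv f g"] line_conv_def[of f "line_conv g h"] line_conv_def[of g])
qed

lemma line_conv_assoc_bounded:
  fixes f g h :: "real \<Rightarrow> real"
  assumes "f \<in> borel_measurable borel" "\<And>s. \<bar>f s\<bar> \<le> B" "integrable lborel g" "integrable lborel h"
  shows "line_conv (line_conv f g) h t = line_conv f (line_conv g h) t"
  using assms
  by (intro line_conv_assoc_at integrable_bounded_conv[where B=B] integrable_line_conv) auto

lemma line_conv_assoc_AE:
  fixes f g h :: "real \<Rightarrow> real"
  assumes "integrable lborel f" "integrable lborel g" "integrable lborel h"
  shows "AE t in lborel. line_conv (line_conv f g) h t = line_conv f (line_conv g h) t"
proof -
  have "AE t in lborel. integrable lborel (\<lambda>s. \<bar>f (t - s)\<bar> * line_conv (\<lambda>s. \<bar>g s\<bar>) (\<lambda>s. \<bar>h s\<bar>) s)"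
    using assms by (intro AE_integrable_conv[of "\<lambda>s. \<bar>f s\<bar>"] integrable_line_conv) auto
  then show ?thesis
    by eventually_elim (use assms in \<open>auto intro!: line_conv_assoc_at\<close>)
qed

lemma line_conv_diff_right:
  assumes "integrable lborel (\<lambda>s. f (t - s) * g s)" "integrable lborel (\<lambda>s. f (t - s) * h s)"
  shows "line_conv f (\<lambda>s. g s - h s) t = line_conv f g t - line_conv f h t"
  using Bochner_Integration.integral_diff[OF assms] by (simp add: line_conv_def right_diff_distrib)

lemma line_conv_cmult_right: "line_conv f (\<lambda>s. c * g s) t = c * line_conv f g t"
  by (simp add: line_conv_def mult.left_commute[of _ c])

lemma line_conv_nonneg:
  assumes "\<And>s. 0 \<le> f s" "AE s in lborel. 0 \<le> g s"
  shows "0 \<le> line_conv f g t"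
  unfolding line_conv_def using assms by (intro integral_nonneg_AE) auto

lemma line_conv_mono:
  assumes "\<And>s. 0 \<le> f s" "AE s in lborel. g s \<le> h s"
    and "integrable lborel (\<lambda>s. f (t - s) * g s)" "integrable lborel (\<lambda>s. f (t - s) * h s)"
  shows "line_conv f g t \<le> line_conv f h t"
  unfolding line_conv_def using assms(2)
  by (intro integral_mono_AE assms(3,4)) (auto elim!: eventually_mono intro!: mult_left_mono assms(1))

text \<open>A kernel that vanishes for nonpositive arguments sees only the past, so relations that
  hold almost everywhere before \<open>T\<close> may be used under the convolution up to time
  \<open>T\<close>.\<close>

lemma line_conv_cong_causal:
  assumes "AE s in lborel. s < T \<longrightarrow> g s = g' s" "t \<le> T" "\<And>s. s \<le> 0 \<Longrightarrow> f s = 0"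
    and [measurable]: "f \<in> borel_measurable borel" "g \<in> borel_measurable borel" "g' \<in> borel_measurable borel"
  shows "line_conv f g t = line_conv f g' t"
  unfolding line_conv_def
proof (rule integral_cong_AE)
  show "AE s in lborel. f (t - s) * g s = f (t - s) * g' s"
    using assms(1)
  proof eventually_elim
    case (elim s)
    then show ?case
      using assms(2,3) by (cases "s < t") auto
  qed
qed measurable

lemma line_conv_eq_0_of_causal:
  assumes "\<And>s. s \<le> 0 \<Longrightarrow> f s = 0" "\<And>s. s \<le> 0 \<Longrightarrow> g s = 0" "t \<le> 0"
  shows "line_conv f g t = 0"
proof -
  have *: "f (t - s) * g s = 0" for s
  proof (cases "s \<le> 0")
    case False
    then have "t - s \<le> 0" using assms(3) by simp
    then show ?thesis using assms(1) by simp
  qed (use assms(2) in auto)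
  show ?thesis by (simp add: line_conv_def *)
qed

section \<open>Monotone kernels and their regularisation\<close>

text \<open>The point 0 is excluded because a monotone kernel is controlled on the open half-line
  only. Extension by zero makes a locally integrable kernel integrable on the line.\<close>

definition cutoff :: "real \<Rightarrow> (real \<Rightarrow> 'a) \<Rightarrow> real \<Rightarrow> 'a::zero" where
  "cutoff T f t = (if 0 < t \<and> t \<le> T then f t else 0)"

lemma cutoff_eq[simp]: "0 < t \<Longrightarrow> t \<le> T \<Longrightarrow> cutoff T f t = f t"
  and cutoff_nonpos[simp]: "t \<le> 0 \<Longrightarrow> cutoff T f t = 0"
  and cutoff_above[simp]: "T < t \<Longrightarrow> cutoff T f t = 0"
  by (auto simp: cutoff_def)

lemma borel_measurable_cutoff[measurable]:
  fixes f :: "real \<Rightarrow> real"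
  assumes [measurable]: "f \<in> borel_measurable borel"
  shows "cutoff T f \<in> borel_measurable borel"
  unfolding cutoff_def[abs_def] by measurable

lemma cutoff_cutoff: "S \<le> T \<Longrightarrow> cutoff S (cutoff T f) = cutoff S f"
  by (auto simp: cutoff_def fun_eq_iff)

lemma cutoff_indicator: "cutoff T f s = indicator {0<..T} s * f s" for f :: "real \<Rightarrow> real"
  by (auto simp: cutoff_def indicator_def)

lemma integrable_cutoff:
  fixes f :: "real \<Rightarrow> real"
  assumes "integrable lborel f"
  shows "integrable lborel (cutoff T f)"
  using integrable_mult_indicator[OF _ assms, of "{0<..T}"] by (simp add: cutoff_indicator[abs_def])

lemma AE_lborel_neq: "AE s in lborel. s \<noteq> (a :: real)"
  by (rule AE_lborel_singleton)

text \<open>The theorem integrates over Lebesgue measure on intervals, whereas Fubini is applied to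
  Borel measure on the line. Here \<open>f\<close> may fail to be Borel: agreement almost everywhere
  with the Borel function \<open>f'\<close> makes its extension by zero Lebesgue measurable, because
  Lebesgue measure is complete.\<close>

lemma lebesgue_on_lborel:
  fixes f f' :: "real \<Rightarrow> real"
  assumes S[measurable]: "S \<in> sets borel" and f'[measurable]: "f' \<in> borel_measurable borel"
    and ae: "AE x in lborel. (if x \<in> S then f x else 0) = f' x"
  shows integrable_lebesgue_on_lborel: "integrable (lebesgue_on S) f \<longleftrightarrow> integrable lborel f'"
    and integral_lebesgue_on_lborel: "integral\<^sup>L (lebesgue_on S) f = integral\<^sup>L lborel f'"
proof -
  have ae': "AE x in lebesgue. indicator S x *\<^sub>R f x = f' x"
    using AE_completion[OF ae] by eventually_elim (auto split: if_splits)
  have f'l: "f' \<in> borel_measurable lebesgue"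
    using f' by (intro measurable_completion) simp
  then have fl: "(\<lambda>x. indicator S x *\<^sub>R f x) \<in> borel_measurable lebesgue"
    by (rule borel_measurable_AE) (use ae' in \<open>auto elim!: eventually_mono\<close>)
  have "integrable (lebesgue_on S) f \<longleftrightarrow> integrable lebesgue (\<lambda>x. indicator S x *\<^sub>R f x)"
    by (subst integrable_restrict_space) auto
  also have "\<dots> \<longleftrightarrow> integrable lebesgue f'"
    by (intro integrable_cong_AE fl f'l ae')
  also have "\<dots> \<longleftrightarrow> integrable lborel f'"
    by (rule integrable_completion) simp
  finally show "integrable (lebesgue_on S) f \<longleftrightarrow> integrable lborel f'" .
  have "integral\<^sup>L (lebesgue_on S) f = integral\<^sup>L lebesgue (\<lambda>x. indicator S x *\<^sub>R f x)"
    by (subst integral_restrict_space) auto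
  also have "\<dots> = integral\<^sup>L lebesgue f'"
    by (intro integral_cong_AE fl f'l ae')
  also have "\<dots> = integral\<^sup>L lborel f'"
    by (rule integral_completion) simp
  finally show "integral\<^sup>L (lebesgue_on S) f = integral\<^sup>L lborel f'" .
qed

context
  fixes k :: "real \<Rightarrow> real"
  assumes k: "monotone_kernel k"
begin

lemma kernel_nonneg: "0 < t \<Longrightarrow> 0 \<le> k t"
  using k by (simp add: monotone_kernel_def)

lemma kernel_antimono: "0 < s \<Longrightarrow> s \<le> t \<Longrightarrow> k t \<le> k s"
  using k by (simp add: monotone_kernel_def monotone_on_def)

lemma borel_measurable_kernel[measurable]: "cutoff T k \<in> borel_measurable borel"
proof -
  have "mono_on {0<..} (\<lambda>t. - k t)"
    using kernel_antimono by (auto simp: mono_on_def)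
  then have "(\<lambda>t. - k t) \<in> borel_measurable (restrict_space borel {0<..})"
    by (rule borel_measurable_mono_on_fnc)
  then have "(\<lambda>t. - (- k t)) \<in> borel_measurable (restrict_space borel {0<..})"
    by (rule borel_measurable_uminus)
  then have [measurable]: "(\<lambda>t. indicator {0<..} t *\<^sub>R k t) \<in> borel_measurable borel"
    by (subst (asm) borel_measurable_restrict_space_iff) auto
  have "cutoff T (\<lambda>t. indicator {0<..} t *\<^sub>R k t) = cutoff T k"
    by (auto simp: cutoff_def fun_eq_iff)
  moreover have "cutoff T (\<lambda>t. indicator {0<..} t *\<^sub>R k t) \<in> borel_measurable borel"
    by measurable
  ultimately show ?thesis by (simp only:)
qed

lemma integrable_kernel: "integrable lborel (cutoff T k)"
proof (cases "0 < T")
  case True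
  then have "integrable (lebesgue_on {0..T}) k"
    using k by (simp add: monotone_kernel_def)
  moreover have "AE x in lborel. (if x \<in> {0..T} then k x else 0) = cutoff T k x"
    using AE_lborel_neq[of 0] by eventually_elim (auto simp: cutoff_def)
  ultimately show ?thesis
    by (subst (asm) integrable_lebesgue_on_lborel) auto
next
  case False
  then have "cutoff T k = (\<lambda>t. 0)"
    by (auto simp: cutoff_def fun_eq_iff)
  then show ?thesis by simp
qed

lemma cutoff_kernel_nonneg: "0 \<le> cutoff T k t"
  using kernel_nonneg by (simp add: cutoff_def)

lemma conv_line_conv:
  assumes "f' \<in> borel_measurable borel" "\<And>s. s \<le> 0 \<Longrightarrow> f' s = 0" "0 < t" "t \<le> T"
    and "AE s in lborel. 0 < s \<and> s < t \<longrightarrow> f s = f' s"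
  shows conv_integrable_line_conv: "conv_integrable k f t \<longleftrightarrow> integrable lborel (\<lambda>s. cutoff T k (t - s) * f' s)"
    and conv_eq_line_conv: "conv k f t = line_conv (cutoff T k) f' t"
proof -
  have [measurable]: "f' \<in> borel_measurable borel" by fact
  have meas: "(\<lambda>s. cutoff T k (t - s) * f' s) \<in> borel_measurable borel"
    by measurable
  \<comment> \<open>\<open>k 0\<close> and \<open>f 0\<close> are arbitrary, but they enter the
    closed interval only at \<open>s = t\<close> and \<open>s = 0\<close>.\<close>
  have ae: "AE s in lborel. (if s \<in> {0..t} then k (t - s) * f s else 0) = cutoff T k (t - s) * f' s"
    using assms(5) AE_lborel_neq[of 0] AE_lborel_neq[of t]
    by eventually_elim (use assms(2-4) in \<open>auto simp: cutoff_def\<close>)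
  show "conv_integrable k f t \<longleftrightarrow> integrable lborel (\<lambda>s. cutoff T k (t - s) * f' s)"
    unfolding conv_integrable_def by (rule integrable_lebesgue_on_lborel[OF _ meas ae]) simp
  show "conv k f t = line_conv (cutoff T k) f' t"
    unfolding conv_def line_conv_def by (rule integral_lebesgue_on_lborel[OF _ meas ae]) simp
qed

end

text \<open>Both horizons may be chosen freely beyond \<open>t\<close>, since the product of the two
  cut off kernels lives on (0, t).\<close>

lemma line_conv_conjugate:
  assumes k: "monotone_kernel k" and l: "conjugate_kernel k l" and "0 < t" "t \<le> T" "t \<le> S"
  shows "line_conv (cutoff T k) (cutoff S l) t = 1"
proof -
  have "monotone_kernel l" using l by (simp add: conjugate_kernel_def)
  then have "conv k l t = line_conv (cutoff T k) (cutoff S l) t"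
    using assms by (intro conv_eq_line_conv) (auto intro!: borel_measurable_kernel)
  then show ?thesis using l \<open>0 < t\<close> by (simp add: conjugate_kernel_def)
qed

lemma set_integral_Ioc_split:
  fixes f :: "real \<Rightarrow> real"
  assumes "integrable lborel f" "a \<le> b" "b \<le> c"
  shows "(LINT s:{a<..c}|lborel. f s) = (LINT s:{a<..b}|lborel. f s) + (LINT s:{b<..c}|lborel. f s)"
proof -
  have "set_integrable lborel A f" if "A \<in> sets borel" for A
    unfolding set_integrable_def using that assms by (intro integrable_mult_indicator) auto
  then have "(LINT s:{a<..b} \<union> {b<..c}|lborel. f s) = (LINT s:{a<..b}|lborel. f s) + (LINT s:{b<..c}|lborel. f s)"
    by (intro set_integral_Un) auto
  moreover have "{a<..b} \<union> {b<..c} = {a<..c}" using assms by auto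
  ultimately show ?thesis by simp
qed

text \<open>The kernel \<open>t \<mapsto> c - \<integral>\<^sub>0\<^sup>t p\<close> is the moving average \<open>(1/\<epsilon>) \<integral>\<^sub>t\<^sup>t\<^sup>+\<^sup>\<epsilon> k\<close>, a bounded
  nonincreasing regularisation of \<open>k\<close>; \<open>\<rho>\<close> is the derivative of its convolution with \<open>l\<close>.\<close>

lemma regularised_kernel:
  assumes k: "monotone_kernel k" and l: "conjugate_kernel k l" and e: "0 < e" and T: "0 < T"
  obtains c p \<rho> where
    "integrable lborel p" "integrable lborel \<rho>" "0 \<le> c"
    "\<And>s. 0 \<le> p s" "\<And>s. s \<le> 0 \<Longrightarrow> p s = 0" "\<And>s. 0 \<le> \<rho> s" "\<And>s. s \<le> 0 \<or> T < s \<Longrightarrow> \<rho> s = 0"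
    "\<And>t. 0 < t \<Longrightarrow> t \<le> T \<Longrightarrow> \<rho> t = c * l t - line_conv p (cutoff T l) t"
    "\<And>t. 0 < t \<Longrightarrow> t \<le> T \<Longrightarrow> (LINT s|lborel. cutoff t p s) \<le> c"
    "\<And>t. 0 < t \<Longrightarrow> t \<le> T \<Longrightarrow> (LINT s|lborel. cutoff t \<rho> s) \<le> 1"
    "\<And>t. 0 < t \<Longrightarrow> t \<le> T \<Longrightarrow> 1 - l t * (LINT s|lborel. cutoff e k s) \<le> (LINT s|lborel. cutoff t \<rho> s)"
proof -
  have ml: "monotone_kernel l" using l by (simp add: conjugate_kernel_def)
  note k_int = integrable_kernel[OF k] and l_int = integrable_kernel[OF ml]
  note [measurable] = borel_measurable_kernel[OF k] borel_measurable_kernel[OF ml]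
  note k_anti = kernel_antimono[OF k] and k_nn = kernel_nonneg[OF k]
  note l_anti = kernel_antimono[OF ml] and l_nn = kernel_nonneg[OF ml]
  \<comment> \<open>The shifted values k(s + e) with s \<le> T must survive the cutoff.\<close>
  define S where "S = T + e"
  define c where "c = (LINT s|lborel. cutoff e k s) / e"
  define p where "p = cutoff T (\<lambda>s. (cutoff S k s - cutoff S k (s + e)) / e)"
  define L where "L = cutoff T l"
  define \<rho> where "\<rho> = cutoff T (\<lambda>t. c * L t - line_conv p L t)"
  \<comment> \<open>\<open>B t\<close> is the share of (t, t + e] in the conjugacy integral at time
    t + e. It turns out to be e times the value of p * l at t.\<close>
  define B where "B t = (LINT s:{t<..t + e}|lborel. cutoff S k (t + e - s) * cutoff S l s)" for t
  have shiftint: "integrable lborel (\<lambda>s. cutoff S k (s + e))"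
    using integrable_shift[of "cutoff S k" "-e"] k_int by simp
  have p_int: "integrable lborel p"
    unfolding p_def using k_int shiftint by (intro integrable_cutoff) auto
  have L_int: "integrable lborel L"
    unfolding L_def by (rule l_int)
  have [measurable]: "p \<in> borel_measurable borel" "L \<in> borel_measurable borel"
    using p_int L_int by auto
  have \<rho>_int: "integrable lborel \<rho>"
    unfolding \<rho>_def using integrable_line_conv[OF p_int L_int] L_int by (intro integrable_cutoff) auto
  have p_nn: "0 \<le> p s" for s
    using k_anti[of s "s + e"] e T by (auto simp: p_def cutoff_def S_def)
  have c_nn: "0 \<le> c"
    unfolding c_def using e cutoff_kernel_nonneg[OF k] by (intro divide_nonneg_pos integral_nonneg_AE) auto
  have one_int: "integrable lborel (\<lambda>s. cutoff S k (t + e - s) * cutoff S l s)"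
    and one: "(LINT s|lborel. cutoff S k (t + e - s) * cutoff S l s) = 1" if "0 < t" "t \<le> T" for t
  proof -
    show eq: "(LINT s|lborel. cutoff S k (t + e - s) * cutoff S l s) = 1"
      using line_conv_conjugate[OF k l, of "t + e" S S] that e by (simp add: line_conv_def S_def)
    \<comment> \<open>Conjugacy prescribes only the value 1 of the integral; as non-integrable
      functions have integral 0, this value forces integrability.\<close>
    show "integrable lborel (\<lambda>s. cutoff S k (t + e - s) * cutoff S l s)"
      by (rule ccontr) (use eq not_integrable_integral_eq in force)
  qed
  have A_eq: "(LINT s:{0<..t}|lborel. cutoff S k (t + e - s) * cutoff S l s) = 1 - B t"
    if "0 < t" "t \<le> T" for t
  proof -
    have "(LINT s:{0<..t+e}|lborel. cutoff S k (t + e - s) * cutoff S l s) = 1"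
      unfolding one[OF that, symmetric] set_lebesgue_integral_def
      by (rule Bochner_Integration.integral_cong)
        (use that in \<open>auto simp: indicator_def cutoff_def split: if_splits\<close>)
    then show ?thesis
      using set_integral_Ioc_split[OF one_int[OF that], of 0 t "t + e"] that e by (simp add: B_def)
  qed
  \<comment> \<open>Here the monotonicity of \<open>l\<close> enters, and with it the sign of
    \<rho>: on (t, t + e] the kernel \<open>l\<close> is at most \<open>l t\<close>, and what
    remains is the integral of \<open>k\<close> over (0, e], that is e * c.\<close>
  have B_le: "B t \<le> l t * (e * c)" if "0 < t" "t \<le> T" for t
  proof -
    have "B t \<le> (LINT s|lborel. l t * cutoff e k (t + e - s))"
      unfolding B_def set_lebesgue_integral_def
    proof (rule integral_mono_AE)
      show "integrable lborel (\<lambda>s. indicator {t<..t + e} s *\<^sub>R (cutoff S k (t + e - s) * cutoff S l s))"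
        using one_int[OF that] by (intro integrable_mult_indicator) auto
      show "integrable lborel (\<lambda>s. l t * cutoff e k (t + e - s))"
        using integrable_reflect_shift[of "cutoff e k" "t + e"] k_int by auto
      show "AE s in lborel. indicator {t<..t + e} s *\<^sub>R (cutoff S k (t + e - s) * cutoff S l s)
          \<le> l t * cutoff e k (t + e - s)"
      proof (rule AE_I2)
        fix s
        show "indicator {t<..t + e} s *\<^sub>R (cutoff S k (t + e - s) * cutoff S l s) \<le> l t * cutoff e k (t + e - s)"
        proof (cases "t < s \<and> s < t + e")
          case True
          then have "cutoff S k (t + e - s) = k (t + e - s)" "cutoff S l s = l s" "cutoff e k (t + e - s) = k (t + e - s)"
            using that e T by (auto simp: S_def)
          then show ?thesis
            using True l_anti[of t s] k_nn[of "t + e - s"] that by (simp add: mult.commute mult_right_mono)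
        next
          case False
          then show ?thesis
            using cutoff_kernel_nonneg[OF k] l_nn that by (cases "s = t + e") (auto simp: indicator_def)
        qed
      qed
    qed
    also have "\<dots> = l t * (e * c)"
      using e integral_reflect_shift[of "cutoff e k" "t + e"] by (simp add: c_def)
    finally show ?thesis .
  qed
  \<comment> \<open>Inside the cutoff e * p(s) is k(s) - k(s + e), so the left-hand side is the
    conjugacy integral at \<open>t\<close> minus the part over (0, t] of the one at t + e.\<close>
  have pL: "e * line_conv p L t = B t" if t: "0 < t" "t \<le> T" for t
  proof -
    have "e * line_conv p L t = (LINT s|lborel. e * (p (t - s) * L s))"
      by (simp add: line_conv_def)
    also have "\<dots> = (LINT s|lborel. cutoff S k (t - s) * cutoff S l s
        - indicator {0<..t} s *\<^sub>R (cutoff S k (t + e - s) * cutoff S l s))"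
    proof (rule integral_cong_AE)
      show "AE s in lborel. e * (p (t - s) * L s) = cutoff S k (t - s) * cutoff S l s
        - indicator {0<..t} s *\<^sub>R (cutoff S k (t + e - s) * cutoff S l s)"
        using AE_lborel_neq[of t]
      proof eventually_elim
        case (elim s)
        show ?case
        proof (cases "0 < s \<and> s < t")
          case True
          then show ?thesis using e that T
            by (simp add: p_def L_def S_def field_simps)
        next
          case False
          then show ?thesis
            using elim by (cases "s \<le> 0") (auto simp: p_def L_def)
        qed
      qed
    qed measurable
    also have "\<dots> = 1 - (1 - B t)"
    proof (subst Bochner_Integration.integral_diff)
      have *: "(LINT s|lborel. cutoff S k (t - s) * cutoff S l s) = 1"
        using line_conv_conjugate[OF k l, of t S S] that e by (simp add: line_conv_def S_def)
      then show "integrable lborel (\<lambda>s. cutoff S k (t - s) * cutoff S l s)"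
        using not_integrable_integral_eq by force
      show "integrable lborel (\<lambda>s. indicator {0<..t} s *\<^sub>R (cutoff S k (t + e - s) * cutoff S l s))"
        using one_int[OF that] by (intro integrable_mult_indicator) auto
      show "(LINT s|lborel. cutoff S k (t - s) * cutoff S l s)
         - (LINT s|lborel. indicator {0<..t} s *\<^sub>R (cutoff S k (t + e - s) * cutoff S l s)) = 1 - (1 - B t)"
        using A_eq[OF that] * by (simp add: set_lebesgue_integral_def)
    qed
    finally show ?thesis by simp
  qed
  have \<rho>_nn: "0 \<le> \<rho> t" for t
  proof (cases "0 < t \<and> t \<le> T")
    case True
    then have "e * line_conv p L t \<le> e * (c * l t)"
      using pL[of t] B_le[of t] by (simp add: mult_ac)
    then show ?thesis using True e by (simp add: \<rho>_def L_def)
  qed (auto simp: \<rho>_def)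
  define \<kappa> where "\<kappa> t = (LINT s:{t<..t + e}|lborel. cutoff S k s) / e" for t
  have P_eq: "(LINT s|lborel. cutoff t p s) = c - \<kappa> t" if t: "0 < t" "t \<le> T" for t
  proof -
    have "(LINT s|lborel. cutoff t p s) = (LINT s|lborel.
        (indicator {0<..t} s *\<^sub>R cutoff S k s - indicator {e<..t+e} (s + e) *\<^sub>R cutoff S k (s + e)) / e)"
      by (rule Bochner_Integration.integral_cong) (use t in \<open>auto simp: cutoff_def p_def indicator_def\<close>)
    also have "\<dots> = ((LINT s|lborel. indicator {0<..t} s *\<^sub>R cutoff S k s)
       - (LINT s|lborel. indicator {e<..t+e} (s + e) *\<^sub>R cutoff S k (s + e))) / e"
    proof (subst integral_divide_zero, subst Bochner_Integration.integral_diff)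
      show "integrable lborel (\<lambda>s. indicator {0<..t} s *\<^sub>R cutoff S k s)"
        using k_int by (intro integrable_mult_indicator) auto
      show "integrable lborel (\<lambda>s. indicator {e<..t+e} (s + e) *\<^sub>R cutoff S k (s + e))"
        using integrable_shift[of "\<lambda>s. indicator {e<..t+e} s *\<^sub>R cutoff S k s" "-e"]
          integrable_mult_indicator[OF _ k_int, of "{e<..t+e}"] by simp
    qed simp
    also have "(LINT s|lborel. indicator {e<..t+e} (s + e) *\<^sub>R cutoff S k (s + e))
        = (LINT s:{e<..t+e}|lborel. cutoff S k s)"
      using integral_shift[of "\<lambda>s. indicator {e<..t+e} s *\<^sub>R cutoff S k s" "-e"]
      by (simp add: set_lebesgue_integral_def)
    also have "(LINT s|lborel. indicator {0<..t} s *\<^sub>R cutoff S k s) = (LINT s:{0<..t}|lborel. cutoff S k s)"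
      by (simp add: set_lebesgue_integral_def)
    \<comment> \<open>The interval (0, t + e] is split once at \<open>t\<close> and once at
      \<open>e\<close>, so the difference telescopes to the windows at 0 and at \<open>t\<close>.
      Thus \<open>c\<close> is the moving average at 0.\<close>
    also have "(LINT s:{0<..t}|lborel. cutoff S k s) - (LINT s:{e<..t+e}|lborel. cutoff S k s)
      = (LINT s:{0<..e}|lborel. cutoff S k s) - (LINT s:{t<..t+e}|lborel. cutoff S k s)"
      using set_integral_Ioc_split[OF k_int[of S], of 0 t "t + e"]
        set_integral_Ioc_split[OF k_int[of S], of 0 e "t + e"] t e by simp
    also have "(LINT s:{0<..e}|lborel. cutoff S k s) = e * c"
      unfolding set_lebesgue_integral_def c_def using e T
      by (auto intro!: Bochner_Integration.integral_cong simp: cutoff_def indicator_def S_def)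
    finally show ?thesis using e by (simp add: \<kappa>_def field_simps)
  qed
  have const_int: "(LINT s|lborel. indicator {t<..t + e} s *\<^sub>R x) = e * x" for x t :: real
    using e by simp
  have const_integrable: "integrable lborel (\<lambda>s. indicator {t<..t + e} s *\<^sub>R x)" for x t :: real
    using e by (intro integrable_real_indicator integrable_scaleR_left) auto
  have \<kappa>_le: "\<kappa> t \<le> k t" and \<kappa>_ge: "k (t + e) \<le> \<kappa> t" if "0 < t" "t \<le> T" for t
  proof -
    have "e * \<kappa> t = (LINT s|lborel. indicator {t<..t + e} s *\<^sub>R cutoff S k s)"
      using e by (simp add: \<kappa>_def set_lebesgue_integral_def)
    moreover have ind: "integrable lborel (\<lambda>s. indicator {t<..t + e} s *\<^sub>R cutoff S k s)"
      using k_int by (intro integrable_mult_indicator) auto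
    moreover have "(LINT s|lborel. indicator {t<..t + e} s *\<^sub>R cutoff S k s) \<le> e * k t"
      unfolding const_int[symmetric, of _ t]
    proof (rule integral_mono[OF ind const_integrable])
      show "indicator {t<..t + e} s *\<^sub>R cutoff S k s \<le> indicator {t<..t + e} s *\<^sub>R k t" for s
        using k_anti[of t s] that by (auto simp: indicator_def cutoff_def S_def)
    qed
    moreover have "e * k (t + e) \<le> (LINT s|lborel. indicator {t<..t + e} s *\<^sub>R cutoff S k s)"
      unfolding const_int[symmetric, of _ t]
    proof (rule integral_mono[OF const_integrable ind])
      show "indicator {t<..t + e} s *\<^sub>R k (t + e) \<le> indicator {t<..t + e} s *\<^sub>R cutoff S k s" for s
        using k_anti[of s "t + e"] that by (auto simp: indicator_def cutoff_def S_def)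
    qed
    ultimately have "e * \<kappa> t \<le> e * k t" "e * k (t + e) \<le> e * \<kappa> t" by auto
    then show "\<kappa> t \<le> k t" "k (t + e) \<le> \<kappa> t" using e by auto
  qed
  have \<kappa>_nn: "0 \<le> \<kappa> t" if "0 < t" "t \<le> T" for t
    using \<kappa>_ge[OF that] k_nn[of "t + e"] that e by simp
  have R_eq: "(LINT s|lborel. cutoff t \<rho> s) = (LINT s|lborel. cutoff t \<kappa> (t - s) * L s)"
    and K_int: "integrable lborel (\<lambda>s. cutoff t \<kappa> (t - s) * L s)" if t: "0 < t" "t \<le> T" for t
  proof -
    \<comment> \<open>Convolving with \<open>J\<close> at time \<open>t\<close> integrates over (0,
      t]; the half-open interval is reversed because the argument is t - s. Associativity moves this
      integration onto \<open>p\<close>, where it produces c - \<kappa>, so the mass of \<rho>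
      becomes a convolution of \<kappa> with \<open>l\<close>.\<close>
    define J where "J = (indicator {0..<t} :: real \<Rightarrow> real)"
    have [measurable]: "J \<in> borel_measurable borel" by (simp add: J_def)
    have J1: "\<bar>J s\<bar> \<le> 1" for s by (simp add: J_def indicator_def)
    have Jp: "integrable lborel (\<lambda>s. line_conv J p (t - s) * L s)"
    proof (rule integrable_bounded_conv[where B="1 * (LINT s|lborel. \<bar>p s\<bar>)"])
      fix s
      have "\<bar>line_conv J p s\<bar> \<le> (LINT r|lborel. \<bar>J (s - r) * p r\<bar>)"
        unfolding line_conv_def by (rule integral_abs_bound)
      also have "\<dots> \<le> (LINT r|lborel. \<bar>p r\<bar>)"
      proof (rule integral_mono)
        show "integrable lborel (\<lambda>r. \<bar>J (s - r) * p r\<bar>)"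
          by (intro integrable_abs integrable_bounded_conv[OF _ J1 p_int]) measurable
        show "\<bar>J (s - r) * p r\<bar> \<le> \<bar>p r\<bar>" for r
          using J1 by (simp add: abs_mult mult_left_le_one_le)
      qed (use p_int in auto)
      finally show "\<bar>line_conv J p s\<bar> \<le> 1 * (LINT s|lborel. \<bar>p s\<bar>)" by simp
    qed (auto simp: L_int)
    have cL: "integrable lborel (\<lambda>s. J (t - s) * (c * L s))"
      by (rule integrable_bounded_conv[OF _ J1]) (use L_int in auto)
    have JpL: "integrable lborel (\<lambda>s. J (t - s) * line_conv p L s)"
      by (intro integrable_bounded_conv[OF _ J1] integrable_line_conv p_int L_int) measurable
    \<comment> \<open>At \<open>s = t\<close> the two sides may differ: \<open>J 0\<close> is 1,
      whereas the cutoff removes \<kappa> at 0.\<close>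
    have eq: "c * (J (t - s) * L s) - line_conv J p (t - s) * L s = cutoff t \<kappa> (t - s) * L s"
      if s: "s \<noteq> t" for s
    proof (cases "0 < s \<and> s < t")
      case True
      then have "line_conv J p (t - s) = (LINT r|lborel. cutoff (t - s) p r)"
        unfolding line_conv_def
        by (intro Bochner_Integration.integral_cong) (auto simp: J_def indicator_def cutoff_def p_def)
      also have "\<dots> = c - \<kappa> (t - s)"
        using True t by (intro P_eq) auto
      finally have "line_conv J p (t - s) = c - \<kappa> (t - s)" .
      moreover have "J (t - s) = 1" using True by (simp add: J_def)
      ultimately show ?thesis using True
        by (simp add: left_diff_distrib)
    next
      case False
      then have "s \<le> 0 \<or> t - s \<le> 0" by auto
      moreover have "line_conv J p (t - s) = 0" if "t - s \<le> 0"
        unfolding line_conv_def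
        by (rule integral_eq_zero_AE) (use that in \<open>auto simp: J_def indicator_def p_def cutoff_def\<close>)
      ultimately show ?thesis using s
        by (auto simp: L_def J_def)
    qed
    have eqAE: "AE s in lborel. c * (J (t - s) * L s) - line_conv J p (t - s) * L s = cutoff t \<kappa> (t - s) * L s"
      using AE_lborel_neq[of t] by eventually_elim (rule eq)
    have [measurable]: "\<kappa> \<in> borel_measurable borel"
    proof -
      \<comment> \<open>The moving window is expressed by fixed sets evaluated at s - t and s - (t +
        e), which makes the integrand jointly measurable in \<open>s\<close> and
        \<open>t\<close>.\<close>
      have "(LINT s:{t<..t + e}|lborel. cutoff S k s) = (LINT s|lborel. indicator {t<..} s * (indicator {..0} (s - (t + e)) * cutoff S k s))" for t
        unfolding set_lebesgue_integral_def
        by (auto intro!: Bochner_Integration.integral_cong simp: indicator_def)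
      moreover have "(\<lambda>t. LINT s|lborel. indicator {0<..} (s - t) * (indicator {..0} (s - (t + e)) * cutoff S k s)) \<in> borel_measurable borel"
        by measurable
      moreover have "(indicator {t<..} s :: real) = indicator {0<..} (s - t)" for s t :: real
        by (auto simp: indicator_def)
      ultimately show ?thesis unfolding \<kappa>_def[abs_def] by simp
    qed
    have "(LINT s|lborel. cutoff t \<rho> s) = line_conv J (\<lambda>s. c * L s - line_conv p L s) t"
      unfolding line_conv_def[of J]
      by (intro Bochner_Integration.integral_cong) (use t in \<open>auto simp: J_def indicator_def cutoff_def \<rho>_def\<close>)
    also have "\<dots> = c * line_conv J L t - line_conv (line_conv J p) L t"
      using cL JpL by (simp add: line_conv_diff_right line_conv_cmult_right
          line_conv_assoc_bounded[of J, OF _ J1 p_int L_int])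
    also have "\<dots> = (LINT s|lborel. c * (J (t - s) * L s) - line_conv J p (t - s) * L s)"
      using cL Jp by (simp add: line_conv_def[of _ L] mult.left_commute)
    also have "\<dots> = (LINT s|lborel. cutoff t \<kappa> (t - s) * L s)"
      by (intro integral_cong_AE eqAE) measurable
    finally show "(LINT s|lborel. cutoff t \<rho> s) = (LINT s|lborel. cutoff t \<kappa> (t - s) * L s)" .
    show "integrable lborel (\<lambda>s. cutoff t \<kappa> (t - s) * L s)"
    proof (rule integrable_cong_AE_imp[OF _ _ eqAE])
      show "integrable lborel (\<lambda>s. c * (J (t - s) * L s) - line_conv J p (t - s) * L s)"
        using cL Jp by (auto simp: mult.left_commute)
    qed measurable
  qed
  show ?thesis
  proof
    show "integrable lborel p" "integrable lborel \<rho>" "0 \<le> c" by fact+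
    show "0 \<le> p s" "0 \<le> \<rho> s" for s by fact+
    show "p s = 0" if "s \<le> 0" for s using that by (simp add: p_def)
    show "\<rho> s = 0" if "s \<le> 0 \<or> T < s" for s using that by (auto simp: \<rho>_def)
    fix t assume t: "0 < t" "t \<le> T"
    show "\<rho> t = c * l t - line_conv p (cutoff T l) t"
      using t by (simp add: \<rho>_def L_def)
    show "(LINT s|lborel. cutoff t p s) \<le> c"
      using P_eq[OF t] \<kappa>_nn[OF t] by simp
    \<comment> \<open>A nonincreasing kernel dominates its averages to the right, so the mass of
      \<rho> is at most the conjugacy integral 1.\<close>
    have "(LINT s|lborel. cutoff t \<kappa> (t - s) * L s) \<le> line_conv (cutoff S k) (cutoff S l) t"
      unfolding line_conv_def
    proof (rule integral_mono[OF K_int[OF t]])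
      show "integrable lborel (\<lambda>s. cutoff S k (t - s) * cutoff S l s)"
        using line_conv_conjugate[OF k l, of t S S] t e not_integrable_integral_eq
        unfolding line_conv_def by (force simp: S_def)
      show "cutoff t \<kappa> (t - s) * L s \<le> cutoff S k (t - s) * cutoff S l s" for s
        using \<kappa>_le[of "t - s"] l_nn[of s] t e
        by (auto simp: cutoff_def L_def S_def intro!: mult_right_mono)
    qed
    then show "(LINT s|lborel. cutoff t \<rho> s) \<le> 1"
      using R_eq[OF t] line_conv_conjugate[OF k l, of t S S] t e by (simp add: S_def)
    \<comment> \<open>The average over a window is at least the value at its right end. This shifts
      \<open>k\<close> by \<open>e\<close> and leaves the part over (0, t] of the conjugacy integral
      at t + e.\<close>
    have "1 - B t \<le> (LINT s|lborel. cutoff t \<kappa> (t - s) * L s)"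
      unfolding A_eq[OF t, symmetric] set_lebesgue_integral_def
    proof (rule integral_mono_AE)
      show "integrable lborel (\<lambda>s. cutoff t \<kappa> (t - s) * L s)" by (rule K_int[OF t])
      show "integrable lborel (\<lambda>s. indicator {0<..t} s *\<^sub>R (cutoff S k (t + e - s) * cutoff S l s))"
        using one_int[OF t] by (intro integrable_mult_indicator) auto
      show "AE s in lborel. indicator {0<..t} s *\<^sub>R (cutoff S k (t + e - s) * cutoff S l s) \<le> cutoff t \<kappa> (t - s) * L s"
        using AE_lborel_neq[of t]
      proof eventually_elim
        case (elim s)
        show ?case
          using \<kappa>_ge[of "t - s"] l_nn[of s] t e elim
          by (auto simp: cutoff_def L_def S_def indicator_def algebra_simps intro!: mult_left_mono)
      qed
    qed
    then show "1 - l t * (LINT s|lborel. cutoff e k s) \<le> (LINT s|lborel. cutoff t \<rho> s)"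
      using B_le[OF t] R_eq[OF t] e by (simp add: c_def)
  qed
qed

section \<open>Pointwise limits of simple functions\<close>

text \<open>Pointwise limits of simple functions replace Borel measurability for values in a possibly
  non-separable space, where sums of Borel functions need not be Borel.\<close>

definition simple_limit :: "'a measure \<Rightarrow> ('a \<Rightarrow> 'b::real_normed_vector) \<Rightarrow> bool" where
  "simple_limit M f \<longleftrightarrow>
     (\<exists>s. (\<forall>i. simple_function M (s i)) \<and> (\<forall>x\<in>space M. (\<lambda>i. s i x) \<longlonglongrightarrow> f x))"

lemma simple_limitE:
  assumes "simple_limit M f"
  obtains s where "\<And>i. simple_function M (s i)" "\<And>x. x \<in> space M \<Longrightarrow> (\<lambda>i. s i x) \<longlonglongrightarrow> f x"
proof -
  from assms obtain s where "(\<forall>i. simple_function M (s i)) \<and> (\<forall>x\<in>space M. (\<lambda>i. s i x) \<longlonglongrightarrow> f x)"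
    unfolding simple_limit_def ..
  then show thesis
    by (intro that[of s]) simp_all
qed

lemma simple_limit_simple: "simple_function M f \<Longrightarrow> simple_limit M f"
  unfolding simple_limit_def by (intro exI[of _ "\<lambda>_. f"]) auto

lemma simple_limit_measurable:
  assumes "simple_limit M f"
  shows "f \<in> borel_measurable M"
proof -
  obtain s where s: "\<And>i. simple_function M (s i)" "\<And>x. x \<in> space M \<Longrightarrow> (\<lambda>i. s i x) \<longlonglongrightarrow> f x"
    by (rule simple_limitE[OF assms], rule that)
  show ?thesis
    by (rule borel_measurable_LIMSEQ_metric[where f=s]) (simp_all add: s borel_measurable_simple_function)
qed

lemma measurable_simple_limit:
  fixes f :: "'a \<Rightarrow> 'b::{real_normed_vector, second_countable_topology}"
  assumes "f \<in> borel_measurable M"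
  shows "simple_limit M f"
  using borel_measurable_implies_sequence_metric[OF assms, of 0] unfolding simple_limit_def by blast

lemma simple_limit_compose2:
  fixes h :: "'b::real_normed_vector \<Rightarrow> 'c::real_normed_vector \<Rightarrow> 'd::real_normed_vector"
  assumes "simple_limit M f" "simple_limit M g"
    and h: "\<And>X Y x y. X \<longlonglongrightarrow> x \<Longrightarrow> Y \<longlonglongrightarrow> y \<Longrightarrow> (\<lambda>i::nat. h (X i) (Y i)) \<longlonglongrightarrow> h x y"
  shows "simple_limit M (\<lambda>x. h (f x) (g x))"
proof -
  obtain s where s: "\<And>i. simple_function M (s i)" "\<And>x. x \<in> space M \<Longrightarrow> (\<lambda>i. s i x) \<longlonglongrightarrow> f x"
    by (rule simple_limitE[OF assms(1)], rule that)
  obtain s' where s': "\<And>i. simple_function M (s' i)" "\<And>x. x \<in> space M \<Longrightarrow> (\<lambda>i. s' i x) \<longlonglongrightarrow> g x"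
    by (rule simple_limitE[OF assms(2)], rule that)
  have "simple_function M (\<lambda>x. h (s i x) (s' i x))" for i
    by (rule simple_function_compose2[OF s(1) s'(1)])
  moreover have "(\<lambda>i. h (s i x) (s' i x)) \<longlonglongrightarrow> h (f x) (g x)" if "x \<in> space M" for x
    using that by (intro h[OF s(2) s'(2)])
  ultimately show ?thesis
    unfolding simple_limit_def by (intro exI[of _ "\<lambda>i x. h (s i x) (s' i x)"] conjI allI ballI)
qed

lemma simple_limit_diff: "simple_limit M f \<Longrightarrow> simple_limit M g \<Longrightarrow> simple_limit M (\<lambda>x. f x - g x)"
  by (rule simple_limit_compose2[where h="\<lambda>x y. x - y"]) (assumption | rule tendsto_diff)+

lemma simple_limit_scaleR: "simple_limit M f \<Longrightarrow> simple_limit M g \<Longrightarrow> simple_limit M (\<lambda>x. f x *\<^sub>R g x)"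
  by (rule simple_limit_compose2[where h="\<lambda>x y. x *\<^sub>R y"]) (assumption | rule tendsto_scaleR)+

lemma simple_limit_inner: "simple_limit M f \<Longrightarrow> simple_limit M g \<Longrightarrow> simple_limit M (\<lambda>x. f x \<bullet> g x)"
  by (rule simple_limit_compose2[where h="\<lambda>x y. x \<bullet> y"]) (assumption | rule tendsto_inner)+

lemma simple_limit_norm: "simple_limit M f \<Longrightarrow> simple_limit M (\<lambda>x. norm (f x))"
  by (rule simple_limit_compose2[where g=f and h="\<lambda>x y. norm x"]) (assumption | rule tendsto_norm)+

lemma simple_limit_const: "simple_limit M (\<lambda>x. c)"
  by (intro simple_limit_simple) simp

lemma simple_limit_if:
  assumes "simple_limit M f" and A: "A \<in> sets M"
  shows "simple_limit M (\<lambda>x. if x \<in> A then f x else 0)"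
proof -
  have "simple_limit M (\<lambda>x. indicator A x *\<^sub>R f x)"
    using A by (intro simple_limit_scaleR measurable_simple_limit[of "indicator A"] assms) auto
  moreover have "(\<lambda>x. indicator A x *\<^sub>R f x) = (\<lambda>x. if x \<in> A then f x else 0)"
    by (auto simp: indicator_def)
  ultimately show ?thesis by simp
qed

lemma simple_limit_comp:
  assumes "simple_limit N f" "T \<in> measurable M N"
  shows "simple_limit M (\<lambda>x. f (T x))"
proof -
  obtain s where s: "\<And>i. simple_function N (s i)" "\<And>x. x \<in> space N \<Longrightarrow> (\<lambda>i. s i x) \<longlonglongrightarrow> f x"
    by (rule simple_limitE[OF assms(1)], rule that)
  then have "\<And>i. simple_function M (\<lambda>x. s i (T x))"
    using simple_function_comp[OF assms(2)] by auto
  then show ?thesis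
    unfolding simple_limit_def using s(2) measurable_space[OF assms(2)]
    by (intro exI[of _ "\<lambda>i x. s i (T x)"]) auto
qed

lemma simple_limit_cong_sets: "sets N = sets M \<Longrightarrow> simple_limit M f \<longleftrightarrow> simple_limit N f"
  unfolding simple_limit_def
  by (simp add: simple_function_cong_algebra[of N M] sets_eq_imp_space_eq[of N M])

text \<open>Approximants larger than twice the limit are reset to 0. Where the limit is nonzero this
  affects only finitely many indices, thanks to the room left by the factor 2; where it is zero, all
  of them become 0. The bound serves dominated convergence.\<close>

lemma simple_limit_dominated:
  assumes "simple_limit M f"
  obtains s where "\<And>i. simple_function M (s i)" "\<And>x. x \<in> space M \<Longrightarrow> (\<lambda>i. s i x) \<longlonglongrightarrow> f x"
    "\<And>i x. x \<in> space M \<Longrightarrow> norm (s i x) \<le> 2 * norm (f x)"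
proof -
  obtain s where s: "\<And>i. simple_function M (s i)" "\<And>x. x \<in> space M \<Longrightarrow> (\<lambda>i. s i x) \<longlonglongrightarrow> f x"
    by (rule simple_limitE[OF assms], rule that)
  have [measurable]: "(\<lambda>x. norm (f x)) \<in> borel_measurable M"
    using simple_limit_norm[OF assms] by (rule simple_limit_measurable)
  have [measurable]: "(\<lambda>x. norm (s i x)) \<in> borel_measurable M" for i
    by (rule simple_limit_measurable[OF simple_limit_norm[OF simple_limit_simple[OF s(1)]]])
  define s' where "s' i x = (if norm (s i x) \<le> 2 * norm (f x) then s i x else 0)" for i x
  show ?thesis
  proof
    show "simple_function M (s' i)" for i
      unfolding s'_def by (intro simple_function_If s(1) simple_function_const) measurable
    show "norm (s' i x) \<le> 2 * norm (f x)" for i x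
      by (simp add: s'_def)
    fix x assume x: "x \<in> space M"
    show "(\<lambda>i. s' i x) \<longlonglongrightarrow> f x"
    proof (cases "f x = 0")
      case True
      then have "s' i x = 0" for i by (simp add: s'_def)
      then show ?thesis using True by simp
    next
      case False
      have "(\<lambda>i. norm (s i x)) \<longlonglongrightarrow> norm (f x)"
        using s(2)[OF x] by (rule tendsto_norm)
      moreover have "norm (f x) < 2 * norm (f x)" using False by simp
      ultimately have "eventually (\<lambda>i. norm (s i x) < 2 * norm (f x)) sequentially"
        by (rule order_tendstoD(2))
      then have "eventually (\<lambda>i. s i x = s' i x) sequentially"
        by eventually_elim (simp add: s'_def)
      then show ?thesis
        using s(2)[OF x] by (rule Lim_transform_eventually[rotated])
    qed
  qed
qed

section \<open>Continuity of translations\<close>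

abbreviation translate_continuous :: "(real \<Rightarrow> 'b::real_normed_vector) \<Rightarrow> bool" where
  "translate_continuous f \<equiv> ((\<lambda>r. LINT t|lborel. norm (f (t - r) - f t)) \<longlongrightarrow> 0) (at 0)"

lemma integrable_norm_shift:
  "integrable lborel (\<lambda>t. norm (f t)) \<Longrightarrow> integrable lborel (\<lambda>t. norm (f (t - r)))" for f :: "real \<Rightarrow> 'b::real_normed_vector"
  using integrable_shift[of "\<lambda>t. norm (f t)"] by simp

lemma simple_limit_translate_diff:
  fixes f :: "real \<Rightarrow> 'b::real_normed_vector"
  assumes "simple_limit borel f"
  shows "simple_limit borel (\<lambda>t. f (t - r) - f t)"
  by (intro simple_limit_diff assms simple_limit_comp[OF assms]) measurable

lemma integrable_norm_bound:
  fixes f :: "'a \<Rightarrow> 'b::real_normed_vector"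
  assumes "integrable M g" "simple_limit M f" "\<And>x. norm (f x) \<le> g x"
  shows "integrable M (\<lambda>x. norm (f x))"
  using assms(1)
proof (rule Bochner_Integration.integrable_bound)
  show "(\<lambda>x. norm (f x)) \<in> borel_measurable M"
    using simple_limit_measurable[OF simple_limit_norm[OF assms(2)]] .
  show "AE x in M. norm (norm (f x)) \<le> norm (g x)"
    using order_trans[OF assms(3) abs_ge_self] by auto
qed

lemma simple_limit_lborel: "simple_limit lborel f \<longleftrightarrow> simple_limit borel f"
  by (rule simple_limit_cong_sets) simp

lemma integrable_norm_diff:
  fixes f g :: "real \<Rightarrow> 'b::real_normed_vector"
  assumes "simple_limit borel f" "integrable lborel (\<lambda>t. norm (f t))"
    "simple_limit borel g" "integrable lborel (\<lambda>t. norm (g t))"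
  shows "integrable lborel (\<lambda>t. norm (f t - g t))"
  by (rule integrable_norm_bound[OF Bochner_Integration.integrable_add[OF assms(2,4)]])
    (auto simp: simple_limit_lborel norm_triangle_ineq4 intro: simple_limit_diff assms)

lemma integrable_norm_translate_diff:
  fixes f :: "real \<Rightarrow> 'b::real_normed_vector"
  assumes "simple_limit borel f" "integrable lborel (\<lambda>t. norm (f t))"
  shows "integrable lborel (\<lambda>t. norm (f (t - r) - f t))"
  by (intro integrable_norm_diff assms integrable_norm_shift simple_limit_comp[OF assms(1)]) measurable

text \<open>Translation preserves the L^1 distance of \<open>f\<close> and \<open>g\<close>, so this
  distance enters twice; hence the thirds of \<open>e\<close>.\<close>

lemma translate_continuous_approx:
  fixes f :: "real \<Rightarrow> 'b::real_normed_vector"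
  assumes f: "simple_limit borel f" "integrable lborel (\<lambda>t. norm (f t))"
    and approx: "\<And>e. 0 < e \<Longrightarrow> \<exists>g. simple_limit borel g \<and> integrable lborel (\<lambda>t. norm (g t)) \<and>
       (LINT t|lborel. norm (f t - g t)) < e \<and> translate_continuous g"
  shows "translate_continuous f"
proof (rule tendstoI)
  fix e :: real assume "0 < e"
  then obtain g where g: "simple_limit borel g" "integrable lborel (\<lambda>t. norm (g t))"
    and fg: "(LINT t|lborel. norm (f t - g t)) < e / 3" and cont: "translate_continuous g"
    using approx[of "e / 3"] by auto
  have "eventually (\<lambda>r. dist (LINT t|lborel. norm (g (t - r) - g t)) 0 < e / 3) (at 0)"
    using cont \<open>0 < e\<close> by (intro tendstoD) auto
  then show "eventually (\<lambda>r. dist (LINT t|lborel. norm (f (t - r) - f t)) 0 < e) (at 0)"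
  proof eventually_elim
    case (elim r)
    note fg_int = integrable_norm_diff[OF f g]
    note fg_int' = integrable_norm_shift[OF fg_int, of r]
    have "(LINT t|lborel. norm (f (t - r) - f t))
        \<le> (LINT t|lborel. norm (f (t - r) - g (t - r)) + norm (f t - g t) + norm (g (t - r) - g t))"
    proof (rule integral_mono)
      show "integrable lborel (\<lambda>t. norm (f (t - r) - g (t - r)) + norm (f t - g t) + norm (g (t - r) - g t))"
        using fg_int fg_int' integrable_norm_translate_diff[OF g] by auto
      show "norm (f (t - r) - f t) \<le> norm (f (t - r) - g (t - r)) + norm (f t - g t) + norm (g (t - r) - g t)" for t
        using norm_triangle_ineq[of "(f (t - r) - g (t - r)) + (g (t - r) - g t)" "g t - f t"]
          norm_triangle_ineq[of "f (t - r) - g (t - r)" "g (t - r) - g t"]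
        by (simp add: norm_minus_commute)
    qed (rule integrable_norm_translate_diff[OF f])
    also have "\<dots> = 2 * (LINT t|lborel. norm (f t - g t)) + (LINT t|lborel. norm (g (t - r) - g t))"
      using fg_int fg_int' integrable_norm_translate_diff[OF g]
        integral_shift[of "\<lambda>t. norm (f t - g t)" r] by simp
    finally show ?case using elim fg by auto
  qed
qed

lemma translate_continuous_add:
  fixes f g :: "real \<Rightarrow> 'b::real_normed_vector"
  assumes f: "simple_limit borel f" "integrable lborel (\<lambda>t. norm (f t))" "translate_continuous f"
    and g: "simple_limit borel g" "integrable lborel (\<lambda>t. norm (g t))" "translate_continuous g"
  shows "translate_continuous (\<lambda>t. f t + g t)"
proof (rule Lim_null_comparison[OF always_eventually])
  show "\<forall>r. norm (LINT t|lborel. norm (f (t - r) + g (t - r) - (f t + g t)))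
     \<le> (LINT t|lborel. norm (f (t - r) - f t)) + (LINT t|lborel. norm (g (t - r) - g t))"
  proof
    fix r
    have eq: "f (t - r) + g (t - r) - (f t + g t) = (f (t - r) - f t) + (g (t - r) - g t)" for t
      by simp
    have le: "norm (f (t - r) + g (t - r) - (f t + g t)) \<le> norm (f (t - r) - f t) + norm (g (t - r) - g t)" for t
      unfolding eq by (rule norm_triangle_ineq)
    note int = integrable_norm_translate_diff[OF f(1,2)] integrable_norm_translate_diff[OF g(1,2)]
    have sl: "simple_limit borel (\<lambda>t. f (t - r) + g (t - r) - (f t + g t))"
      unfolding eq
      by (rule simple_limit_compose2[OF simple_limit_translate_diff[OF f(1)] simple_limit_translate_diff[OF g(1)]])
        (rule tendsto_add)
    have "integrable lborel (\<lambda>t. norm (f (t - r) + g (t - r) - (f t + g t)))"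
      by (rule integrable_norm_bound[OF Bochner_Integration.integrable_add[OF int] _ le])
        (simp add: simple_limit_lborel sl)
    then have "(LINT t|lborel. norm (f (t - r) + g (t - r) - (f t + g t)))
       \<le> (LINT t|lborel. norm (f (t - r) - f t) + norm (g (t - r) - g t))"
      using int le by (intro integral_mono) auto
    then show "norm (LINT t|lborel. norm (f (t - r) + g (t - r) - (f t + g t)))
       \<le> (LINT t|lborel. norm (f (t - r) - f t)) + (LINT t|lborel. norm (g (t - r) - g t))"
      using int by simp
  qed
  show "((\<lambda>r. (LINT t|lborel. norm (f (t - r) - f t)) + (LINT t|lborel. norm (g (t - r) - g t))) \<longlongrightarrow> 0) (at 0)"
    using tendsto_add[OF f(3) g(3)] by simp
qed

text \<open>For an open set, \<open>\<integral>\<bar>1\<^sub>U(t-r) - 1\<^sub>U(t)\<bar>\<close> is twice the integral of the positive part of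
  \<open>1\<^sub>U(t) - 1\<^sub>U(t-r)\<close>, which tends to \<open>0\<close> pointwise and is dominated by \<open>1\<^sub>U\<close>.\<close>

lemma translate_continuous_open:
  assumes U: "open U" and fin: "emeasure lborel U < \<infinity>"
  shows "translate_continuous (indicator U :: real \<Rightarrow> real)"
proof -
  let ?u = "indicator U :: real \<Rightarrow> real"
  have [measurable]: "U \<in> sets borel" using U by simp
  have u_int: "integrable lborel ?u" "integrable lborel (\<lambda>t. ?u (t - r))" for r
    using fin integrable_shift[of ?u r] by auto
  define P where "P r t = max 0 (?u t - ?u (t - r))" for r t
  have [measurable]: "P r \<in> borel_measurable borel" for r
    unfolding P_def by measurable
  have P_int: "integrable lborel (P r)" for r
    by (rule Bochner_Integration.integrable_bound[OF u_int(1)]) (auto simp: P_def indicator_def)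
  have "(LINT t|lborel. norm (?u (t - r) - ?u t)) = 2 * (LINT t|lborel. P r t)" for r
  proof -
    have "(LINT t|lborel. norm (?u (t - r) - ?u t)) = (LINT t|lborel. 2 * P r t + (?u (t - r) - ?u t))"
      by (rule Bochner_Integration.integral_cong) (auto simp: P_def max_def)
    also have "\<dots> = 2 * (LINT t|lborel. P r t) + ((LINT t|lborel. ?u (t - r)) - (LINT t|lborel. ?u t))"
      using P_int u_int by simp
    also have "(LINT t|lborel. ?u (t - r)) = (LINT t|lborel. ?u t)"
      by (rule integral_shift)
    finally show ?thesis by simp
  qed
  moreover have "((\<lambda>r. LINT t|lborel. P r t) \<longlongrightarrow> (LINT t|(lborel :: real measure). (0::real))) (at 0)"
  proof (rule tendsto_at_iff_sequentially[THEN iffD2], intro allI impI)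
    fix X :: "nat \<Rightarrow> real" assume X: "\<forall>i. X i \<in> UNIV - {0}" "X \<longlonglongrightarrow> 0"
    show "((\<lambda>r. LINT t|lborel. P r t) \<circ> X) \<longlonglongrightarrow> (LINT t|(lborel :: real measure). (0::real))"
      unfolding o_def
    proof (rule integral_dominated_convergence[where w="?u"])
      show "AE t in lborel. (\<lambda>i. P (X i) t) \<longlonglongrightarrow> 0"
      proof (rule AE_I2)
        fix t
        show "(\<lambda>i. P (X i) t) \<longlonglongrightarrow> 0"
        proof (cases "t \<in> U")
          case True
          have "(\<lambda>i. t - X i) \<longlonglongrightarrow> t - 0" by (intro tendsto_intros X)
          then have "eventually (\<lambda>i. t - X i \<in> U) sequentially"
            using topological_tendstoD[OF _ U, of _ t sequentially] True by simp
          then have "eventually (\<lambda>i. P (X i) t = 0) sequentially"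
            by eventually_elim (simp add: P_def True)
          then show ?thesis by (rule tendsto_eventually)
        next
          case False
          then show ?thesis by (simp add: P_def)
        qed
      qed
      show "AE t in lborel. norm (P (X i) t) \<le> ?u t" for i
        by (auto simp: P_def indicator_def)
    qed (use u_int in auto)
  qed
  ultimately show ?thesis
    using tendsto_mult_left[of "\<lambda>r. LINT t|lborel. P r t" 0 "at 0" 2] by simp
qed

text \<open>Outer regularity gives an open superset whose excess has measure below \<open>e\<close>,
  and open sets are already settled.\<close>

lemma translate_continuous_indicator:
  assumes A[measurable]: "A \<in> sets borel" and fin: "emeasure lborel A < \<infinity>"
  shows "translate_continuous (indicator A :: real \<Rightarrow> real)"
proof (rule translate_continuous_approx)
  show "simple_limit borel (indicator A :: real \<Rightarrow> real)"
    by (intro measurable_simple_limit) measurable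
  show "integrable lborel (\<lambda>t. norm (indicator A t :: real))"
    using fin by auto
  fix e :: real assume "0 < e"
  have A': "A \<in> sets lebesgue" using A by simp
  obtain U where U: "open U" "A \<subseteq> U" "emeasure lebesgue (U - A) < ennreal e"
    by (rule sets_lebesgue_outer_open[OF A' \<open>0 < e\<close>], rule that)
  have [measurable]: "U \<in> sets borel" using U by simp
  have UA: "emeasure lborel (U - A) < ennreal e"
    using U(3) by (simp add: emeasure_completion)
  have "emeasure lborel U \<le> emeasure lborel A + emeasure lborel (U - A)"
    using U(2) emeasure_subadditive[of A lborel "U - A"] by (simp add: Un_absorb1)
  also have "\<dots> < \<infinity>"
    using UA fin by (auto simp: less_top[symmetric] top_unique)
  finally have Ufin: "emeasure lborel U < \<infinity>" .
  show "\<exists>g. simple_limit borel g \<and> integrable lborel (\<lambda>t. norm (g t)) \<and>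
    (LINT t|lborel. norm (indicator A t - g t)) < e \<and> translate_continuous (g :: real \<Rightarrow> real)"
  proof (intro exI[of _ "indicator U"] conjI translate_continuous_open U Ufin)
    show "simple_limit borel (indicator U :: real \<Rightarrow> real)"
      by (intro measurable_simple_limit) measurable
    show "integrable lborel (\<lambda>t. norm (indicator U t :: real))"
      using Ufin by auto
    have "(LINT t|lborel. norm (indicator A t - indicator U t :: real)) = (LINT t|lborel. indicator (U - A) t)"
      using U(2) by (intro Bochner_Integration.integral_cong) (auto simp: indicator_def)
    also have "\<dots> = measure lborel (U - A)"
      by simp
    also have "\<dots> < e"
      using UA enn2real_less_iff[OF order_less_trans[OF UA ennreal_less_top]]
      by (simp add: measure_def)
    finally show "(LINT t|lborel. norm (indicator A t - indicator U t :: real)) < e" .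
  qed
qed

text \<open>The value 0 is left out of the sum because its level set may have infinite measure,
  whereas integrability of the norm makes every other level set one of finite measure.\<close>

lemma translate_continuous_simple:
  fixes s :: "real \<Rightarrow> 'b::real_normed_vector"
  assumes s: "simple_function borel s" and int: "integrable lborel (\<lambda>t. norm (s t))"
  shows "translate_continuous s"
proof -
  let ?A = "\<lambda>y. s -` {y}"
  have A[measurable]: "?A y \<in> sets borel" for y
    using simple_functionD(2)[OF s, of "{y}"] by simp
  have fin: "finite (range s)"
    using simple_functionD(1)[OF s] by simp
  have Afin: "emeasure lborel (?A y) < \<infinity>" if "y \<noteq> 0" for y
  proof -
    have "integrable lborel (\<lambda>t. indicator (?A y) t *\<^sub>R norm (s t))"
      using int by (intro integrable_mult_indicator) auto
    moreover have "(\<lambda>t. indicator (?A y) t *\<^sub>R norm (s t)) = (\<lambda>t. norm y * indicator (?A y) t)"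
      by (auto simp: indicator_def)
    ultimately have "integrable lborel (\<lambda>t. norm y * indicator (?A y) t)" by simp
    then have "integrable lborel (\<lambda>t. (1 / norm y) * (norm y * indicator (?A y) t))"
      by (rule integrable_mult_right)
    then have "integrable lborel (indicator (?A y) :: real \<Rightarrow> real)"
      using that by simp
    then show ?thesis
      by (subst (asm) integrable_indicator_iff) auto
  qed
  have one: "simple_limit borel (\<lambda>t. indicator (?A y) t *\<^sub>R y)"
    "integrable lborel (\<lambda>t. norm (indicator (?A y) t *\<^sub>R y))"
    "translate_continuous (\<lambda>t. indicator (?A y) t *\<^sub>R y)" if "y \<noteq> 0" for y
  proof -
    show "simple_limit borel (\<lambda>t. indicator (?A y) t *\<^sub>R y)"
      by (intro simple_limit_scaleR measurable_simple_limit[of "indicator (?A y)"] simple_limit_const) measurable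
    show "integrable lborel (\<lambda>t. norm (indicator (?A y) t *\<^sub>R y))"
      using Afin[OF that] by auto
    have "((\<lambda>r. (LINT t|lborel. norm (indicator (?A y) (t - r) - indicator (?A y) t :: real)) * norm y) \<longlongrightarrow> 0 * norm y) (at 0)"
      by (intro tendsto_mult_right translate_continuous_indicator A Afin that)
    then show "translate_continuous (\<lambda>t. indicator (?A y) t *\<^sub>R y)"
      by (simp only: scaleR_left_diff_distrib[symmetric] norm_scaleR real_norm_def integral_mult_left_zero mult_zero_left)
  qed
  have "simple_limit borel (\<lambda>t. \<Sum>y\<in>Y. indicator (?A y) t *\<^sub>R y) \<and>
    integrable lborel (\<lambda>t. norm (\<Sum>y\<in>Y. indicator (?A y) t *\<^sub>R y)) \<and>
    translate_continuous (\<lambda>t. \<Sum>y\<in>Y. indicator (?A y) t *\<^sub>R y)" if "finite Y" "0 \<notin> Y" for Y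
    using that
  proof (induction rule: finite_induct)
    case empty
    then show ?case by (auto intro: simple_limit_const)
  next
    case (insert y Y)
    then have y: "y \<noteq> 0" by auto
    have IH: "simple_limit borel (\<lambda>t. \<Sum>y\<in>Y. indicator (?A y) t *\<^sub>R y)"
      "integrable lborel (\<lambda>t. norm (\<Sum>y\<in>Y. indicator (?A y) t *\<^sub>R y))"
      "translate_continuous (\<lambda>t. \<Sum>y\<in>Y. indicator (?A y) t *\<^sub>R y)"
      using insert.IH insert.prems by simp_all
    have sl: "simple_limit borel (\<lambda>t. indicator (?A y) t *\<^sub>R y + (\<Sum>y\<in>Y. indicator (?A y) t *\<^sub>R y))"
      by (rule simple_limit_compose2[OF one(1)[OF y] IH(1)]) (rule tendsto_add)
    moreover have "integrable lborel (\<lambda>t. norm (indicator (?A y) t *\<^sub>R y + (\<Sum>y\<in>Y. indicator (?A y) t *\<^sub>R y)))"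
      by (rule integrable_norm_bound[OF Bochner_Integration.integrable_add[OF one(2)[OF y] IH(2)]])
        (simp add: simple_limit_lborel sl, rule norm_triangle_ineq)
    ultimately show ?case
      using translate_continuous_add[OF one[OF y] IH] by (simp only: sum.insert[OF insert(1,2)] simp_thms)
  qed
  from this[of "range s - {0}"] fin
  have "translate_continuous (\<lambda>t. \<Sum>y\<in>range s - {0}. indicator (?A y) t *\<^sub>R y)" by blast
  moreover have "(\<Sum>y\<in>range s - {0}. indicator (?A y) t *\<^sub>R y) = s t" for t
  proof -
    have "(\<Sum>y\<in>range s - {0}. indicator (?A y) t *\<^sub>R y) = (\<Sum>y\<in>range s. indicator (?A y) t *\<^sub>R y)"
      using fin by (intro sum.mono_neutral_left) auto
    also have "\<dots> = (\<Sum>y\<in>{s t}. indicator (?A y) t *\<^sub>R y)"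
      using fin by (intro sum.mono_neutral_right) (auto simp: indicator_def)
    finally show ?thesis by simp
  qed
  ultimately show ?thesis by (simp only:)
qed

lemma translate_continuous_integrable:
  fixes f :: "real \<Rightarrow> 'b::real_normed_vector"
  assumes f: "simple_limit borel f" and int: "integrable lborel (\<lambda>t. norm (f t))"
  shows "translate_continuous f"
proof (rule translate_continuous_approx[OF f int])
  fix e :: real assume e: "0 < e"
  obtain s where s: "\<And>i. simple_function borel (s i)" "\<And>x. (\<lambda>i. s i x) \<longlonglongrightarrow> f x"
    "\<And>i x. norm (s i x) \<le> 2 * norm (f x)"
    by (rule simple_limit_dominated[OF f], rule that) simp_all
  have sl: "simple_limit borel (s i)" for i
    by (intro simple_limit_simple s)
  have s_int: "integrable lborel (\<lambda>t. norm (s i t))" for i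
    by (rule integrable_norm_bound[of _ "\<lambda>t. 2 * norm (f t)"]) (use int s(3) sl in \<open>auto simp: simple_limit_lborel\<close>)
  have "(\<lambda>i. LINT t|lborel. norm (f t - s i t)) \<longlonglongrightarrow> (LINT t|(lborel :: real measure). (0::real))"
  proof (rule integral_dominated_convergence[where w="\<lambda>t. 3 * norm (f t)"])
    show "integrable lborel (\<lambda>t. 3 * norm (f t))" using int by auto
    show "(\<lambda>t. norm (f t - s i t)) \<in> borel_measurable lborel" for i
      using simple_limit_measurable[OF simple_limit_norm[OF simple_limit_diff[OF f sl[of i]]]] by simp
    show "AE t in lborel. (\<lambda>i. norm (f t - s i t)) \<longlonglongrightarrow> 0"
    proof (rule AE_I2)
      show "(\<lambda>i. norm (f t - s i t)) \<longlonglongrightarrow> 0" for t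
        using tendsto_norm[OF tendsto_diff[OF tendsto_const[of "f t"] s(2)[of t]]] by simp
    qed
    show "AE t in lborel. norm (norm (f t - s i t)) \<le> 3 * norm (f t)" for i
    proof (rule AE_I2)
      show "norm (norm (f t - s i t)) \<le> 3 * norm (f t)" for t
        using norm_triangle_ineq4[of "f t" "s i t"] s(3)[of i t] by simp
    qed
  qed auto
  from order_tendstoD(2)[OF this, of e]
  have "eventually (\<lambda>i. (LINT t|lborel. norm (f t - s i t)) < e) sequentially"
    using e by simp
  then obtain i where "(LINT t|lborel. norm (f t - s i t)) < e"
    by (auto simp: eventually_sequentially)
  then show "\<exists>g. simple_limit borel g \<and> integrable lborel (\<lambda>t. norm (g t)) \<and>
       (LINT t|lborel. norm (f t - g t)) < e \<and> translate_continuous g"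
    using sl s_int translate_continuous_simple[OF s(1) s_int] by (intro exI[of _ "s i"]) simp
qed

section \<open>Approximate identities\<close>

lemma integrable_pair_weighted:
  fixes \<rho> :: "real \<Rightarrow> real" and G :: "real \<Rightarrow> real \<Rightarrow> real"
  assumes \<rho>: "integrable lborel \<rho>"
    and G[measurable]: "(\<lambda>(r, t). G r t) \<in> borel_measurable (lborel \<Otimes>\<^sub>M lborel)"
    and int: "\<And>r. integrable lborel (G r)" and bound: "\<And>r. (LINT t|lborel. \<bar>G r t\<bar>) \<le> W"
  shows "integrable (lborel \<Otimes>\<^sub>M lborel) (\<lambda>(r, t). \<rho> r * G r t)"
proof (rule lborel_pair.Fubini_integrable)
  have [measurable]: "\<rho> \<in> borel_measurable borel" using \<rho> by simp
  show "(\<lambda>(r, t). \<rho> r * G r t) \<in> borel_measurable (lborel \<Otimes>\<^sub>M lborel)"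
    by measurable
  show "AE r in lborel. integrable lborel (\<lambda>t. case (r, t) of (r, t) \<Rightarrow> \<rho> r * G r t)"
    using int by simp
  show "integrable lborel (\<lambda>r. LINT t|lborel. norm (case (r, t) of (r, t) \<Rightarrow> \<rho> r * G r t))"
  proof (rule Bochner_Integration.integrable_bound)
    show "integrable lborel (\<lambda>r. W * \<rho> r)" using \<rho> by simp
    show "(\<lambda>r. LINT t|lborel. norm (case (r, t) of (r, t) \<Rightarrow> \<rho> r * G r t)) \<in> borel_measurable lborel"
      by measurable
    show "AE r in lborel. norm (LINT t|lborel. norm (case (r, t) of (r, t) \<Rightarrow> \<rho> r * G r t)) \<le> norm (W * \<rho> r)"
    proof (rule AE_I2)
      fix r
      have "(LINT t|lborel. \<bar>G r t\<bar>) \<le> \<bar>W\<bar>" using bound[of r] by simp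
      from mult_left_mono[OF this, of "\<bar>\<rho> r\<bar>"]
      show "norm (LINT t|lborel. norm (case (r, t) of (r, t) \<Rightarrow> \<rho> r * G r t)) \<le> norm (W * \<rho> r)"
        by (simp add: abs_mult mult.commute)
    qed
  qed
qed

text \<open>\<open>F\<close> has two arguments so that it may be a scalar product in which one
  factor is frozen at the outer time \<open>t\<close>; the limit is then the diagonal. The error has
  two sources: the modulus \<open>w\<close> of translation along the diagonal, averaged against
  \<rho>, and the mass missing from \<rho>.\<close>

lemma approximate_identity:
  fixes \<rho> :: "nat \<Rightarrow> real \<Rightarrow> real" and F :: "real \<Rightarrow> real \<Rightarrow> real"
  assumes T: "0 < T" and \<rho>_int: "\<And>n. integrable lborel (\<rho> n)" and \<rho>_nn: "\<And>n r. 0 \<le> \<rho> n r"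
    and \<rho>_supp: "\<And>n r. r \<le> 0 \<or> T < r \<Longrightarrow> \<rho> n r = 0"
    and \<rho>_le: "\<And>n. (LINT r|lborel. cutoff T (\<rho> n) r) \<le> 1"
    and \<rho>_lim: "\<And>\<delta>. 0 < \<delta> \<Longrightarrow> \<delta> \<le> T \<Longrightarrow> (\<lambda>n. LINT r|lborel. cutoff \<delta> (\<rho> n) r) \<longlonglongrightarrow> 1"
    and F[measurable]: "(\<lambda>(t, s). F t s) \<in> borel_measurable (lborel \<Otimes>\<^sub>M lborel)"
    and F_int: "\<And>r. integrable lborel (\<lambda>t. F t (t - r))"
    and W: "\<And>r. (LINT t|lborel. \<bar>F t (t - r)\<bar>) \<le> W"
    and \<omega>: "((\<lambda>r. LINT t|lborel. \<bar>F t (t - r) - F t t\<bar>) \<longlongrightarrow> 0) (at 0)"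
  shows approximate_identity_integrable: "integrable lborel (\<lambda>t. LINT s|lborel. \<rho> n (t - s) * F t s)"
    and approximate_identity_AE: "AE t in lborel. integrable lborel (\<lambda>s. \<rho> n (t - s) * F t s)"
    and approximate_identity_tendsto:
      "(\<lambda>n. LINT t|lborel. \<bar>(LINT s|lborel. \<rho> n (t - s) * F t s) - F t t\<bar>) \<longlonglongrightarrow> 0"
proof -
  define w where "w r = (LINT t|lborel. \<bar>F t (t - r) - F t t\<bar>)" for r
  have F0_int: "integrable lborel (\<lambda>t. F t t)" using F_int[of 0] by simp
  have W0: "(LINT t|lborel. \<bar>F t t\<bar>) \<le> W" using W[of 0] by simp
  have [measurable]: "(\<lambda>(r, t). F t (t - r)) \<in> borel_measurable (lborel \<Otimes>\<^sub>M lborel)"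
    by measurable
  have [measurable]: "w \<in> borel_measurable borel"
    unfolding w_def by measurable
  have w_le: "w r \<le> 2 * W" for r
  proof -
    have "w r \<le> (LINT t|lborel. \<bar>F t (t - r)\<bar> + \<bar>F t t\<bar>)"
      unfolding w_def using F_int F0_int by (intro integral_mono) auto
    also have "\<dots> \<le> 2 * W"
      using F_int[of r] F0_int W[of r] W0 by simp
    finally show ?thesis .
  qed
  have w_nn: "0 \<le> w r" for r unfolding w_def by (rule integral_nonneg_AE) simp
  have pair: "integrable (lborel \<Otimes>\<^sub>M lborel) (\<lambda>(r, t). \<rho> n r * F t (t - r))" for n
    by (rule integrable_pair_weighted[OF \<rho>_int _ F_int W]) measurable
  have pair': "integrable (lborel \<Otimes>\<^sub>M lborel) (\<lambda>(r, t). \<rho> n r * \<bar>F t (t - r) - F t t\<bar>)" for n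
  proof (rule integrable_pair_weighted[OF \<rho>_int])
    show "(LINT t|lborel. \<bar>\<bar>F t (t - r) - F t t\<bar>\<bar>) \<le> 2 * W" for r
      using w_le[of r] by (simp add: w_def)
    show "integrable lborel (\<lambda>t. \<bar>F t (t - r) - F t t\<bar>)" for r
      using F_int[of r] F0_int by simp
  qed measurable
  have swap: "(LINT s|lborel. \<rho> n (t - s) * F t s) = (LINT r|lborel. \<rho> n r * F t (t - r))" for n t
    using integral_reflect_shift[of "\<lambda>r. \<rho> n r * F t (t - r)" t] by simp
  have swap_int: "integrable lborel (\<lambda>s. \<rho> n (t - s) * F t s) \<longleftrightarrow> integrable lborel (\<lambda>r. \<rho> n r * F t (t - r))" for n t
    using integrable_reflect_shift[of "\<lambda>r. \<rho> n r * F t (t - r)" t] by simp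
  have AE_int: "AE t in lborel. integrable lborel (\<lambda>r. \<rho> n r * F t (t - r))" for n
    using lborel_pair.AE_integrable_fst'[OF lborel_pair.integrable_product_swap[OF pair[of n]]] by simp
  have AE_int': "AE t in lborel. integrable lborel (\<lambda>r. \<rho> n r * \<bar>F t (t - r) - F t t\<bar>)" for n
    using lborel_pair.AE_integrable_fst'[OF lborel_pair.integrable_product_swap[OF pair'[of n]]] by simp
  have I_int: "integrable lborel (\<lambda>t. LINT r|lborel. \<rho> n r * F t (t - r))" for n
    using lborel_pair.integrable_fst'[OF lborel_pair.integrable_product_swap[OF pair[of n]]] by simp
  have I'_int: "integrable lborel (\<lambda>t. LINT r|lborel. \<rho> n r * \<bar>F t (t - r) - F t t\<bar>)" for n
    using lborel_pair.integrable_fst'[OF lborel_pair.integrable_product_swap[OF pair'[of n]]] by simp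
  show "integrable lborel (\<lambda>t. LINT s|lborel. \<rho> n (t - s) * F t s)"
    using I_int[of n] by (simp add: swap)
  show "AE t in lborel. integrable lborel (\<lambda>s. \<rho> n (t - s) * F t s)"
    using AE_int[of n] by (simp add: swap_int)
  define m where "m n = (LINT r|lborel. \<rho> n r)" for n
  have m_eq: "m n = (LINT r|lborel. cutoff T (\<rho> n) r)" for n
    unfolding m_def using \<rho>_supp by (intro Bochner_Integration.integral_cong) (auto simp: cutoff_def)
  define X where "X n = (LINT t|lborel. \<bar>(LINT s|lborel. \<rho> n (t - s) * F t s) - F t t\<bar>)" for n
  have X_le: "X n \<le> (LINT r|lborel. \<rho> n r * w r) + (1 - m n) * W" for n
  proof -
    have "X n \<le> (LINT t|lborel. (LINT r|lborel. \<rho> n r * \<bar>F t (t - r) - F t t\<bar>) + (1 - m n) * \<bar>F t t\<bar>)"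
      unfolding X_def swap
    proof (rule integral_mono_AE)
      show "integrable lborel (\<lambda>t. \<bar>(LINT r|lborel. \<rho> n r * F t (t - r)) - F t t\<bar>)"
        using I_int F0_int by simp
      show "integrable lborel (\<lambda>t. (LINT r|lborel. \<rho> n r * \<bar>F t (t - r) - F t t\<bar>) + (1 - m n) * \<bar>F t t\<bar>)"
        using I'_int F0_int by simp
      show "AE t in lborel. \<bar>(LINT r|lborel. \<rho> n r * F t (t - r)) - F t t\<bar>
         \<le> (LINT r|lborel. \<rho> n r * \<bar>F t (t - r) - F t t\<bar>) + (1 - m n) * \<bar>F t t\<bar>"
        using AE_int[of n] AE_int'[of n]
      proof eventually_elim
        case (elim t)
        have "(LINT r|lborel. \<rho> n r * (F t (t - r) - F t t)) = (LINT r|lborel. \<rho> n r * F t (t - r)) - m n * F t t"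
          using elim(1) \<rho>_int[of n] by (simp add: right_diff_distrib m_def)
        then have "(LINT r|lborel. \<rho> n r * F t (t - r)) - F t t
            = (LINT r|lborel. \<rho> n r * (F t (t - r) - F t t)) - (1 - m n) * F t t"
          by (simp add: algebra_simps)
        also have "\<bar>\<dots>\<bar> \<le> \<bar>LINT r|lborel. \<rho> n r * (F t (t - r) - F t t)\<bar> + \<bar>(1 - m n) * F t t\<bar>"
          by (rule abs_triangle_ineq4)
        also have "\<bar>LINT r|lborel. \<rho> n r * (F t (t - r) - F t t)\<bar> \<le> (LINT r|lborel. \<bar>\<rho> n r * (F t (t - r) - F t t)\<bar>)"
          by (rule integral_abs_bound)
        also have "\<dots> = (LINT r|lborel. \<rho> n r * \<bar>F t (t - r) - F t t\<bar>)"
          using \<rho>_nn by (simp add: abs_mult)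
        also have "\<bar>(1 - m n) * F t t\<bar> = (1 - m n) * \<bar>F t t\<bar>"
          using \<rho>_le[of n] by (simp add: abs_mult m_eq)
        finally show ?case by simp
      qed
    qed
    also have "\<dots> = (LINT t|lborel. LINT r|lborel. \<rho> n r * \<bar>F t (t - r) - F t t\<bar>) + (1 - m n) * (LINT t|lborel. \<bar>F t t\<bar>)"
      using I'_int[of n] F0_int by simp
    also have "(LINT t|lborel. LINT r|lborel. \<rho> n r * \<bar>F t (t - r) - F t t\<bar>)
       = (LINT r|lborel. LINT t|lborel. \<rho> n r * \<bar>F t (t - r) - F t t\<bar>)"
      using lborel_pair.Fubini_integral[of "\<lambda>r t. \<rho> n r * \<bar>F t (t - r) - F t t\<bar>"] pair'[of n] by simp
    also have "\<dots> = (LINT r|lborel. \<rho> n r * w r)"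
      by (simp add: w_def)
    also have "(1 - m n) * (LINT t|lborel. \<bar>F t t\<bar>) \<le> (1 - m n) * W"
      using W0 \<rho>_le[of n] by (intro mult_left_mono) (auto simp: m_eq)
    finally show ?thesis by simp
  qed
  have "X \<longlonglongrightarrow> 0"
  proof (rule LIMSEQ_I)
    fix e :: real assume e: "0 < e"
    from \<omega> have "eventually (\<lambda>r. w r < e / 2) (at 0)"
      unfolding w_def using e by (intro order_tendstoD(2)[where y=0]) auto
    then obtain d where d: "0 < d" "\<And>r. r \<noteq> 0 \<Longrightarrow> \<bar>r\<bar> < d \<Longrightarrow> w r < e / 2"
      by (auto simp: eventually_at dist_real_def)
    \<comment> \<open>The mass hypothesis is available only up to \<open>T\<close>, and halving
      \<open>d\<close> makes \<delta> strictly smaller than \<open>d\<close>.\<close>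
    define \<delta> where "\<delta> = min (d / 2) T"
    have \<delta>: "0 < \<delta>" "\<delta> \<le> T" "\<delta> < d" using d(1) T by (auto simp: \<delta>_def)
    define c where "c n = (LINT r|lborel. cutoff \<delta> (\<rho> n) r)" for n
    \<comment> \<open>On (0, \<delta>] the modulus is below e / 2. Elsewhere it is at most 2 * W,
      against the mass \<open>m n - c n\<close>, which tends to 0.\<close>
    have \<rho>w: "(LINT r|lborel. \<rho> n r * w r) \<le> e / 2 * m n + 2 * W * (m n - c n)" for n
    proof -
      have cut: "integrable lborel (cutoff \<delta> (\<rho> n))" by (rule integrable_cutoff[OF \<rho>_int])
      have "(LINT r|lborel. \<rho> n r * w r) \<le> (LINT r|lborel. e / 2 * \<rho> n r + 2 * W * (\<rho> n r - cutoff \<delta> (\<rho> n) r))"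
      proof (rule integral_mono)
        have "integrable lborel (\<lambda>r. w r * \<rho> n r)"
        proof (rule Bochner_Integration.integrable_bound)
          show "integrable lborel (\<lambda>r. 2 * W * \<rho> n r)" using \<rho>_int by simp
          show "(\<lambda>r. w r * \<rho> n r) \<in> borel_measurable lborel"
            using \<rho>_int by measurable
          show "AE r in lborel. norm (w r * \<rho> n r) \<le> norm (2 * W * \<rho> n r)"
          proof (rule AE_I2)
            fix r show "norm (w r * \<rho> n r) \<le> norm (2 * W * \<rho> n r)"
              using mult_right_mono[OF order_trans[OF w_le[of r] abs_ge_self], of "\<rho> n r"] w_nn[of r] \<rho>_nn[of n r]
              by (simp add: abs_mult)
          qed
        qed
        then show "integrable lborel (\<lambda>r. \<rho> n r * w r)" by (simp add: mult.commute)
        show "integrable lborel (\<lambda>r. e / 2 * \<rho> n r + 2 * W * (\<rho> n r - cutoff \<delta> (\<rho> n) r))"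
          using \<rho>_int cut by simp
        show "\<rho> n r * w r \<le> e / 2 * \<rho> n r + 2 * W * (\<rho> n r - cutoff \<delta> (\<rho> n) r)" for r
        proof (cases "0 < r \<and> r \<le> \<delta>")
          case True
          then show ?thesis
            using mult_left_mono[OF less_imp_le[OF d(2)[of r]], of "\<rho> n r"] \<rho>_nn[of n r] \<delta> by (simp add: mult.commute)
        next
          case False
          then have "cutoff \<delta> (\<rho> n) r = 0" by (auto simp: cutoff_def)
          then show ?thesis
            using mult_left_mono[OF w_le[of r] \<rho>_nn[of n r]] \<rho>_nn[of n r] e
            by (simp add: mult.commute add_increasing)
        qed
      qed
      also have "\<dots> = e / 2 * m n + 2 * W * (m n - c n)"
        using \<rho>_int[of n] cut by (simp add: m_def c_def)
      finally show ?thesis .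
    qed
    have m_lim: "m \<longlonglongrightarrow> 1" unfolding m_eq[abs_def] using \<rho>_lim[of T] T by simp
    have c_lim: "c \<longlonglongrightarrow> 1" unfolding c_def[abs_def] using \<rho>_lim \<delta> by simp
    have "(\<lambda>n. e / 2 * m n + 2 * W * (m n - c n) + (1 - m n) * W) \<longlonglongrightarrow> e / 2 * 1 + 2 * W * (1 - 1) + (1 - 1) * W"
      by (intro tendsto_intros m_lim c_lim)
    then have "(\<lambda>n. e / 2 * m n + 2 * W * (m n - c n) + (1 - m n) * W) \<longlonglongrightarrow> e / 2" by simp
    from order_tendstoD(2)[OF this, of e] e
    have "eventually (\<lambda>n. e / 2 * m n + 2 * W * (m n - c n) + (1 - m n) * W < e) sequentially" by simp
    then have "eventually (\<lambda>n. norm (X n - 0) < e) sequentially"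
    proof eventually_elim
      case (elim n)
      have "0 \<le> X n" unfolding X_def by (rule integral_nonneg_AE) simp
      then show ?case using elim X_le[of n] \<rho>w[of n] by simp
    qed
    then show "\<exists>no. \<forall>n\<ge>no. norm (X n - 0) < e" by (simp add: eventually_sequentially)
  qed
  then show "(\<lambda>n. LINT t|lborel. \<bar>(LINT s|lborel. \<rho> n (t - s) * F t s) - F t t\<bar>) \<longlonglongrightarrow> 0"
    unfolding X_def[abs_def] .
qed

section \<open>Scalar products of square integrable functions\<close>

lemma young_product:
  fixes a b :: real
  assumes "0 < e"
  shows "a * b \<le> e / 2 * a\<^sup>2 + b\<^sup>2 / (2 * e)"
proof -
  have "0 \<le> (e * a - b)\<^sup>2 / (2 * e)" using assms by simp
  also have "\<dots> = e / 2 * a\<^sup>2 - a * b + b\<^sup>2 / (2 * e)"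
    using assms by (simp add: field_simps power2_eq_square)
  finally show ?thesis by simp
qed

context
  fixes d g :: "real \<Rightarrow> 'h::real_inner"
  assumes d: "simple_limit borel d" "integrable lborel (\<lambda>t. (norm (d t))\<^sup>2)"
    and g: "simple_limit borel g" "integrable lborel (\<lambda>t. (norm (g t))\<^sup>2)"
begin

lemma borel_measurable_norms:
  "(\<lambda>t. norm (d t)) \<in> borel_measurable borel" "(\<lambda>t. norm (g t)) \<in> borel_measurable borel"
  using simple_limit_measurable[OF simple_limit_norm[OF d(1)]]
    simple_limit_measurable[OF simple_limit_norm[OF g(1)]] by auto

lemma borel_measurable_inner_pair:
  "(\<lambda>(t, s). d s \<bullet> g t) \<in> borel_measurable (lborel \<Otimes>\<^sub>M lborel)"
proof -
  have "simple_limit (lborel \<Otimes>\<^sub>M lborel) (\<lambda>x. d (snd x) \<bullet> g (fst x))"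
    by (intro simple_limit_inner simple_limit_comp[OF d(1)] simple_limit_comp[OF g(1)]) measurable
  from simple_limit_measurable[OF this] show ?thesis by (simp add: case_prod_beta)
qed

lemma borel_measurable_inner_shift: "(\<lambda>t. d (t - r) \<bullet> g t) \<in> borel_measurable borel"
  by (rule simple_limit_measurable[OF simple_limit_inner[OF simple_limit_comp[OF d(1)] g(1)]]) measurable

lemma square_shift_integrable: "integrable lborel (\<lambda>t. (norm (d (t - r)))\<^sup>2)"
  using integrable_shift[of "\<lambda>t. (norm (d t))\<^sup>2" r] d(2) by simp

lemma square_shift_integral: "(LINT t|lborel. (norm (d (t - r)))\<^sup>2) = (LINT t|lborel. (norm (d t))\<^sup>2)"
  by (rule integral_shift[of "\<lambda>t. (norm (d t))\<^sup>2"])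

lemma inner_le_squares: "\<bar>x \<bullet> y\<bar> \<le> ((norm x)\<^sup>2 + (norm y)\<^sup>2) / 2" for x y :: 'h
  using Cauchy_Schwarz_ineq2[of x y] young_product[of 1 "norm x" "norm y"] by simp

lemma integrable_inner_shift: "integrable lborel (\<lambda>t. d (t - r) \<bullet> g t)"
proof (rule Bochner_Integration.integrable_bound)
  show "integrable lborel (\<lambda>t. ((norm (d (t - r)))\<^sup>2 + (norm (g t))\<^sup>2) / 2)"
    using square_shift_integrable g(2) by simp
  show "AE t in lborel. norm (d (t - r) \<bullet> g t) \<le> norm (((norm (d (t - r)))\<^sup>2 + (norm (g t))\<^sup>2) / 2)"
    using inner_le_squares by (auto intro!: AE_I2 order_trans[OF _ abs_ge_self])
qed (use borel_measurable_inner_shift in simp)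

lemma integral_inner_shift_le:
  "(LINT t|lborel. \<bar>d (t - r) \<bullet> g t\<bar>) \<le> (LINT t|lborel. (norm (d t))\<^sup>2) + (LINT t|lborel. (norm (g t))\<^sup>2)"
proof -
  have "(LINT t|lborel. \<bar>d (t - r) \<bullet> g t\<bar>) \<le> (LINT t|lborel. (norm (d (t - r)))\<^sup>2 + (norm (g t))\<^sup>2)"
  proof (rule integral_mono)
    show "\<bar>d (t - r) \<bullet> g t\<bar> \<le> (norm (d (t - r)))\<^sup>2 + (norm (g t))\<^sup>2" for t
      by (rule order_trans[OF inner_le_squares]) simp
  qed (use square_shift_integrable g(2) integrable_inner_shift in auto)
  then show ?thesis
    using square_shift_integrable g(2) square_shift_integral by simp
qed

text \<open>Splitting \<open>g\<close> at a large height reduces this to the continuity of translations in \<open>L\<^sup>1\<close>.\<close>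

lemma inner_translate_tendsto:
  assumes d1: "integrable lborel (\<lambda>t. norm (d t))"
  shows "((\<lambda>r. LINT t|lborel. \<bar>d (t - r) \<bullet> g t - d t \<bullet> g t\<bar>) \<longlongrightarrow> 0) (at 0)"
proof (rule tendstoI)
  fix e :: real assume e: "0 < e"
  note [measurable] = borel_measurable_norms
  define D where "D = (LINT t|lborel. (norm (d t))\<^sup>2)"
  have D: "0 \<le> D" unfolding D_def by (rule integral_nonneg_AE) simp
  \<comment> \<open>The final budget is e / 4 for the bounded part of \<open>g\<close> and e / 2 + e
    / 4 for the two terms of Young's inequality with weight \<open>a\<close>. The tail of
    \<open>g\<close> gets divided by 2 * a, so it has to fall below a * e / 2. The added 1 excludes
    division by zero when D = 0.\<close>
  define a where "a = e / (6 * (D + 1))"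
  have a: "0 < a" "2 * a * D < e / 2" using e D by (auto simp: a_def field_simps intro!: add_pos_nonneg)
  define tail where "tail M t = (if M < norm (g t) then (norm (g t))\<^sup>2 else 0)" for M t
  have [measurable]: "tail M \<in> borel_measurable borel" for M
    unfolding tail_def by measurable
  have tail_le: "norm (tail M t) \<le> (norm (g t))\<^sup>2" for M t
    by (simp add: tail_def)
  have tail_int: "integrable lborel (tail M)" for M
    by (rule Bochner_Integration.integrable_bound[OF g(2)]) (use tail_le in auto)
  have "(\<lambda>n. LINT t|lborel. tail (real n) t) \<longlonglongrightarrow> (LINT t|(lborel :: real measure). 0)"
  proof (rule integral_dominated_convergence[where w="\<lambda>t. (norm (g t))\<^sup>2"])
    show "AE t in lborel. (\<lambda>n. tail (real n) t) \<longlonglongrightarrow> 0"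
    proof (rule AE_I2)
      fix t
      obtain N where "norm (g t) < real N" using reals_Archimedean2 by blast
      then have "eventually (\<lambda>n. tail (real n) t = 0) sequentially"
        by (intro eventually_sequentiallyI[of N]) (auto simp: tail_def)
      then show "(\<lambda>n. tail (real n) t) \<longlonglongrightarrow> 0" by (rule tendsto_eventually)
    qed
  qed (use g(2) tail_le in auto)
  then have "(\<lambda>n. LINT t|lborel. tail (real n) t) \<longlonglongrightarrow> 0" by simp
  from order_tendstoD(2)[OF this, of "a * e / 2"] a e
  obtain N where N: "(LINT t|lborel. tail (real N) t) < a * e / 2"
    by (auto simp: eventually_sequentially)
  have "((\<lambda>r. real N * (LINT t|lborel. norm (d (t - r) - d t))) \<longlongrightarrow> real N * 0) (at 0)"
    by (intro tendsto_mult_left translate_continuous_integrable d(1) d1)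
  then have "((\<lambda>r. real N * (LINT t|lborel. norm (d (t - r) - d t))) \<longlongrightarrow> 0) (at 0)" by simp
  from order_tendstoD(2)[OF this, of "e / 4"] e
  have "eventually (\<lambda>r. real N * (LINT t|lborel. norm (d (t - r) - d t)) < e / 4) (at 0)" by simp
  then show "eventually (\<lambda>r. dist (LINT t|lborel. \<bar>d (t - r) \<bullet> g t - d t \<bullet> g t\<bar>) 0 < e) (at 0)"
  proof eventually_elim
    case (elim r)
    let ?b = "\<lambda>t. real N * norm (d (t - r) - d t) + (a * ((norm (d (t - r)))\<^sup>2 + (norm (d t))\<^sup>2) + tail (real N) t / (2 * a))"
    have b_int: "integrable lborel (\<lambda>t. norm (d (t - r) - d t))"
      by (rule integrable_norm_translate_diff[OF d(1) d1])
    have "(LINT t|lborel. \<bar>d (t - r) \<bullet> g t - d t \<bullet> g t\<bar>) \<le> (LINT t|lborel. ?b t)"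
    proof (rule integral_mono)
      show "integrable lborel (\<lambda>t. \<bar>d (t - r) \<bullet> g t - d t \<bullet> g t\<bar>)"
        using integrable_inner_shift[of r] integrable_inner_shift[of 0] by simp
      show "integrable lborel ?b"
        using b_int square_shift_integrable d(2) tail_int by simp
      fix t
      let ?x = "norm (d (t - r) - d t)"
      have "\<bar>d (t - r) \<bullet> g t - d t \<bullet> g t\<bar> \<le> ?x * norm (g t)"
        using Cauchy_Schwarz_ineq2[of "d (t - r) - d t" "g t"] by (simp add: inner_diff_left)
      also have "\<dots> \<le> ?b t"
      proof (cases "real N < norm (g t)")
        case True
        have "?x * norm (g t) \<le> a / 2 * ?x\<^sup>2 + tail (real N) t / (2 * a)"
          using young_product[OF a(1), of ?x "norm (g t)"] True by (simp add: tail_def)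
        also have "?x\<^sup>2 \<le> (norm (d (t - r)) + norm (d t))\<^sup>2"
          by (intro power_mono norm_triangle_ineq4) simp
        also have "\<dots> \<le> 2 * ((norm (d (t - r)))\<^sup>2 + (norm (d t))\<^sup>2)"
          using sum_squares_bound[of "norm (d (t - r))" "norm (d t)"] by (simp add: power2_sum)
        finally have "?x * norm (g t) \<le> a / 2 * (2 * ((norm (d (t - r)))\<^sup>2 + (norm (d t))\<^sup>2)) + tail (real N) t / (2 * a)"
          using a(1) by (simp add: mult_left_mono)
        also have "a / 2 * (2 * ((norm (d (t - r)))\<^sup>2 + (norm (d t))\<^sup>2)) = a * ((norm (d (t - r)))\<^sup>2 + (norm (d t))\<^sup>2)"
          by simp
        finally show ?thesis by (simp add: add_increasing)
      next
        case False
        then have "?x * norm (g t) \<le> real N * ?x"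
          by (simp add: mult.commute mult_right_mono)
        moreover have "0 \<le> a * ((norm (d (t - r)))\<^sup>2 + (norm (d t))\<^sup>2) + tail (real N) t / (2 * a)"
          using a(1) by (simp add: tail_def)
        ultimately show ?thesis by linarith
      qed
      finally show "\<bar>d (t - r) \<bullet> g t - d t \<bullet> g t\<bar> \<le> ?b t" .
    qed
    also have "\<dots> = real N * (LINT t|lborel. norm (d (t - r) - d t)) + (a * (D + D) + (LINT t|lborel. tail (real N) t) / (2 * a))"
      using b_int square_shift_integrable[of r] d(2) tail_int[of "real N"]
      by (simp add: square_shift_integral D_def)
    also have "\<dots> < e / 4 + (e / 2 + e / 4)"
    proof -
      have "(LINT t|lborel. tail (real N) t) / (2 * a) < e / 4"
        using N a(1) by (simp add: field_simps)
      moreover have "a * (D + D) < e / 2" using a(2) by (simp add: algebra_simps)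
      ultimately show ?thesis using elim by linarith
    qed
    finally show ?case by simp
  qed
qed

end

section \<open>The lemma of du Bois-Reymond\<close>

text \<open>Smoothness is obtained without computing higher derivatives: membership in a family
  closed under differentiation passes from each derivative to the next.\<close>

lemma iterated_deriv_closed:
  fixes f :: "real \<Rightarrow> real"
  assumes "f \<in> F" and closed: "\<And>f. f \<in> F \<Longrightarrow> \<exists>f'\<in>F. \<forall>x. (f has_field_derivative f' x) (at x)"
  shows "(deriv ^^ n) f field_differentiable at x"
proof -
  have deriv_in: "deriv h \<in> F" if h: "h \<in> F" for h
  proof -
    obtain h' where h': "h' \<in> F" "\<forall>x. (h has_field_derivative h' x) (at x)"
      using closed[OF h] by blast
    then have "deriv h = h'" by (auto intro!: DERIV_imp_deriv)
    then show ?thesis using h'(1) by simp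
  qed
  have *: "(deriv ^^ n) f \<in> F" for n
    by (induction n) (simp_all add: assms(1) deriv_in)
  show "(deriv ^^ n) f field_differentiable at x"
    using closed[OF *[of n]] by (auto simp: field_differentiable_def)
qed

text \<open>On (0, 1) all derivatives of exp(-1/(x(1-x))) have this shape, so polynomial and
  exponent are kept as parameters; \<open>bump 1 0\<close> is the classical bump function.\<close>

definition bump :: "real poly \<Rightarrow> nat \<Rightarrow> real \<Rightarrow> real" where
  "bump P m x = (if 0 < x \<and> x < 1 then poly P x / (x * (1 - x)) ^ m * exp (- 1 / (x * (1 - x))) else 0)"

text \<open>Quadratic vanishing at both ends forces the derivative there to be 0. It comes from exp
  y \<ge> (y / k)^k with y = 1/(x(1-x)) and k = m + 2: \<open>m\<close> powers cancel the
  denominator and two are left over.\<close>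

lemma bump_bound: "\<exists>C. \<forall>x. \<bar>bump P m x\<bar> \<le> C * x\<^sup>2 \<and> \<bar>bump P m x\<bar> \<le> C * (x - 1)\<^sup>2"
proof -
  have "compact ((\<lambda>x. poly P x) ` {0..1})"
    by (intro compact_continuous_image continuous_intros) auto
  then obtain A where A: "\<And>x. x \<in> {0..1} \<Longrightarrow> \<bar>poly P x\<bar> \<le> A"
    by (metis (no_types, lifting) bounded_real compact_imp_bounded imageI)
  have A0: "0 \<le> A" using A[of 0] by simp
  define k where "k = m + 2"
  define C where "C = A * real k ^ k"
  have C0: "0 \<le> C" using A0 by (simp add: C_def)
  have main: "\<bar>bump P m x\<bar> \<le> C * (x * (1 - x))\<^sup>2" if x: "0 < x" "x < 1" for x
  proof -
    define z where "z = x * (1 - x)"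
    have z: "0 < z" using x by (simp add: z_def)
    have "(1 / z / real k) ^ k \<le> (1 + 1 / z / real k) ^ k"
      using z by (intro power_mono) (auto simp: k_def)
    also have "\<dots> \<le> exp (1 / z)"
      using z by (intro exp_ge_one_plus_x_over_n_power_n) (auto simp: k_def intro: order_trans[of _ 0])
    finally have "(1 / z) ^ k / real k ^ k \<le> exp (1 / z)"
      by (simp only: power_divide[of "1 / z" "real k" k])
    moreover have "0 < real k ^ k" by (simp add: k_def)
    ultimately have "(1 / z) ^ k \<le> exp (1 / z) * real k ^ k"
      by (simp only: pos_divide_le_eq)
    then have "exp (- 1 / z) * (1 / z) ^ k \<le> exp (- 1 / z) * (exp (1 / z) * real k ^ k)"
      by (rule mult_left_mono) simp
    also have "\<dots> = real k ^ k"
      by (simp add: mult.assoc[symmetric] exp_add[symmetric])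
    finally have "exp (- 1 / z) * (1 / z) ^ k \<le> real k ^ k" .
    then have "exp (- 1 / z) * (1 / z) ^ k * z\<^sup>2 \<le> real k ^ k * z\<^sup>2"
      by (rule mult_right_mono) simp
    then have e: "exp (- 1 / z) / z ^ m \<le> real k ^ k * z\<^sup>2"
      using z by (simp add: k_def power_add power_divide power2_eq_square)
    have "\<bar>bump P m x\<bar> = \<bar>poly P x\<bar> * (exp (- 1 / z) / z ^ m)"
      using x z by (simp add: bump_def z_def[symmetric] abs_mult)
    also have "\<dots> \<le> A * (real k ^ k * z\<^sup>2)"
      using e A[of x] x A0 z by (intro mult_mono) auto
    finally show ?thesis by (simp add: C_def z_def)
  qed
  have "\<bar>bump P m x\<bar> \<le> C * x\<^sup>2 \<and> \<bar>bump P m x\<bar> \<le> C * (x - 1)\<^sup>2" for x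
  proof (cases "0 < x \<and> x < 1")
    case True
    have "(x * (1 - x))\<^sup>2 \<le> x\<^sup>2"
      using True by (intro power_mono mult_left_le) auto
    moreover have "(x * (1 - x))\<^sup>2 \<le> (1 - x)\<^sup>2"
      using True by (intro power_mono mult_left_le_one_le) auto
    moreover have "(x - 1)\<^sup>2 = (1 - x)\<^sup>2" by (rule power2_commute)
    ultimately show ?thesis
      using main[of x] True C0 by (auto intro: order_trans[OF _ mult_left_mono])
  next
    case False
    then have "bump P m x = 0" by (simp only: bump_def if_False)
    then show ?thesis using C0 by simp
  qed
  then show ?thesis by blast
qed

lemma has_field_derivative_zero_quadratic:
  fixes f :: "real \<Rightarrow> real"
  assumes "\<And>x. \<bar>f x\<bar> \<le> C * (x - a)\<^sup>2"
  shows "(f has_field_derivative 0) (at a)"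
proof -
  have fa: "f a = 0" using assms[of a] by simp
  have "((\<lambda>h. f (a + h) / h) \<longlongrightarrow> 0) (at 0)"
  proof (rule Lim_null_comparison)
    show "eventually (\<lambda>h. norm (f (a + h) / h) \<le> C * \<bar>h\<bar>) (at 0)"
    proof (rule eventually_at_filter[THEN iffD2, OF always_eventually], intro allI impI)
      fix h :: real assume "h \<noteq> 0"
      then show "norm (f (a + h) / h) \<le> C * \<bar>h\<bar>"
        using assms[of "a + h"] by (simp add: abs_divide pos_divide_le_eq power2_eq_square mult.assoc)
    qed
    show "((\<lambda>h. C * \<bar>h\<bar>) \<longlongrightarrow> 0) (at 0)"
      by (auto intro!: tendsto_eq_intros)
  qed
  then show ?thesis by (simp add: DERIV_def fa)
qed

lemma bump_derivative: "\<exists>Q. \<forall>x. (bump P m has_field_derivative bump Q (m + 2) x) (at x)"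
proof -
  \<comment> \<open>The three terms of \<open>Q\<close> come from differentiating \<open>P\<close>,
    the power and the exponential, multiplied by Z^(m + 2) to clear denominators; this is why the
    exponent grows by 2.\<close>
  define Z Z' :: "real poly" where "Z = [:0, 1, -1:]" and "Z' = [:1, -2:]"
  define Q where "Q = pderiv P * Z\<^sup>2 - smult (real m) (P * Z * Z') + P * Z'"
  have "(bump P m has_field_derivative bump Q (m + 2) x) (at x)" for x
  proof (cases "0 < x \<and> x < 1")
    case True
    define z where "z = x * (1 - x)"
    have z: "0 < z" using True by (simp add: z_def)
    have Qx: "poly Q x = poly (pderiv P) x * z\<^sup>2 - real m * (poly P x * z * (1 - 2 * x)) + poly P x * (1 - 2 * x)"
      by (simp add: Q_def Z_def Z'_def z_def algebra_simps)
    have d: "((\<lambda>x. poly P x * inverse (x * (1 - x)) ^ m * exp (- inverse (x * (1 - x))))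
       has_field_derivative bump Q (m + 2) x) (at x)"
    proof -
      have "((\<lambda>x. poly P x * inverse (x * (1 - x)) ^ m * exp (- inverse (x * (1 - x))))
         has_field_derivative
         (poly (pderiv P) x * inverse z ^ m
           + poly P x * (real m * inverse z ^ (m - 1) * (- (1 - 2 * x) * (inverse z)\<^sup>2))) * exp (- inverse z)
           + poly P x * inverse z ^ m * (exp (- inverse z) * ((1 - 2 * x) * (inverse z)\<^sup>2))) (at x)"
      proof -
        have dY: "((\<lambda>x. inverse (x * (1 - x))) has_field_derivative - (1 - 2 * x) * (inverse z)\<^sup>2) (at x)"
        proof -
          have "((\<lambda>x. x * (1 - x)) has_field_derivative 1 - 2 * x) (at x)"
            by (auto intro!: derivative_eq_intros)
          moreover have "x * (1 - x) \<noteq> 0" using z by (auto simp: z_def)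
          ultimately have "((\<lambda>x. inverse (x * (1 - x))) has_field_derivative
              - ((1 - 2 * x) * inverse ((x * (1 - x)) ^ Suc (Suc 0)))) (at x)"
            by (rule DERIV_inverse_fun)
          then show ?thesis
            by (rule DERIV_cong) (simp only: z_def power_inverse numeral_2_eq_2 mult_minus_left)
        qed
        have dP: "((\<lambda>x. poly P x * inverse (x * (1 - x)) ^ m) has_field_derivative
            poly (pderiv P) x * inverse z ^ m
           + (real m * (- (1 - 2 * x) * (inverse z)\<^sup>2 * inverse z ^ (m - Suc 0))) * poly P x) (at x)"
          using DERIV_mult[OF poly_DERIV DERIV_power[OF dY, of m], of P] by (simp add: z_def)
        have "((\<lambda>x. exp (- inverse (x * (1 - x)))) has_field_derivative
            exp (- inverse z) * - (- (1 - 2 * x) * (inverse z)\<^sup>2)) (at x)"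
          using DERIV_fun_exp[OF DERIV_minus[OF dY]] by (simp add: z_def)
        from DERIV_mult[OF dP this] show ?thesis
          by (rule DERIV_cong, fold z_def) (simp add: algebra_simps)
      qed
      moreover have "(poly (pderiv P) x * inverse z ^ m
           + poly P x * (real m * inverse z ^ (m - 1) * (- (1 - 2 * x) * (inverse z)\<^sup>2))) * exp (- inverse z)
           + poly P x * inverse z ^ m * (exp (- inverse z) * ((1 - 2 * x) * (inverse z)\<^sup>2)) = bump Q (m + 2) x"
      proof -
        \<comment> \<open>For m = 0 the truncated exponent m - 1 is made harmless by the factor
          \<open>real m\<close>.\<close>
        have "real m * inverse z ^ (m - 1) * (inverse z)\<^sup>2 = real m * inverse z ^ m * inverse z"
          by (cases m) (auto simp: power2_eq_square)
        then have 1: "real m * inverse z ^ (m - 1) * (- (1 - 2 * x) * (inverse z)\<^sup>2) = - (1 - 2 * x) * (real m * inverse z ^ m * inverse z)"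
          by (metis (no_types, lifting) mult.assoc mult.commute)
        have "bump Q (m + 2) x = poly Q x * (inverse z)\<^sup>2 * inverse z ^ m * exp (- inverse z)"
          using True by (simp add: bump_def z_def[symmetric] power_add divide_inverse power_inverse[symmetric] power2_eq_square)
        also have "poly Q x * (inverse z)\<^sup>2 = poly (pderiv P) x - real m * (poly P x * inverse z * (1 - 2 * x))
            + poly P x * (1 - 2 * x) * (inverse z)\<^sup>2"
          unfolding Qx using z by (simp add: field_simps power2_eq_square)
        finally show ?thesis unfolding 1 by (simp add: algebra_simps)
      qed
      ultimately show ?thesis by simp
    qed
    show ?thesis
    proof (rule has_field_derivative_transform_within_open[OF d, of "{0<..<1}"])
      show "poly P y * inverse (y * (1 - y)) ^ m * exp (- inverse (y * (1 - y))) = bump P m y" if "y \<in> {0<..<1}" for y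
        using that by (simp add: bump_def divide_inverse power_inverse[symmetric])
    qed (use True in auto)
  next
    case False
    then have Q0: "bump Q (m + 2) x = 0" by (simp only: bump_def if_False)
    obtain C where C: "\<And>x. \<bar>bump P m x\<bar> \<le> C * x\<^sup>2" "\<And>x. \<bar>bump P m x\<bar> \<le> C * (x - 1)\<^sup>2"
      using bump_bound[of P m] by blast
    consider "x < 0" | "x = 0" | "x = 1" | "1 < x" using False by linarith
    then show ?thesis
    proof cases
      case 1
      have "((\<lambda>_. 0) has_field_derivative 0) (at x)" by simp
      then show ?thesis unfolding Q0
        by (rule has_field_derivative_transform_within_open[of _ _ _ "{..<0}"]) (use 1 in \<open>auto simp: bump_def\<close>)
    next
      case 4
      have "((\<lambda>_. 0) has_field_derivative 0) (at x)" by simp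
      then show ?thesis unfolding Q0
        by (rule has_field_derivative_transform_within_open[of _ _ _ "{1<..}"]) (use 4 in \<open>auto simp: bump_def\<close>)
    next
      case 2
      show ?thesis unfolding Q0 by (rule has_field_derivative_zero_quadratic[of _ C]) (simp add: C 2)
    next
      case 3
      show ?thesis unfolding Q0 by (rule has_field_derivative_zero_quadratic[of _ C]) (simp only: C 3)
    qed
  qed
  then show ?thesis by blast
qed

text \<open>\<open>S\<close> is the normalised primitive of the bump. Rescaled copies of its
  derivative \<open>s\<close> will act as approximate point masses.\<close>

lemma smooth_step:
  obtains S s :: "real \<Rightarrow> real" where
    "\<And>x. (S has_field_derivative s x) (at x)" "\<And>n x. (deriv ^^ n) S field_differentiable at x"
    "\<And>x. x \<le> 0 \<Longrightarrow> S x = 0" "\<And>x. 1 \<le> x \<Longrightarrow> S x = 1" "\<And>x. 0 \<le> S x" "\<And>x. S x \<le> 1"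
    "\<And>x. x \<le> 0 \<or> 1 \<le> x \<Longrightarrow> s x = 0" "continuous_on UNIV s"
proof -
  let ?b = "bump 1 0"
  have cont: "continuous_on A ?b" for A
  proof -
    obtain Q where "\<forall>x. (?b has_field_derivative bump Q (0 + 2) x) (at x)"
      using bump_derivative[of 1 0] by blast
    then show ?thesis by (intro continuous_at_imp_continuous_on ballI) (blast intro: DERIV_isCont)
  qed
  have b_nn: "0 \<le> ?b x" for x by (simp add: bump_def)
  \<comment> \<open>Starting at -1 keeps 0 in the interior of the domain of integration, where the
    fundamental theorem gives a two-sided derivative.\<close>
  define B where "B x = integral {-1..x} ?b" for x
  have B0: "B x = 0" if "x \<le> 0" for x
    unfolding B_def by (rule integral_unique[OF has_integral_is_0]) (use that in \<open>auto simp: bump_def\<close>)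
  have dB: "(B has_field_derivative ?b x) (at x)" for x
  proof (cases "x < 0")
    case True
    have "((\<lambda>_. 0) has_field_derivative 0) (at x)" by simp
    then have "(B has_field_derivative 0) (at x)"
      by (rule has_field_derivative_transform_within_open[of _ _ _ "{..<0}"]) (use True B0 in auto)
    then show ?thesis using True by (simp add: bump_def)
  next
    case False
    have "((\<lambda>u. integral {-1..u} ?b) has_real_derivative ?b x) (at x within {-1..x+1})"
      by (rule integral_has_real_derivative[OF cont]) (use False in auto)
    then show ?thesis unfolding B_def[abs_def]
      using False by (subst (asm) at_within_interior) auto
  qed
  have B_mono: "B x \<le> B y" if "x \<le> y" for x y
    by (rule DERIV_nonneg_imp_nondecreasing[OF that]) (use dB b_nn in blast)
  have B1: "B x = B 1" if "1 \<le> x" for x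
  proof (cases "x = 1")
    case False
    then have "1 < x" using that by simp
    then show ?thesis
    proof (rule DERIV_isconst_end[where f=B])
      show "continuous_on {1..x} B"
        using dB by (auto intro!: continuous_at_imp_continuous_on DERIV_isCont)
      show "(B has_real_derivative 0) (at y)" if "1 < y" "y < x" for y
        using dB[of y] that by (simp add: bump_def)
    qed
  qed simp
  have "B 0 < B 1"
  proof (rule DERIV_pos_imp_increasing_open[where f=B])
    show "\<exists>y. (B has_real_derivative y) (at x) \<and> 0 < y" if "0 < x" "x < 1" for x
      using dB[of x] that by (intro exI[of _ "?b x"]) (simp add: bump_def)
    show "continuous_on {0..1} B"
      using dB by (auto intro!: continuous_at_imp_continuous_on DERIV_isCont)
  qed simp
  then have Bpos: "0 < B 1" using B0[of 0] by simp
  define S where "S x = B x / B 1" for x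
  \<comment> \<open>The normalisation is absorbed into the polynomial, so that \<open>s\<close> is
    again a bump and the family \<open>F\<close> below is closed under differentiation.\<close>
  define s where "s x = bump [:1 / B 1:] 0 x" for x
  have s_eq: "s x = ?b x / B 1" for x by (simp add: s_def bump_def)
  have dS: "(S has_field_derivative s x) (at x)" for x
    unfolding S_def[abs_def] s_eq by (rule DERIV_cdivide[OF dB])
  define F where "F = insert S {bump P m |P m. True}"
  have F: "\<exists>f'\<in>F. \<forall>x. (f has_field_derivative f' x) (at x)" if fF: "f \<in> F" for f
  proof -
    consider "f = S" | P m where "f = bump P m" using fF by (auto simp: F_def)
    then show ?thesis
    proof cases
      case 1
      have "s \<in> F" unfolding F_def s_def[abs_def] by blast
      then show ?thesis using dS 1 by blast
    next
      case 2
      then show ?thesis using bump_derivative[of P m] unfolding F_def by blast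
    qed
  qed
  show ?thesis
  proof
    show "(S has_field_derivative s x) (at x)" for x by (rule dS)
    show "(deriv ^^ n) S field_differentiable at x" for n x
      by (rule iterated_deriv_closed[of S F, OF _ F]) (simp_all add: F_def)
    show "S x = 0" if "x \<le> 0" for x using B0[OF that] by (simp add: S_def)
    show "S x = 1" if "1 \<le> x" for x using B1[OF that] Bpos by (simp add: S_def)
    show "0 \<le> S x" for x
      using B_mono[of 0 x] B0 Bpos by (cases "0 \<le> x") (auto simp: S_def)
    show "S x \<le> 1" for x
      using B_mono[of x 1] B1[of x] Bpos by (cases "x \<le> 1") (auto simp: S_def)
    show "s x = 0" if "x \<le> 0 \<or> 1 \<le> x" for x using that by (auto simp: s_def bump_def)
    show "continuous_on UNIV s" unfolding s_eq[abs_def] using Bpos by (intro continuous_intros cont) auto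
  qed
qed

text \<open>The test functions are smooth plateaus over (p, q] with flanks of width 1/(n + 1). Their
  derivatives average \<open>W\<close> just after \<open>p\<close> and just after \<open>q\<close>,
  while the plateaus tend to the indicator of (p, q]. Only then does \<open>p\<close> tend to 0,
  because supports have to stay away from 0.\<close>

lemma du_bois_reymond:
  fixes W D :: "real \<Rightarrow> real"
  assumes W: "continuous_on {0..T} W" and D: "integrable lborel D"
    and weak: "\<And>\<psi>. test_function T \<psi> \<Longrightarrow>
      (LINT t|lborel. deriv \<psi> t * cutoff T W t) = - (LINT t|lborel. \<psi> t * D t)"
    and q: "0 < q" "q < T"
  shows "W q = W 0 + (LINT s|lborel. cutoff q D s)"
proof -
  obtain S s :: "real \<Rightarrow> real" where dS: "\<And>x. (S has_field_derivative s x) (at x)"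
    and smooth: "\<And>n x. (deriv ^^ n) S field_differentiable at x"
    and S0: "\<And>x. x \<le> 0 \<Longrightarrow> S x = 0" and S1: "\<And>x. 1 \<le> x \<Longrightarrow> S x = 1"
    and S_ge: "\<And>x. 0 \<le> S x" and S_le: "\<And>x. S x \<le> 1"
    and s0: "\<And>x. x \<le> 0 \<or> 1 \<le> x \<Longrightarrow> s x = 0" and s_cont: "continuous_on UNIV s"
    by (rule smooth_step, rule that)
  have [measurable]: "s \<in> borel_measurable borel" "S \<in> borel_measurable borel" "D \<in> borel_measurable borel"
    using s_cont dS D
    by (auto intro!: borel_measurable_continuous_onI continuous_at_imp_continuous_on DERIV_isCont)
  obtain M where M: "\<And>t. t \<in> {0..T} \<Longrightarrow> \<bar>W t\<bar> \<le> M"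
    using compact_imp_bounded[OF compact_continuous_image[OF W compact_Icc]]
    by (metis (no_types, lifting) bounded_real imageI)
  have M0: "0 \<le> M" using M[of 0] q by auto
  have W_le: "\<bar>cutoff T W t\<bar> \<le> M" for t using M M0 by (auto simp: cutoff_def)
  have [measurable]: "cutoff T W \<in> borel_measurable borel"
  proof -
    have "(\<lambda>t. indicator {0..T} t *\<^sub>R W t) \<in> borel_measurable borel"
      by (rule borel_measurable_continuous_on_indicator) (use W in auto)
    then have "cutoff T (\<lambda>t. indicator {0..T} t *\<^sub>R W t) \<in> borel_measurable borel" by simp
    moreover have "cutoff T (\<lambda>t. indicator {0..T} t *\<^sub>R W t) = cutoff T W"
      by (auto simp: cutoff_def fun_eq_iff)
    ultimately show ?thesis by (simp only:)
  qed
  have s_int: "integrable lborel s" and s_one: "(LINT x|lborel. s x) = 1"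
  proof -
    have "has_bochner_integral lborel (\<lambda>x. s x * indicator {0..1} x) (S 1 - S 0)"
      by (rule has_bochner_integral_FTC_Icc_real)
        (use dS s_cont in \<open>auto simp: continuous_on_eq_continuous_at\<close>)
    moreover have "(\<lambda>x. s x * indicator {0..1} x) = s"
    proof
      show "s x * indicator {0..1} x = s x" for x
        using s0[of x] by (cases "x \<le> 0 \<or> 1 \<le> x") auto
    qed
    ultimately show "integrable lborel s" "(LINT x|lborel. s x) = 1"
      using S0[of 0] S1[of 1] by (auto simp: has_bochner_integral_iff)
  qed
  define \<psi> where "\<psi> p q n x = S (real (Suc n) * (x - p)) - S (real (Suc n) * (x - q))" for p q n x
  have d\<psi>: "(\<psi> p q n has_field_derivative real (Suc n) * s (real (Suc n) * (x - p)) - real (Suc n) * s (real (Suc n) * (x - q))) (at x)" for p q n x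
    unfolding \<psi>_def
    by (auto intro!: derivative_eq_intros DERIV_chain'[OF _ dS] simp: algebra_simps)
  have test: "test_function T (\<psi> p q n)" if "0 < p" "p < q" "q + 1 / real (Suc n) < T" for p q n
  proof -
    let ?a = "real (Suc n)"
    \<comment> \<open>By the chain rule for the affine arguments of slope \<open>Suc n\<close>, the
      derivative of the member with index \<open>m\<close> is the one with index
      \<open>Suc m\<close>.\<close>
    define F where "F = {\<lambda>x. ?a ^ m * ((deriv ^^ m) S (?a * (x - p)) - (deriv ^^ m) S (?a * (x - q))) | m. True}"
    have "\<exists>f'\<in>F. \<forall>x. (f has_field_derivative f' x) (at x)" if fF: "f \<in> F" for f
    proof -
      obtain m where f: "f = (\<lambda>x. ?a ^ m * ((deriv ^^ m) S (?a * (x - p)) - (deriv ^^ m) S (?a * (x - q))))"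
        using fF unfolding F_def by blast
      have dm: "((deriv ^^ m) S has_field_derivative (deriv ^^ Suc m) S x) (at x)" for x
        using smooth[of m x] by (simp add: field_differentiable_derivI)
      have aff: "((\<lambda>x. ?a * (x - c)) has_field_derivative ?a) (at x)" for c x
        by (auto intro!: derivative_eq_intros)
      have "(f has_field_derivative ?a ^ m * ((deriv ^^ Suc m) S (?a * (x - p)) * ?a - (deriv ^^ Suc m) S (?a * (x - q)) * ?a)) (at x)" for x
        unfolding f by (intro DERIV_cmult DERIV_diff DERIV_chain2[OF dm aff])
      moreover have "?a ^ m * ((deriv ^^ Suc m) S (?a * (x - p)) * ?a - (deriv ^^ Suc m) S (?a * (x - q)) * ?a)
        = ?a ^ Suc m * ((deriv ^^ Suc m) S (?a * (x - p)) - (deriv ^^ Suc m) S (?a * (x - q)))" for x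
        by (simp add: algebra_simps del: of_nat_Suc)
      ultimately show ?thesis
        unfolding F_def by (intro bexI[where x="\<lambda>x. ?a ^ Suc m * ((deriv ^^ Suc m) S (?a * (x - p)) - (deriv ^^ Suc m) S (?a * (x - q)))"])
          (auto simp only: mem_Collect_eq)
    qed
    moreover have "\<psi> p q n \<in> F"
      unfolding F_def \<psi>_def by (rule CollectI, rule exI[of _ 0]) simp
    ultimately have "(deriv ^^ m) (\<psi> p q n) field_differentiable at x" for m x
      by (intro iterated_deriv_closed[of _ F])
    moreover have "\<psi> p q n x = 0" if "x \<notin> {p..q + 1 / ?a}" for x
    proof (cases "x < p")
      case True
      then show ?thesis using \<open>p < q\<close> by (simp add: \<psi>_def S0 mult_nonneg_nonpos)
    next
      case False
      then have x: "q + 1 / ?a < x" using that by auto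
      then have "1 \<le> ?a * (x - q)" by (simp add: field_simps)
      moreover have "?a * (x - q) \<le> ?a * (x - p)" using \<open>p < q\<close> by (intro mult_left_mono) auto
      ultimately have "S (?a * (x - q)) = 1" "S (?a * (x - p)) = 1"
        using S1 order_trans by blast+
      then show ?thesis by (simp add: \<psi>_def)
    qed
    moreover have "p \<le> q + 1 / ?a" using \<open>p < q\<close> by (simp add: add_increasing2)
    ultimately show ?thesis
      unfolding test_function_def using that by (intro conjI allI exI[of _ p] exI[of _ "q + 1 / ?a"]) auto
  qed
  \<comment> \<open>The substitution t = p + y/(n + 1) moves the concentration from \<open>s\<close>
    into the argument of \<open>W\<close>, where continuity and dominated convergence apply.\<close>
  have avg_int: "integrable lborel (\<lambda>t. real (Suc n) * s (real (Suc n) * (t - p)) * cutoff T W t)"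
    and avg: "(LINT t|lborel. real (Suc n) * s (real (Suc n) * (t - p)) * cutoff T W t)
    = (LINT y|lborel. s y * cutoff T W (p + y / real (Suc n)))" for n p
  proof -
    let ?f = "\<lambda>t. real (Suc n) * s (real (Suc n) * (t - p)) * cutoff T W t"
    have eq: "?f (p + 1 / real (Suc n) * y) = real (Suc n) * (s y * cutoff T W (p + y / real (Suc n)))" for y
      by (simp add: field_simps del: of_nat_Suc)
    have "integrable lborel (\<lambda>y. s y * cutoff T W (p + y / real (Suc n)))"
    proof (rule Bochner_Integration.integrable_bound)
      show "integrable lborel (\<lambda>y. M * s y)" using s_int by simp
      show "AE y in lborel. norm (s y * cutoff T W (p + y / real (Suc n))) \<le> norm (M * s y)"
      proof (rule AE_I2)
        show "norm (s y * cutoff T W (p + y / real (Suc n))) \<le> norm (M * s y)" for y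
          using mult_left_mono[OF W_le, of "\<bar>s y\<bar>"] M0 by (simp add: abs_mult mult.commute)
      qed
    qed measurable
    then have "integrable lborel (\<lambda>y. ?f (p + 1 / real (Suc n) * y))"
      unfolding eq by simp
    then show "integrable lborel ?f"
      by (subst (asm) lborel_integrable_real_affine_iff) auto
    have "(LINT t|lborel. ?f t) = \<bar>1 / real (Suc n)\<bar> *\<^sub>R (LINT y|lborel. ?f (p + 1 / real (Suc n) * y))"
      by (rule lborel_integral_real_affine) simp
    then show "(LINT t|lborel. ?f t) = (LINT y|lborel. s y * cutoff T W (p + y / real (Suc n)))"
      unfolding eq by (simp del: of_nat_Suc)
  qed
  have avg_lim: "(\<lambda>n. LINT y|lborel. s y * cutoff T W (p + y / real (Suc n))) \<longlonglongrightarrow> W p" if p: "0 < p" "p < T" for p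
  proof -
    have "(\<lambda>n. LINT y|lborel. s y * cutoff T W (p + y / real (Suc n))) \<longlonglongrightarrow> (LINT y|lborel. s y * W p)"
    proof (rule integral_dominated_convergence[where w="\<lambda>y. M * \<bar>s y\<bar>"])
      show "AE y in lborel. (\<lambda>n. s y * cutoff T W (p + y / real (Suc n))) \<longlonglongrightarrow> s y * W p"
      proof (rule AE_I2)
        fix y
        have "isCont W p" using continuous_on_interior[OF W, of p] p by simp
        then have "isCont (cutoff T W) p"
        proof (rule continuous_transform_within)
          show "0 < min p (T - p)" using p by simp
          show "W x' = cutoff T W x'" if "dist x' p < min p (T - p)" for x'
            using that by (auto simp: dist_real_def cutoff_def)
        qed auto
        moreover have "(\<lambda>n. p + y / real (Suc n)) \<longlonglongrightarrow> p + 0"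
          by (intro tendsto_add tendsto_const LIMSEQ_Suc[of "\<lambda>n. y / real n"] lim_const_over_n)
        ultimately have "(\<lambda>n. cutoff T W (p + y / real (Suc n))) \<longlonglongrightarrow> cutoff T W p"
          using isCont_tendsto_compose by fastforce
        then show "(\<lambda>n. s y * cutoff T W (p + y / real (Suc n))) \<longlonglongrightarrow> s y * W p"
          using p by (intro tendsto_mult_left) simp
      qed
      show "AE y in lborel. norm (s y * cutoff T W (p + y / real (Suc n))) \<le> M * \<bar>s y\<bar>" for n
      proof (rule AE_I2)
        show "norm (s y * cutoff T W (p + y / real (Suc n))) \<le> M * \<bar>s y\<bar>" for y
          using mult_left_mono[OF W_le, of "\<bar>s y\<bar>"] by (simp add: abs_mult mult.commute)
      qed
    qed (use s_int in auto)
    then show ?thesis using s_one by simp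
  qed
  have step: "W q - W p = (LINT t|lborel. indicator {p<..q} t * D t)" if p: "0 < p" "p < q" for p
  proof -
    \<comment> \<open>The right flank reaches as far as q + 1/(n + 1), so the plateau is an
      admissible test function only for large \<open>n\<close>.\<close>
    have "(\<lambda>n. q + 1 / real (Suc n)) \<longlonglongrightarrow> q + 0"
      by (intro tendsto_add tendsto_const LIMSEQ_Suc[of "\<lambda>n. 1 / real n"] lim_const_over_n)
    then have "eventually (\<lambda>n. q + 1 / real (Suc n) < T) sequentially"
      using q by (intro order_tendstoD(2)) auto
    then have ev: "eventually (\<lambda>n. (LINT y|lborel. s y * cutoff T W (p + y / real (Suc n)))
        - (LINT y|lborel. s y * cutoff T W (q + y / real (Suc n))) = - (LINT t|lborel. \<psi> p q n t * D t)) sequentially"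
    proof eventually_elim
      case (elim n)
      have "deriv (\<psi> p q n) t = real (Suc n) * s (real (Suc n) * (t - p)) - real (Suc n) * s (real (Suc n) * (t - q))" for t
        by (rule DERIV_imp_deriv[OF d\<psi>])
      then have "(LINT t|lborel. deriv (\<psi> p q n) t * cutoff T W t)
        = (LINT t|lborel. real (Suc n) * s (real (Suc n) * (t - p)) * cutoff T W t
            - real (Suc n) * s (real (Suc n) * (t - q)) * cutoff T W t)"
        by (simp only: left_diff_distrib)
      also have "\<dots> = (LINT y|lborel. s y * cutoff T W (p + y / real (Suc n)))
          - (LINT y|lborel. s y * cutoff T W (q + y / real (Suc n)))"
        using avg_int avg by (simp del: of_nat_Suc)
      finally show ?case using weak[OF test[OF p elim]] by simp
    qed
    have "(\<lambda>n. LINT t|lborel. \<psi> p q n t * D t) \<longlonglongrightarrow> (LINT t|lborel. indicator {p<..q} t * D t)"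
    proof (rule integral_dominated_convergence[where w="\<lambda>t. \<bar>D t\<bar>"])
      show "AE t in lborel. (\<lambda>n. \<psi> p q n t * D t) \<longlonglongrightarrow> indicator {p<..q} t * D t"
      proof (rule AE_I2)
        fix t
        have S_lim: "(\<lambda>n. S (real (Suc n) * (t - c))) \<longlonglongrightarrow> indicator {c<..} t" for c
        proof (cases "c < t")
          case True
          obtain N where N: "1 / (t - c) < real N" using reals_Archimedean2 by blast
          have "S (real (Suc n) * (t - c)) = 1" if "N \<le> n" for n
          proof (rule S1)
            have "1 / (t - c) \<le> real (Suc n)" using N that by simp
            then show "1 \<le> real (Suc n) * (t - c)" using True by (simp add: pos_divide_le_eq del: of_nat_Suc)
          qed
          then show ?thesis using True by (intro tendsto_eventually eventually_sequentiallyI[of N]) simp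
        next
          case False
          then show ?thesis by (simp add: S0 mult_nonneg_nonpos del: of_nat_Suc)
        qed
        have "(\<lambda>n. \<psi> p q n t * D t) \<longlonglongrightarrow> (indicator {p<..} t - indicator {q<..} t) * D t"
          unfolding \<psi>_def by (intro tendsto_intros S_lim)
        moreover have "indicator {p<..} t - indicator {q<..} t = (indicator {p<..q} t :: real)"
          using p by (auto simp: indicator_def)
        ultimately show "(\<lambda>n. \<psi> p q n t * D t) \<longlonglongrightarrow> indicator {p<..q} t * D t" by simp
      qed
      show "AE t in lborel. norm (\<psi> p q n t * D t) \<le> \<bar>D t\<bar>" for n
      proof (rule AE_I2)
        fix t
        have "\<bar>\<psi> p q n t\<bar> \<le> 1"
          using S_ge[of "real (Suc n) * (t - p)"] S_ge[of "real (Suc n) * (t - q)"]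
            S_le[of "real (Suc n) * (t - p)"] S_le[of "real (Suc n) * (t - q)"] unfolding \<psi>_def by linarith
        then show "norm (\<psi> p q n t * D t) \<le> \<bar>D t\<bar>" by (simp add: abs_mult mult_left_le_one_le)
      qed
      show "(\<lambda>t. \<psi> p q n t * D t) \<in> borel_measurable lborel" for n
        unfolding \<psi>_def by measurable
    qed (use D in auto)
    then have "(\<lambda>n. - (LINT t|lborel. \<psi> p q n t * D t)) \<longlonglongrightarrow> - (LINT t|lborel. indicator {p<..q} t * D t)"
      by (rule tendsto_minus)
    moreover have "(\<lambda>n. (LINT y|lborel. s y * cutoff T W (p + y / real (Suc n)))
        - (LINT y|lborel. s y * cutoff T W (q + y / real (Suc n)))) \<longlonglongrightarrow> W p - W q"
      using p q by (intro tendsto_diff avg_lim) auto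
    then have "(\<lambda>n. - (LINT t|lborel. \<psi> p q n t * D t)) \<longlonglongrightarrow> W p - W q"
      using ev by (rule Lim_transform_eventually)
    ultimately have "W p - W q = - (LINT t|lborel. indicator {p<..q} t * D t)"
      by (rule LIMSEQ_unique[rotated])
    then show ?thesis by simp
  qed
  \<comment> \<open>The shift of the index by 2 makes \<open>X n\<close> strictly smaller than
    \<open>q\<close> also for n = 0.\<close>
  define X where "X n = q / real (Suc (Suc n))" for n
  have X: "0 < X n" "X n < q" for n
  proof -
    show "0 < X n" using q by (simp add: X_def)
    have "q / real (Suc (Suc n)) < q / 1"
      using q by (intro divide_strict_left_mono) auto
    then show "X n < q" by (simp add: X_def)
  qed
  have X_lim: "X \<longlonglongrightarrow> 0"
    unfolding X_def[abs_def] by (intro LIMSEQ_Suc[of "\<lambda>n. q / real (Suc n)"] LIMSEQ_Suc[of "\<lambda>n. q / real n"] lim_const_over_n)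
  have "(\<lambda>n. W (X n)) \<longlonglongrightarrow> W 0"
  proof (rule continuous_on_tendsto_compose[OF W X_lim])
    have "X n \<in> {0..T}" for n using X[of n] q by simp
    then show "\<forall>\<^sub>F n in sequentially. X n \<in> {0..T}" by simp
  qed (use q in simp)
  then have "(\<lambda>n. W q - W (X n)) \<longlonglongrightarrow> W q - W 0" by (intro tendsto_intros)
  moreover have "(\<lambda>n. W q - W (X n)) \<longlonglongrightarrow> (LINT t|lborel. cutoff q D t)"
    unfolding step[OF X(1,2)]
  proof (rule integral_dominated_convergence[where w="\<lambda>t. \<bar>D t\<bar>"])
    show "AE t in lborel. (\<lambda>n. indicator {X n<..q} t * D t) \<longlonglongrightarrow> cutoff q D t"
    proof (rule AE_I2)
      fix t
      show "(\<lambda>n. indicator {X n<..q} t * D t) \<longlonglongrightarrow> cutoff q D t"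
      proof (cases "0 < t \<and> t \<le> q")
        case True
        then have "eventually (\<lambda>n. X n < t) sequentially"
          using X_lim by (intro order_tendstoD(2)) auto
        then have "eventually (\<lambda>n. indicator {X n<..q} t * D t = cutoff q D t) sequentially"
          by eventually_elim (use True in auto)
        then show ?thesis by (rule tendsto_eventually)
      next
        case False
        then have "indicator {X n<..q} t * D t = cutoff q D t" for n
          using X(1)[of n] by (auto simp: cutoff_def indicator_def)
        then show ?thesis by simp
      qed
    qed
    show "AE t in lborel. norm (indicator {X n<..q} t * D t) \<le> \<bar>D t\<bar>" for n
      by (auto simp: indicator_def)
  qed (use D in auto)
  ultimately have "W q - W 0 = (LINT t|lborel. cutoff q D t)" by (rule LIMSEQ_unique)
  then show ?thesis by simp
qed

section \<open>Scalar products with strong integrals\<close>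

text \<open>The triangle inequality is integrated. Measurability of the norms of the differences is
  supplied by \<open>simple_limit\<close>; Borel measurability of \<open>f\<close> would not give it
  in a non-separable space.\<close>

lemma simple_bochner_integral_dist:
  fixes f :: "'a \<Rightarrow> 'b::real_normed_vector"
  assumes f: "simple_limit M f"
    and s: "Bochner_Integration.simple_bochner_integrable M s" and t: "Bochner_Integration.simple_bochner_integrable M t"
  shows "ennreal (norm (Bochner_Integration.simple_bochner_integral M s - Bochner_Integration.simple_bochner_integral M t)) \<le>
    (\<integral>\<^sup>+ x. ennreal (norm (f x - s x)) \<partial>M) + (\<integral>\<^sup>+ x. ennreal (norm (f x - t x)) \<partial>M)"
proof -
  have ss: "simple_limit M s" "simple_limit M t"
    using s t by (auto intro: simple_limit_simple elim: simple_bochner_integrable.cases)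
  have [measurable]: "(\<lambda>x. norm (f x - s x)) \<in> borel_measurable M" "(\<lambda>x. norm (f x - t x)) \<in> borel_measurable M"
    by (intro simple_limit_measurable[OF simple_limit_norm[OF simple_limit_diff]] f ss)+
  have "ennreal (norm (Bochner_Integration.simple_bochner_integral M s - Bochner_Integration.simple_bochner_integral M t))
     = norm (Bochner_Integration.simple_bochner_integral M (\<lambda>x. s x - t x))"
    using s t by (subst simple_bochner_integral_diff) auto
  also have "\<dots> \<le> Bochner_Integration.simple_bochner_integral M (\<lambda>x. norm (s x - t x))"
    using simple_bochner_integrable_compose2[of "(-)" M s t] s t
    by (auto intro!: simple_bochner_integral_norm_bound)
  also have "\<dots> = (\<integral>\<^sup>+x. norm (s x - t x) \<partial>M)"
    using simple_bochner_integrable_compose2[of "\<lambda>x y. norm (x - y)" M s t] s t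
    by (auto intro!: simple_bochner_integral_eq_nn_integral)
  also have "\<dots> \<le> (\<integral>\<^sup>+x. ennreal (norm (f x - s x)) + ennreal (norm (f x - t x)) \<partial>M)"
  proof (rule nn_integral_mono)
    fix x
    have "norm (s x - t x) \<le> norm (f x - s x) + norm (f x - t x)"
      using norm_triangle_ineq4[of "f x - t x" "f x - s x"] by (simp add: add.commute)
    then show "ennreal (norm (s x - t x)) \<le> ennreal (norm (f x - s x)) + ennreal (norm (f x - t x))"
      by (simp flip: ennreal_plus)
  qed
  also have "\<dots> = (\<integral>\<^sup>+x. ennreal (norm (f x - s x)) \<partial>M) + (\<integral>\<^sup>+x. ennreal (norm (f x - t x)) \<partial>M)"
    by (rule nn_integral_add) auto
  finally show ?thesis .
qed

text \<open>Pairing with \<open>a\<close> commutes with the integral of simple functions, and by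
  Cauchy-Schwarz it changes the L^1 error by at most the factor \<open>norm a\<close>. The result
  lives in the scalar Bochner integral, where Fubini is at hand.\<close>

lemma has_strong_integral_inner:
  fixes f f' :: "'a \<Rightarrow> 'h::real_inner"
  assumes f': "simple_limit M f'" and ae: "AE x in M. f x = f' x" and x: "has_strong_integral M f x"
  shows "has_bochner_integral M (\<lambda>t. f' t \<bullet> a) (x \<bullet> a)"
proof -
  obtain s where s: "\<And>i. Bochner_Integration.simple_bochner_integrable M (s i)"
    and s0: "(\<lambda>i. \<integral>\<^sup>+ y. ennreal (norm (f y - s i y)) \<partial>M) \<longlonglongrightarrow> 0"
    and sx: "(\<lambda>i. Bochner_Integration.simple_bochner_integral M (s i)) \<longlonglongrightarrow> x"
    using x unfolding has_strong_integral_def by blast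
  have sl: "simple_limit M (s i)" for i
    using s[of i] by (auto intro: simple_limit_simple elim: simple_bochner_integrable.cases)
  have nn: "(\<integral>\<^sup>+ y. ennreal (norm (f y - s i y)) \<partial>M) = (\<integral>\<^sup>+ y. ennreal (norm (f' y - s i y)) \<partial>M)" for i
    using ae by (intro nn_integral_cong_AE) auto
  show ?thesis
  proof (rule has_bochner_integral.intros)
    show "(\<lambda>t. f' t \<bullet> a) \<in> borel_measurable M"
      by (intro simple_limit_measurable simple_limit_inner f' simple_limit_const)
    show "Bochner_Integration.simple_bochner_integrable M (\<lambda>t. s i t \<bullet> a)" for i
      using simple_bochner_integrable_compose2[of "\<lambda>x y. x \<bullet> a" M "s i" "s i"] s by simp
    have "Bochner_Integration.simple_bochner_integral M (\<lambda>t. s i t \<bullet> a) = Bochner_Integration.simple_bochner_integral M (s i) \<bullet> a" for i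
      by (rule simple_bochner_integral_linear[OF _ s])
       (rule bounded_linear.linear[OF bounded_linear_inner_left])
    then show "(\<lambda>i. Bochner_Integration.simple_bochner_integral M (\<lambda>t. s i t \<bullet> a)) \<longlonglongrightarrow> x \<bullet> a"
      using tendsto_inner[OF sx tendsto_const[of a]] by simp
    have le: "(\<integral>\<^sup>+ t. ennreal (norm (f' t \<bullet> a - s i t \<bullet> a)) \<partial>M) \<le> (\<integral>\<^sup>+ y. ennreal (norm (f' y - s i y)) \<partial>M) * ennreal (norm a)" for i
    proof -
      have [measurable]: "(\<lambda>x. norm (f' x - s i x)) \<in> borel_measurable M"
        by (intro simple_limit_measurable[OF simple_limit_norm[OF simple_limit_diff]] f' sl)
      have "(\<integral>\<^sup>+ t. ennreal (norm (f' t \<bullet> a - s i t \<bullet> a)) \<partial>M) \<le> (\<integral>\<^sup>+ t. ennreal (norm (f' t - s i t)) * ennreal (norm a) \<partial>M)"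
      proof (rule nn_integral_mono)
        fix t
        have "norm (f' t \<bullet> a - s i t \<bullet> a) \<le> norm (f' t - s i t) * norm a"
          using Cauchy_Schwarz_ineq2[of "f' t - s i t" a] by (simp add: inner_diff_left)
        then show "ennreal (norm (f' t \<bullet> a - s i t \<bullet> a)) \<le> ennreal (norm (f' t - s i t)) * ennreal (norm a)"
          by (simp flip: ennreal_mult)
      qed
      also have "\<dots> = (\<integral>\<^sup>+ t. ennreal (norm (f' t - s i t)) \<partial>M) * ennreal (norm a)"
        by (rule nn_integral_multc) measurable
      finally show ?thesis .
    qed
    have "(\<lambda>i. (\<integral>\<^sup>+ y. ennreal (norm (f' y - s i y)) \<partial>M) * ennreal (norm a)) \<longlonglongrightarrow> 0 * ennreal (norm a)"
      using s0 unfolding nn by (intro tendsto_mult_ennreal tendsto_const) auto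
    then have lim: "(\<lambda>i. (\<integral>\<^sup>+ y. ennreal (norm (f' y - s i y)) \<partial>M) * ennreal (norm a)) \<longlonglongrightarrow> 0"
      by simp
    show "(\<lambda>i. \<integral>\<^sup>+ t. ennreal (norm (f' t \<bullet> a - s i t \<bullet> a)) \<partial>M) \<longlonglongrightarrow> 0"
    proof (rule tendsto_sandwich)
      show "\<forall>\<^sub>F i in sequentially. 0 \<le> (\<integral>\<^sup>+ t. ennreal (norm (f' t \<bullet> a - s i t \<bullet> a)) \<partial>M)"
        by simp
      show "\<forall>\<^sub>F i in sequentially. (\<integral>\<^sup>+ t. ennreal (norm (f' t \<bullet> a - s i t \<bullet> a)) \<partial>M)
          \<le> (\<integral>\<^sup>+ y. ennreal (norm (f' y - s i y)) \<partial>M) * ennreal (norm a)"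
        by (intro always_eventually allI le)
    qed (simp, fact lim)
  qed
qed

text \<open>Dominated simple approximants converge to \<open>f'\<close> in L^1, so their integrals
  form a Cauchy sequence, and completeness supplies the limit.\<close>

lemma has_strong_integral_exists:
  fixes f f' :: "'a \<Rightarrow> 'h::{real_normed_vector, complete_space}"
  assumes f': "simple_limit M f'" and int: "integrable M (\<lambda>x. norm (f' x))" and ae: "AE x in M. f x = f' x"
  shows "\<exists>x. has_strong_integral M f x"
proof -
  obtain s where s: "\<And>i. simple_function M (s i)" "\<And>x. x \<in> space M \<Longrightarrow> (\<lambda>i. s i x) \<longlonglongrightarrow> f' x"
    "\<And>i x. x \<in> space M \<Longrightarrow> norm (s i x) \<le> 2 * norm (f' x)"
    by (rule simple_limit_dominated[OF f'], rule that)
  have sl: "simple_limit M (s i)" for i by (intro simple_limit_simple s)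
  have [measurable]: "(\<lambda>x. norm (f' x - s i x)) \<in> borel_measurable M" for i
    by (intro simple_limit_measurable[OF simple_limit_norm[OF simple_limit_diff]] f' sl)
  have fin: "(\<integral>\<^sup>+x. ennreal (norm (f' x)) \<partial>M) < \<infinity>"
    using int by (simp add: integrable_iff_bounded)
  have [measurable]: "(\<lambda>x. norm (f' x)) \<in> borel_measurable M" using int by simp
  have sbi: "Bochner_Integration.simple_bochner_integrable M (s i)" for i
  proof (rule simple_bochner_integrableI_bounded[OF s(1)])
    have "(\<integral>\<^sup>+ x. ennreal (norm (s i x)) \<partial>M) \<le> (\<integral>\<^sup>+ x. 2 * ennreal (norm (f' x)) \<partial>M)"
    proof (rule nn_integral_mono)
      fix x assume "x \<in> space M"
      then have "ennreal (norm (s i x)) \<le> ennreal (2 * norm (f' x))" using s(3) by (intro ennreal_leI)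
      then show "ennreal (norm (s i x)) \<le> 2 * ennreal (norm (f' x))" by (simp add: ennreal_mult)
    qed
    also have "\<dots> = 2 * (\<integral>\<^sup>+ x. ennreal (norm (f' x)) \<partial>M)" by (rule nn_integral_cmult) measurable
    also have "\<dots> < \<infinity>" using fin by (simp add: ennreal_mult_less_top)
    finally show "(\<integral>\<^sup>+ x. ennreal (norm (s i x)) \<partial>M) < \<infinity>" .
  qed
  define e where "e i = (\<integral>\<^sup>+ x. ennreal (norm (f' x - s i x)) \<partial>M)" for i
  have e0: "e \<longlonglongrightarrow> 0"
  proof -
    have "(\<lambda>i. \<integral>\<^sup>+ x. ennreal (norm (0 - norm (f' x - s i x))) \<partial>M) \<longlonglongrightarrow> 0"
    proof (rule nn_integral_dominated_convergence_norm[where w="\<lambda>x. 3 * norm (f' x)"])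
      show "AE x in M. norm (norm (f' x - s i x)) \<le> 3 * norm (f' x)" for i
      proof (rule AE_I2)
        fix x assume "x \<in> space M"
        then show "norm (norm (f' x - s i x)) \<le> 3 * norm (f' x)"
          using norm_triangle_ineq4[of "f' x" "s i x"] s(3)[of x i] by simp
      qed
      show "(\<integral>\<^sup>+ x. ennreal (3 * norm (f' x)) \<partial>M) < \<infinity>"
        using fin by (simp add: ennreal_mult nn_integral_cmult ennreal_mult_less_top)
      show "AE x in M. (\<lambda>i. norm (f' x - s i x)) \<longlonglongrightarrow> 0"
      proof (rule AE_I2)
        fix x assume x: "x \<in> space M"
        show "(\<lambda>i. norm (f' x - s i x)) \<longlonglongrightarrow> 0"
          using tendsto_norm[OF tendsto_diff[OF tendsto_const[of "f' x"] s(2)[OF x]]] by simp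
      qed
    qed measurable
    then show ?thesis by (simp add: e_def[abs_def])
  qed
  let ?z = "\<lambda>i. Bochner_Integration.simple_bochner_integral M (s i)"
  have "Cauchy ?z"
  proof (rule metric_CauchyI)
    fix r :: real assume r: "0 < r"
    then have "eventually (\<lambda>i. e i < ennreal (r / 2)) sequentially"
      using e0 by (intro order_tendstoD(2)) auto
    then obtain N where N: "\<And>i. i \<ge> N \<Longrightarrow> e i < ennreal (r / 2)" by (auto simp: eventually_sequentially)
    show "\<exists>N. \<forall>m\<ge>N. \<forall>n\<ge>N. dist (?z m) (?z n) < r"
    proof (intro exI allI impI)
      fix m n assume "N \<le> m" "N \<le> n"
      have "ennreal (norm (?z m - ?z n)) \<le> e m + e n"
        unfolding e_def by (rule simple_bochner_integral_dist[OF f' sbi sbi])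
      also have "\<dots> < ennreal (r / 2) + ennreal (r / 2)"
        using N[OF \<open>N \<le> m\<close>] N[OF \<open>N \<le> n\<close>] by (rule add_strict_mono)
      also have "\<dots> = ennreal r" using r by (simp flip: ennreal_plus)
      finally show "dist (?z m) (?z n) < r" using r by (simp add: dist_norm ennreal_less_iff)
    qed
  qed
  then obtain x where x: "?z \<longlonglongrightarrow> x" using Cauchy_convergent convergent_def by blast
  have "(\<integral>\<^sup>+ y. ennreal (norm (f y - s i y)) \<partial>M) = e i" for i
    unfolding e_def using ae by (intro nn_integral_cong_AE) auto
  then have "(\<lambda>i. \<integral>\<^sup>+ y. ennreal (norm (f y - s i y)) \<partial>M) \<longlonglongrightarrow> 0" using e0 by simp
  moreover have "strongly_measurable M f"
    unfolding strongly_measurable_def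
  proof (intro exI[of _ s] conjI allI s(1))
    show "AE x in M. (\<lambda>i. s i x) \<longlonglongrightarrow> f x"
      using ae AE_space by eventually_elim (use s(2) in simp)
  qed
  ultimately show ?thesis
    unfolding has_strong_integral_def using x sbi by blast
qed

text \<open>The uniqueness behind the definite description comes from scalar products: two
  candidates \<open>x\<close> and \<open>y\<close> have the same product with every vector, in
  particular with y - x.\<close>

lemma strong_integral_inner_AE:
  fixes f f' :: "'a \<Rightarrow> 'h::{real_inner, complete_space}"
  assumes "simple_limit M f'" "integrable M (\<lambda>x. norm (f' x))" "AE x in M. f x = f' x"
  shows "strong_integral M f \<bullet> a = (LINT t|M. f' t \<bullet> a)"
proof -
  obtain x where x: "has_strong_integral M f x"
    using has_strong_integral_exists[OF assms] by blast
  have inner: "y \<bullet> b = (LINT t|M. f' t \<bullet> b)" if "has_strong_integral M f y" for y b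
    by (rule has_bochner_integral_integral_eq[symmetric, OF has_strong_integral_inner[OF assms(1,3) that]])
  have "y = x" if "has_strong_integral M f y" for y
  proof -
    have "(y - x) \<bullet> (y - x) = 0"
      using inner[OF that, of "y - x"] inner[OF x, of "y - x"] by (simp only: inner_diff_left)
    then show ?thesis by simp
  qed
  then have "(THE x. has_strong_integral M f x) = x"
    using x by (intro the_equality)
  then have "strong_integral M f = x"
    using x by (auto simp: strong_integral_def)
  then show ?thesis using inner[OF x] by simp
qed

lemma strong_integral_inner:
  fixes f f' :: "real \<Rightarrow> 'h::{real_inner, complete_space}"
  assumes S[measurable]: "S \<in> sets borel" and f': "simple_limit borel f'"
    and int: "integrable lborel (\<lambda>x. norm (f' x))"
    and ae: "AE x in lborel. (if x \<in> S then f x else 0) = f' x"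
  shows "strong_integral (lebesgue_on S) f \<bullet> a = (LINT t|lborel. f' t \<bullet> a)"
proof -
  have id: "(\<lambda>x. x) \<in> measurable (lebesgue_on S) borel"
    by (intro measurable_restrict_space1 measurable_completion) simp
  have S': "S \<inter> space lebesgue \<in> sets lebesgue" using S by simp
  have norm_meas: "(\<lambda>x. norm (f' x)) \<in> borel_measurable borel"
    by (rule simple_limit_measurable[OF simple_limit_norm[OF f']])
  have inner_meas: "(\<lambda>x. f' x \<bullet> a) \<in> borel_measurable borel"
    by (intro simple_limit_measurable simple_limit_inner f' simple_limit_const)
  have "strong_integral (lebesgue_on S) f \<bullet> a = (LINT t|lebesgue_on S. f' t \<bullet> a)"
  proof (rule strong_integral_inner_AE)
    show "simple_limit (lebesgue_on S) f'"
      by (rule simple_limit_comp[OF f' id])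
    have "AE x in lborel. (if x \<in> S then norm (f' x) else 0) = norm (f' x)"
      using ae by eventually_elim (auto split: if_splits)
    from integrable_lebesgue_on_lborel[OF S norm_meas this] int
    show "integrable (lebesgue_on S) (\<lambda>x. norm (f' x))" by simp
    have "AE x in lborel. x \<in> S \<longrightarrow> f x = f' x"
      using ae by eventually_elim auto
    then show "AE x in lebesgue_on S. f x = f' x"
      unfolding AE_restrict_space_iff[OF S'] by (rule AE_completion)
  qed
  moreover have "AE x in lborel. (if x \<in> S then f' x \<bullet> a else 0) = f' x \<bullet> a"
    using ae by eventually_elim (auto split: if_splits)
  ultimately show ?thesis
    using integral_lebesgue_on_lborel[OF S inner_meas] by simp
qed

text \<open>Each Lebesgue simple function agrees with a Borel one off a null set. The countably many
  exceptional sets and the points of non-convergence lie in one Borel null set \<open>N\<close>;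
  setting \<open>f'\<close> to 0 there turns convergence almost everywhere into convergence
  everywhere.\<close>

lemma strongly_measurable_borel_representative:
  fixes f :: "real \<Rightarrow> 'b::real_normed_vector"
  assumes f: "strongly_measurable (lebesgue_on S) f" and S[measurable]: "S \<in> sets borel"
  obtains f' where "simple_limit borel f'" "AE x in lborel. (if x \<in> S then f x else 0) = f' x"
    "\<And>x. x \<notin> S \<Longrightarrow> f' x = 0"
proof -
  have S': "S \<inter> space lebesgue \<in> sets lebesgue" using S by simp
  obtain s where s: "\<And>i. simple_function (lebesgue_on S) (s i)" "AE x in lebesgue_on S. (\<lambda>i. s i x) \<longlonglongrightarrow> f x"
    using f unfolding strongly_measurable_def by blast
  have "simple_function lebesgue (\<lambda>x. indicator S x *\<^sub>R s i x)" for i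
    using s(1) simple_function_restrict_space[OF S'] by blast
  from completion_ex_simple_function[OF this]
  have "\<forall>i. \<exists>s'. simple_function lborel s' \<and> (AE x in lborel. indicator S x *\<^sub>R s i x = s' x)" by blast
  then obtain s' where s': "\<And>i. simple_function lborel (s' i)" "\<And>i. AE x in lborel. indicator S x *\<^sub>R s i x = s' i x"
    by metis
  have "AE x in lborel. \<forall>i. indicator S x *\<^sub>R s i x = s' i x"
    using s'(2) by (simp add: AE_all_countable)
  moreover have "AE x in lborel. x \<in> S \<longrightarrow> (\<lambda>i. s i x) \<longlonglongrightarrow> f x"
    using s(2) unfolding AE_restrict_space_iff[OF S'] AE_completion_iff .
  ultimately have "AE x in lborel. x \<in> S \<longrightarrow> (\<lambda>i. s' i x) \<longlonglongrightarrow> f x"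
  proof eventually_elim
    case (elim x)
    have "s i x = s' i x" if "x \<in> S" for i using elim(1) that by (metis indicator_simps(1) scaleR_one)
    then show ?case using elim(2) by simp
  qed
  then obtain N where N: "N \<in> null_sets lborel" "\<And>x. x \<notin> N \<Longrightarrow> x \<in> S \<Longrightarrow> (\<lambda>i. s' i x) \<longlonglongrightarrow> f x"
    by (auto simp: eventually_ae_filter)
  have [measurable]: "N \<in> sets borel" using N(1) by auto
  define f' where "f' x = (if x \<in> S - N then f x else 0)" for x
  show ?thesis
  proof
    show "simple_limit borel f'"
      unfolding simple_limit_def
    proof (intro exI[of _ "\<lambda>i x. if x \<in> S - N then s' i x else 0"] conjI allI ballI)
      show "simple_function borel (\<lambda>x. if x \<in> S - N then s' i x else 0)" for i
      proof (rule simple_function_If_set)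
        show "simple_function borel (s' i)"
          using s'(1)[of i] by (simp add: simple_function_def)
      qed auto
      show "(\<lambda>i. if x \<in> S - N then s' i x else 0) \<longlonglongrightarrow> f' x" for x
      proof (cases "x \<in> S - N")
        case True
        then show ?thesis using N(2)[of x] by (simp add: f'_def)
      next
        case False
        then show ?thesis by (simp only: f'_def if_False tendsto_const)
      qed
    qed
    show "AE x in lborel. (if x \<in> S then f x else 0) = f' x"
      using AE_not_in[OF N(1)] by eventually_elim (auto simp: f'_def)
    show "f' x = 0" if "x \<notin> S" for x using that by (simp add: f'_def)
  qed
qed

lemma L2_on_borel_representative:
  fixes f :: "real \<Rightarrow> 'b::real_normed_vector"
  assumes f: "L2_on T f"
  obtains f' where "simple_limit borel f'" "AE t in lborel. 0 < t \<and> t < T \<longrightarrow> f t = f' t"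
    "\<And>t. t \<notin> {0<..<T} \<Longrightarrow> f' t = 0"
    "integrable lborel (\<lambda>t. (norm (f' t))\<^sup>2)" "integrable lborel (\<lambda>t. norm (f' t))"
proof -
  have sm: "strongly_measurable (lebesgue_on {0<..<T}) f" using f by (simp add: L2_on_def)
  obtain f' where f': "simple_limit borel f'" and ae: "AE t in lborel. (if t \<in> {0<..<T} then f t else 0) = f' t"
    and f'0: "\<And>t. t \<notin> {0<..<T} \<Longrightarrow> f' t = 0"
    by (rule strongly_measurable_borel_representative[OF sm], simp, rule that)
  have [measurable]: "(\<lambda>t. norm (f' t)) \<in> borel_measurable borel"
    by (rule simple_limit_measurable[OF simple_limit_norm[OF f']])
  have "AE t in lborel. (if t \<in> {0<..<T} then (norm (f t))\<^sup>2 else 0) = (norm (f' t))\<^sup>2"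
    using ae by eventually_elim (auto split: if_splits)
  then have sq: "integrable lborel (\<lambda>t. (norm (f' t))\<^sup>2)"
    using f integrable_lebesgue_on_lborel[of "{0<..<T}" "\<lambda>t. (norm (f' t))\<^sup>2" "\<lambda>t. (norm (f t))\<^sup>2"]
    by (simp add: L2_on_def)
  show ?thesis
  proof
    show "AE t in lborel. 0 < t \<and> t < T \<longrightarrow> f t = f' t"
      using ae by eventually_elim auto
    show "integrable lborel (\<lambda>t. norm (f' t))"
    proof (rule Bochner_Integration.integrable_bound)
      show "integrable lborel (\<lambda>t. indicator {0<..<T} t + (norm (f' t))\<^sup>2)"
      proof (intro Bochner_Integration.integrable_add integrable_real_indicator sq)
        have "bounded {0<..<T}"
          by (rule bounded_subset[of "cball 0 \<bar>T\<bar>"]) auto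
        then show "emeasure lborel {0<..<T} < \<infinity>" by (rule emeasure_bounded_finite)
      qed simp
      show "AE t in lborel. norm (norm (f' t)) \<le> norm (indicator {0<..<T} t + (norm (f' t))\<^sup>2)"
      proof (rule AE_I2)
        fix t
        \<comment> \<open>Square integrability yields integrability because the interval is bounded
          and a \<le> 1 + a^2.\<close>
        have "2 * norm (f' t) \<le> (norm (f' t))\<^sup>2 + 1"
          using zero_le_power2[of "norm (f' t) - 1"] by (simp add: power2_diff)
        then have "norm (f' t) \<le> 1 + (norm (f' t))\<^sup>2"
          using norm_ge_zero[of "f' t"] by linarith
        then show "norm (norm (f' t)) \<le> norm (indicator {0<..<T} t + (norm (f' t))\<^sup>2)"
          using f'0[of t] by (cases "t \<in> {0<..<T}") auto
      qed
    qed measurable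
  qed (fact f' f'0 sq)+
qed

text \<open>The exceptional set does not depend on \<open>a\<close>: it is decided by the
  integrability of the kernel against \<open>norm (v' s)\<close> alone.\<close>

lemma vconv_inner:
  fixes v v' :: "real \<Rightarrow> 'h::{real_inner, complete_space}"
  assumes k: "monotone_kernel k" and v': "simple_limit borel v'" "integrable lborel (\<lambda>t. norm (v' t))"
    and v'0: "\<And>t. t \<le> 0 \<Longrightarrow> v' t = 0" and ae: "AE t in lborel. 0 < t \<and> t < T \<longrightarrow> v t = v' t"
  shows "AE t in lborel. 0 < t \<and> t < T \<longrightarrow>
    (\<forall>a. vconv k v t \<bullet> a = line_conv (cutoff T k) (\<lambda>s. v' s \<bullet> a) t)"
proof -
  note [measurable] = borel_measurable_kernel[OF k]
  have "AE t in lborel. integrable lborel (\<lambda>s. cutoff T k (t - s) * norm (v' s))"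
    by (rule AE_integrable_conv[OF integrable_kernel[OF k] v'(2)])
  then show ?thesis
  proof eventually_elim
    case (elim t)
    show ?case
    proof (intro impI allI)
      fix a assume t: "0 < t \<and> t < T"
      have "vconv k v t \<bullet> a = (LINT s|lborel. (cutoff T k (t - s) *\<^sub>R v' s) \<bullet> a)"
        unfolding vconv_def
      proof (rule strong_integral_inner)
        show "simple_limit borel (\<lambda>s. cutoff T k (t - s) *\<^sub>R v' s)"
          by (rule simple_limit_scaleR[OF measurable_simple_limit v'(1)]) measurable
        show "integrable lborel (\<lambda>s. norm (cutoff T k (t - s) *\<^sub>R v' s))"
          using elim cutoff_kernel_nonneg[OF k] by (simp add: abs_of_nonneg)
        show "AE s in lborel. (if s \<in> {0..t} then k (t - s) *\<^sub>R v s else 0) = cutoff T k (t - s) *\<^sub>R v' s"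
          using ae AE_lborel_neq[of 0] AE_lborel_neq[of t]
          by eventually_elim (use t v'0 in \<open>auto simp: cutoff_def\<close>)
      qed simp
      then show "vconv k v t \<bullet> a = line_conv (cutoff T k) (\<lambda>s. v' s \<bullet> a) t"
        by (simp add: line_conv_def)
    qed
  qed
qed

text \<open>A test function and its derivative are bounded on [0, T], so both strong integrals exist
  and the vector identity can be paired with \<open>a\<close>.\<close>

lemma weak_derivative_inner:
  fixes w d w' d' :: "real \<Rightarrow> 'h::{real_inner, complete_space}"
  assumes weak: "is_weak_derivative T w d" and \<psi>: "test_function T \<psi>"
    and w': "simple_limit borel w'" "integrable lborel (\<lambda>t. norm (w' t))" "\<And>t. t \<notin> {0<..<T} \<Longrightarrow> w' t = 0"
      "AE t in lborel. 0 < t \<and> t < T \<longrightarrow> w t = w' t"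
    and d': "simple_limit borel d'" "integrable lborel (\<lambda>t. norm (d' t))" "\<And>t. t \<notin> {0<..<T} \<Longrightarrow> d' t = 0"
      "AE t in lborel. 0 < t \<and> t < T \<longrightarrow> d t = d' t"
  shows "(LINT t|lborel. deriv \<psi> t * (w' t \<bullet> a)) = - (LINT t|lborel. \<psi> t * (d' t \<bullet> a))"
proof -
  have main: "strong_integral (lebesgue_on {0<..<T}) (\<lambda>t. h t *\<^sub>R f t) \<bullet> a = (LINT t|lborel. h t * (f' t \<bullet> a))"
    if h: "continuous_on UNIV h" and f': "simple_limit borel f'" "integrable lborel (\<lambda>t. norm (f' t))"
      "\<And>t. t \<notin> {0<..<T} \<Longrightarrow> f' t = 0" "AE t in lborel. 0 < t \<and> t < T \<longrightarrow> f t = f' t"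
    for h :: "real \<Rightarrow> real" and f f' :: "real \<Rightarrow> 'h"
  proof -
    have hm: "h \<in> borel_measurable borel" using h by (rule borel_measurable_continuous_onI)
    have "bounded (h ` {0..T})"
      by (intro compact_imp_bounded compact_continuous_image continuous_on_subset[OF h]) auto
    then obtain B where B: "\<And>t. t \<in> {0..T} \<Longrightarrow> \<bar>h t\<bar> \<le> B"
      by (metis (no_types, lifting) bounded_real imageI)
    have sl: "simple_limit borel (\<lambda>t. h t *\<^sub>R f' t)"
      by (rule simple_limit_scaleR[OF measurable_simple_limit[OF hm] f'(1)])
    have "strong_integral (lebesgue_on {0<..<T}) (\<lambda>t. h t *\<^sub>R f t) \<bullet> a = (LINT t|lborel. (h t *\<^sub>R f' t) \<bullet> a)"
    proof (rule strong_integral_inner[OF _ sl])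
      show "integrable lborel (\<lambda>t. norm (h t *\<^sub>R f' t))"
      proof (rule integrable_norm_bound[of _ "\<lambda>t. B * norm (f' t)"])
        show "norm (h t *\<^sub>R f' t) \<le> B * norm (f' t)" for t
          using B[of t] f'(3)[of t] by (cases "t \<in> {0<..<T}") (auto intro: mult_right_mono)
      qed (use f'(2) sl in \<open>auto simp: simple_limit_lborel\<close>)
      show "AE t in lborel. (if t \<in> {0<..<T} then h t *\<^sub>R f t else 0) = h t *\<^sub>R f' t"
        using f'(4) by eventually_elim (use f'(3) in auto)
    qed simp
    then show ?thesis by simp
  qed
  have diff: "(deriv ^^ n) \<psi> field_differentiable at x" for n x
    using \<psi> by (simp add: test_function_def)
  have "continuous_on UNIV \<psi>"
    using diff[of 0] by (auto intro!: continuous_at_imp_continuous_on field_differentiable_imp_continuous_at)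
  moreover have "continuous_on UNIV (deriv \<psi>)"
    using diff[of 1] by (auto intro!: continuous_at_imp_continuous_on field_differentiable_imp_continuous_at)
  ultimately have "strong_integral (lebesgue_on {0<..<T}) (\<lambda>t. deriv \<psi> t *\<^sub>R w t) \<bullet> a = (LINT t|lborel. deriv \<psi> t * (w' t \<bullet> a))"
    "strong_integral (lebesgue_on {0<..<T}) (\<lambda>t. \<psi> t *\<^sub>R d t) \<bullet> a = (LINT t|lborel. \<psi> t * (d' t \<bullet> a))"
    using main[OF _ w'] main[OF _ d'] by blast+
  moreover have "strong_integral (lebesgue_on {0<..<T}) (\<lambda>t. deriv \<psi> t *\<^sub>R w t)
      = - strong_integral (lebesgue_on {0<..<T}) (\<lambda>t. \<psi> t *\<^sub>R d t)"
    using weak \<psi> by (simp add: is_weak_derivative_def)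
  ultimately show ?thesis by simp
qed

section \<open>The convolution inequality\<close>

text \<open>The windows have length 1/(n + 1). The lower bound for the mass, 1 minus
  \<open>l t\<close> times the integral of \<open>k\<close> over the window, tends to 1 by dominated
  convergence.\<close>

lemma regularised_kernels:
  assumes k: "monotone_kernel k" and l: "conjugate_kernel k l" and T: "0 < T"
  obtains c p \<rho> where
    "\<And>n::nat. integrable lborel (p n)" "\<And>n. integrable lborel (\<rho> n)" "\<And>n. 0 \<le> (c n :: real)"
    "\<And>n s. 0 \<le> p n s" "\<And>n s. s \<le> 0 \<Longrightarrow> p n s = 0"
    "\<And>n s. 0 \<le> \<rho> n s" "\<And>n s. s \<le> 0 \<or> T < s \<Longrightarrow> \<rho> n s = 0"
    "\<And>n t. 0 < t \<Longrightarrow> t \<le> T \<Longrightarrow> \<rho> n t = c n * l t - line_conv (p n) (cutoff T l) t"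
    "\<And>n t. 0 < t \<Longrightarrow> t \<le> T \<Longrightarrow> (LINT s|lborel. cutoff t (p n) s) \<le> c n"
    "\<And>n. (LINT s|lborel. cutoff T (\<rho> n) s) \<le> 1"
    "\<And>t. 0 < t \<Longrightarrow> t \<le> T \<Longrightarrow> (\<lambda>n. LINT s|lborel. cutoff t (\<rho> n) s) \<longlonglongrightarrow> 1"
proof -
  define K where "K n = (LINT s|lborel. cutoff (1 / real (Suc n)) k s)" for n
  \<comment> \<open>All properties are bundled into one relation, so that constant, density and
    kernel can be chosen simultaneously for every \<open>n\<close>.\<close>
  define R where "R n c p \<rho> \<longleftrightarrow> integrable lborel p \<and> integrable lborel \<rho> \<and> 0 \<le> c \<and>
    (\<forall>s. 0 \<le> p s) \<and> (\<forall>s. s \<le> 0 \<longrightarrow> p s = 0) \<and> (\<forall>s. 0 \<le> \<rho> s) \<and> (\<forall>s. s \<le> 0 \<or> T < s \<longrightarrow> \<rho> s = 0) \<and>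
    (\<forall>t. 0 < t \<longrightarrow> t \<le> T \<longrightarrow> \<rho> t = c * l t - line_conv p (cutoff T l) t) \<and>
    (\<forall>t. 0 < t \<longrightarrow> t \<le> T \<longrightarrow> (LINT s|lborel. cutoff t p s) \<le> c) \<and>
    (\<forall>t. 0 < t \<longrightarrow> t \<le> T \<longrightarrow> (LINT s|lborel. cutoff t \<rho> s) \<le> 1) \<and>
    (\<forall>t. 0 < t \<longrightarrow> t \<le> T \<longrightarrow> 1 - l t * K n \<le> (LINT s|lborel. cutoff t \<rho> s))" for n c p \<rho>
  have "\<exists>c p \<rho>. R n c p \<rho>" for n
    by (rule regularised_kernel[OF k l _ T, of "1 / real (Suc n)"], simp)
      (unfold R_def K_def, blast)
  then obtain c p \<rho> where R: "\<And>n. R n (c n) (p n) (\<rho> n)"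
    by metis
  have k_int: "integrable lborel (cutoff S k)" for S by (rule integrable_kernel[OF k])
  have "(\<lambda>n. LINT s|lborel. cutoff (1 / real (Suc n)) k s) \<longlonglongrightarrow> (LINT s|(lborel :: real measure). 0)"
  proof (rule integral_dominated_convergence[where w="cutoff 1 k"])
    show "AE s in lborel. (\<lambda>n. cutoff (1 / real (Suc n)) k s) \<longlonglongrightarrow> 0"
    proof (rule AE_I2)
      fix s
      show "(\<lambda>n. cutoff (1 / real (Suc n)) k s) \<longlonglongrightarrow> 0"
      proof (cases "0 < s")
        case True
        have "eventually (\<lambda>n. inverse (real (Suc n)) < s) sequentially"
          using LIMSEQ_inverse_real_of_nat True by (rule order_tendstoD(2))
        then have "eventually (\<lambda>n. cutoff (1 / real (Suc n)) k s = 0) sequentially"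
          by eventually_elim (simp add: inverse_eq_divide)
        then show ?thesis by (rule tendsto_eventually)
      qed simp
    qed
    show "AE s in lborel. norm (cutoff (1 / real (Suc n)) k s) \<le> cutoff 1 k s" for n
    proof (rule AE_I2)
      have "1 / real (Suc n) \<le> 1" by simp
      then have "s \<le> 1" if "s \<le> 1 / real (Suc n)" for s using that by (rule order_trans[rotated])
      then show "norm (cutoff (1 / real (Suc n)) k s) \<le> cutoff 1 k s" for s
        using kernel_nonneg[OF k, of s] by (auto simp: cutoff_def simp del: of_nat_Suc)
    qed
  qed (use k_int in auto)
  then have K0: "K \<longlonglongrightarrow> 0" by (simp add: K_def[abs_def])
  show ?thesis
  proof (rule that[of p \<rho> c])
    show "(\<lambda>n. LINT s|lborel. cutoff t (\<rho> n) s) \<longlonglongrightarrow> 1" if t: "0 < t" "t \<le> T" for t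
    proof (rule tendsto_sandwich)
      show "\<forall>\<^sub>F n in sequentially. 1 - l t * K n \<le> (LINT s|lborel. cutoff t (\<rho> n) s)"
        using R t by (simp add: R_def)
      show "\<forall>\<^sub>F n in sequentially. (LINT s|lborel. cutoff t (\<rho> n) s) \<le> 1"
        using R t by (simp add: R_def)
      show "(\<lambda>n. 1 - l t * K n) \<longlonglongrightarrow> 1"
        using tendsto_diff[OF tendsto_const[of 1] tendsto_mult_left[OF K0, of "l t"]] by simp
    qed simp
  qed (use R T in \<open>auto simp: R_def\<close>)
qed

lemma line_conv_mono_causal:
  fixes f g h :: "real \<Rightarrow> real"
  assumes "\<And>s. 0 \<le> f s" "\<And>s. s \<le> 0 \<Longrightarrow> f s = 0" "AE s in lborel. 0 < s \<and> s < T \<longrightarrow> g s \<le> h s" "t \<le> T"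
    and "\<And>s. s \<le> 0 \<Longrightarrow> g s = 0" "\<And>s. s \<le> 0 \<Longrightarrow> h s = 0"
    and "integrable lborel (\<lambda>s. f (t - s) * g s)" "integrable lborel (\<lambda>s. f (t - s) * h s)"
  shows "line_conv f g t \<le> line_conv f h t"
  unfolding line_conv_def
proof (rule integral_mono_AE[OF assms(7,8)])
  show "AE s in lborel. f (t - s) * g s \<le> f (t - s) * h s"
    using assms(3)
  proof eventually_elim
    case (elim s)
    consider "s \<le> 0" | "t \<le> s" | "0 < s" "s < T" using assms(4) by linarith
    then show ?case
      using assms(1)[of "t - s"] assms(2)[of "t - s"] assms(5,6)[of s] elim by cases (auto intro: mult_left_mono)
  qed
qed

section \<open>From fixed to time-dependent test vectors\<close>

lemma integrable_inner_const:
  fixes f :: "real \<Rightarrow> 'h::real_inner"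
  assumes "simple_limit borel f" "integrable lborel (\<lambda>t. norm (f t))"
  shows "integrable lborel (\<lambda>t. f t \<bullet> a)"
proof (rule Bochner_Integration.integrable_bound)
  show "integrable lborel (\<lambda>t. norm (f t) * norm a)" using assms(2) by simp
  show "(\<lambda>t. f t \<bullet> a) \<in> borel_measurable lborel"
    using simple_limit_measurable[OF simple_limit_inner[OF assms(1) simple_limit_const]] by simp
qed (auto intro!: AE_I2 Cauchy_Schwarz_ineq2)

text \<open>Continuity of a convolution in the test vector. A convergent sequence is bounded, which
  gives the dominating function.\<close>

lemma tendsto_weighted_inner:
  fixes f :: "real \<Rightarrow> 'h::real_inner"
  assumes f: "simple_limit borel f" and q: "q \<in> borel_measurable borel"
    and int: "integrable lborel (\<lambda>s. q s * norm (f s))" and X: "X \<longlonglongrightarrow> a"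
  shows "(\<lambda>i. LINT s|lborel. q s * (f s \<bullet> X i)) \<longlonglongrightarrow> (LINT s|lborel. q s * (f s \<bullet> a))"
proof -
  obtain B where B: "\<And>i. norm (X i) \<le> B"
    using convergent_imp_Bseq[OF convergentI[OF X]] by (auto simp: Bseq_def)
  have meas: "(\<lambda>s. q s * (f s \<bullet> b)) \<in> borel_measurable lborel" for b
  proof -
    have [measurable]: "(\<lambda>s. f s \<bullet> b) \<in> borel_measurable borel"
      by (intro simple_limit_measurable simple_limit_inner f simple_limit_const)
    show ?thesis using q by measurable
  qed
  show ?thesis
  proof (rule integral_dominated_convergence[where w="\<lambda>s. \<bar>q s * norm (f s)\<bar> * B"])
    show "AE s in lborel. (\<lambda>i. q s * (f s \<bullet> X i)) \<longlonglongrightarrow> q s * (f s \<bullet> a)"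
      by (intro AE_I2 tendsto_intros X)
    show "AE s in lborel. norm (q s * (f s \<bullet> X i)) \<le> \<bar>q s * norm (f s)\<bar> * B" for i
    proof (rule AE_I2)
      fix s
      have "\<bar>f s \<bullet> X i\<bar> \<le> norm (f s) * B"
        using Cauchy_Schwarz_ineq2[of "f s" "X i"] mult_left_mono[OF B[of i] norm_ge_zero[of "f s"]] by linarith
      from mult_left_mono[OF this, of "\<bar>q s\<bar>"]
      show "norm (q s * (f s \<bullet> X i)) \<le> \<bar>q s * norm (f s)\<bar> * B" by (simp add: abs_mult mult.assoc)
    qed
  qed (use meas int in auto)
qed

text \<open>The values of \<open>g\<close> lie in the closure of a countable set.\<close>

lemma AE_substitute_simple_limit:
  fixes g :: "real \<Rightarrow> 'h::real_normed_vector" and P Q :: "real \<Rightarrow> 'h \<Rightarrow> real"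
  assumes g: "simple_limit borel g" and eq: "\<And>a. AE t in lborel. P t a = Q t a"
    and cont: "AE t in lborel. \<forall>X a. X \<longlonglongrightarrow> a \<longrightarrow> (\<lambda>i::nat. P t (X i)) \<longlonglongrightarrow> P t a \<and> (\<lambda>i. Q t (X i)) \<longlonglongrightarrow> Q t a"
  shows "AE t in lborel. P t (g t) = Q t (g t)"
proof -
  obtain s where s: "\<And>i. simple_function borel (s i)" "\<And>x. x \<in> space borel \<Longrightarrow> (\<lambda>i. s i x) \<longlonglongrightarrow> g x"
    by (rule simple_limitE[OF g], rule that)
  define C where "C = (\<Union>i. range (s i))"
  have "finite (range (s i))" for i using simple_functionD(1)[OF s(1)[of i]] by simp
  then have "countable C" unfolding C_def by (auto intro: countable_finite)
  then have "AE t in lborel. \<forall>a\<in>C. P t a = Q t a"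
    using eq by (simp add: AE_ball_countable)
  with cont show ?thesis
  proof eventually_elim
    case (elim t)
    have "(\<lambda>i. s i t) \<longlonglongrightarrow> g t" using s(2) by simp
    then have "(\<lambda>i. P t (s i t)) \<longlonglongrightarrow> P t (g t)" "(\<lambda>i. Q t (s i t)) \<longlonglongrightarrow> Q t (g t)"
      using elim(1) by auto
    moreover have "P t (s i t) = Q t (s i t)" for i
      using elim(2) by (auto simp: C_def)
    ultimately show ?case by (simp add: LIMSEQ_unique)
  qed
qed

text \<open>Lebesgue differentiation in L^1: convolving \<open>y\<close> with a box kernel gives a
  difference quotient of its primitive, hence zero before \<open>T\<close>, and the boxes form an
  approximate identity.\<close>

lemma AE_zero_of_integrals_zero:
  fixes y :: "real \<Rightarrow> real"
  assumes y: "integrable lborel y" and y0: "\<And>s. s \<le> 0 \<or> T < s \<Longrightarrow> y s = 0"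
    and zero: "AE t in lborel. 0 < t \<and> t < T \<longrightarrow> (LINT s|lborel. cutoff t y s) = 0"
  shows "AE t in lborel. t < T \<longrightarrow> y t = 0"
proof -
  have [measurable]: "y \<in> borel_measurable borel" using y by simp
  define \<rho> where "\<rho> n s = (if 0 < s \<and> s \<le> 1 / real (Suc n) then real (Suc n) else 0)" for n s
  have \<rho>_eq: "\<rho> n = (\<lambda>s. real (Suc n) * indicator {0<..1 / real (Suc n)} s)" for n
    by (auto simp: \<rho>_def indicator_def fun_eq_iff)
  have \<rho>_int: "integrable lborel (\<rho> n)" for n
    unfolding \<rho>_eq by (intro integrable_mult_right integrable_real_indicator) auto
  have \<rho>_one: "(LINT s|lborel. cutoff \<delta> (\<rho> n) s) = 1" if "1 / real (Suc n) \<le> \<delta>" for n \<delta>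
  proof -
    have "cutoff \<delta> (\<rho> n) = \<rho> n" using that by (auto simp: cutoff_def \<rho>_def fun_eq_iff)
    then show ?thesis by (simp add: \<rho>_eq)
  qed
  have lim: "(\<lambda>n. LINT t|lborel. \<bar>(LINT s|lborel. \<rho> n (t - s) * y s) - y t\<bar>) \<longlonglongrightarrow> 0"
  proof (rule approximate_identity_tendsto[where T=1 and F="\<lambda>t s. y s" and W="LINT s|lborel. \<bar>y s\<bar>"])
    show "(LINT r|lborel. cutoff 1 (\<rho> n) r) \<le> 1" for n using \<rho>_one[of n 1] by simp
    show "(\<lambda>n. LINT r|lborel. cutoff \<delta> (\<rho> n) r) \<longlonglongrightarrow> 1" if "0 < \<delta>" "\<delta> \<le> 1" for \<delta>
    proof (rule tendsto_eventually)
      have "eventually (\<lambda>n. inverse (real (Suc n)) < \<delta>) sequentially"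
        using LIMSEQ_inverse_real_of_nat that(1) by (rule order_tendstoD(2))
      then show "eventually (\<lambda>n. (LINT r|lborel. cutoff \<delta> (\<rho> n) r) = 1) sequentially"
        by eventually_elim (intro \<rho>_one, simp add: inverse_eq_divide)
    qed
    show "integrable lborel (\<lambda>t. y (t - r))" for r using y integrable_shift by blast
    show "(LINT t|lborel. \<bar>y (t - r)\<bar>) \<le> (LINT s|lborel. \<bar>y s\<bar>)" for r
      using integral_shift[of "\<lambda>t. \<bar>y t\<bar>" r] by simp
    show "((\<lambda>r. LINT t|lborel. \<bar>y (t - r) - y t\<bar>) \<longlongrightarrow> 0) (at 0)"
      using translate_continuous_integrable[OF measurable_simple_limit, of y] y by simp
    show "\<rho> n r = 0" if "r \<le> 0 \<or> 1 < r" for n r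
    proof -
      have "1 / real (Suc n) \<le> 1" by simp
      then have "\<not> (0 < r \<and> r \<le> 1 / real (Suc n))" using that by linarith
      then show ?thesis by (simp only: \<rho>_def if_False)
    qed
    show "integrable lborel (\<rho> n)" for n by (rule \<rho>_int)
    show "0 \<le> \<rho> n r" for n r by (simp add: \<rho>_def)
  qed simp_all
  \<comment> \<open>Nonpositive times are included because the left end t - h of a difference
    quotient may be negative.\<close>
  have zero': "AE t in lborel. t < T \<longrightarrow> (LINT s|lborel. cutoff t y s) = 0"
    using zero AE_lborel_neq[of 0]
  proof eventually_elim
    case (elim t)
    show ?case
    proof (cases "0 < t")
      case False
      then have "cutoff t y = (\<lambda>_. 0)" by (auto simp: cutoff_def fun_eq_iff)
      then show ?thesis by simp
    qed (use elim in simp)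
  qed
  have \<rho>y: "AE t in lborel. t < T \<longrightarrow> (LINT s|lborel. \<rho> n (t - s) * y s) = 0" for n
  proof -
    define h where "h = 1 / real (Suc n)"
    have h: "0 < h" by (simp add: h_def)
    \<comment> \<open>Two reflections compose to the translation by \<open>h\<close>.\<close>
    have "AE t in lborel. t - h < T \<longrightarrow> (LINT s|lborel. cutoff (t - h) y s) = 0"
      using AE_reflect_shift[OF AE_reflect_shift[OF zero', of "- h"], of 0] by (simp add: add.commute)
    with zero' show ?thesis
    proof eventually_elim
      case (elim t)
      show ?case
      proof
        assume t: "t < T"
        have "(LINT s|lborel. \<rho> n (t - s) * y s) = (LINT s|lborel. real (Suc n) * (cutoff t y s - cutoff (t - h) y s))"
        proof (rule integral_cong_AE)
          show "AE s in lborel. \<rho> n (t - s) * y s = real (Suc n) * (cutoff t y s - cutoff (t - h) y s)"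
            using AE_lborel_neq[of t] AE_lborel_neq[of "t - h"]
          proof eventually_elim
            case (elim s)
            consider "s \<le> 0" | "0 < s" "s < t - h" | "0 < s" "t - h < s" "s < t" | "t < s" using elim by linarith
            then show ?case
              using y0[of s] h by cases (auto simp: \<rho>_def cutoff_def h_def[symmetric] simp del: of_nat_Suc)
          qed
          show "(\<lambda>s. \<rho> n (t - s) * y s) \<in> borel_measurable lborel"
            unfolding \<rho>_eq by measurable
        qed measurable
        also have "\<dots> = real (Suc n) * ((LINT s|lborel. cutoff t y s) - (LINT s|lborel. cutoff (t - h) y s))"
          using integrable_cutoff[OF y] by (simp del: of_nat_Suc)
        also have "\<dots> = 0"
        proof -
          have "t - h < T" using t h by simp
          then show ?thesis using elim t by simp
        qed
        finally show "(LINT s|lborel. \<rho> n (t - s) * y s) = 0" .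
      qed
    qed
  qed
  have [measurable]: "\<rho> n \<in> borel_measurable borel" for n using \<rho>_int[of n] by simp
  have le: "(LINT t|lborel. indicator {..<T} t * \<bar>y t\<bar>) \<le> (LINT t|lborel. \<bar>(LINT s|lborel. \<rho> n (t - s) * y s) - y t\<bar>)" for n
  proof (rule integral_mono_AE)
    have "integrable lborel (line_conv (\<rho> n) y)" by (rule integrable_line_conv[OF \<rho>_int y])
    then show "integrable lborel (\<lambda>t. \<bar>(LINT s|lborel. \<rho> n (t - s) * y s) - y t\<bar>)"
      using y by (simp add: line_conv_def[abs_def])
    show "integrable lborel (\<lambda>t. indicator {..<T} t * \<bar>y t\<bar>)"
      using integrable_mult_indicator[of "{..<T}" lborel "\<lambda>t. \<bar>y t\<bar>"] y by simp
    show "AE t in lborel. indicator {..<T} t * \<bar>y t\<bar> \<le> \<bar>(LINT s|lborel. \<rho> n (t - s) * y s) - y t\<bar>"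
      using \<rho>y[of n] by eventually_elim (auto simp: indicator_def)
  qed
  have "(LINT t|lborel. indicator {..<T} t * \<bar>y t\<bar>) \<le> 0"
    using lim by (rule LIMSEQ_le_const) (use le in auto)
  moreover have "0 \<le> (LINT t|lborel. indicator {..<T} t * \<bar>y t\<bar>)"
    by (rule integral_nonneg_AE) simp
  ultimately have "(LINT t|lborel. indicator {..<T} t * \<bar>y t\<bar>) = 0" by simp
  moreover have "integrable lborel (\<lambda>t. indicator {..<T} t * \<bar>y t\<bar>)"
    using integrable_mult_indicator[of "{..<T}" lborel "\<lambda>t. \<bar>y t\<bar>"] y by simp
  ultimately have "AE t in lborel. indicator {..<T} t * \<bar>y t\<bar> = 0"
    by (subst (asm) integral_nonneg_eq_0_iff_AE) auto
  then show ?thesis by eventually_elim (auto simp: indicator_def split: if_splits)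
qed

section \<open>Volterra inversion and the inequality for the conjugate kernel\<close>

context
  fixes k l :: "real \<Rightarrow> real" and T :: real
  assumes k: "monotone_kernel k" and l: "conjugate_kernel k l" and T: "0 < T"
begin

lemma monotone_conjugate: "monotone_kernel l"
  using l by (simp add: conjugate_kernel_def)

lemmas cutoff_kernels_measurable[measurable] = borel_measurable_kernel[OF k] borel_measurable_kernel[OF monotone_conjugate]
lemmas cutoff_kernels_integrable = integrable_kernel[OF k] integrable_kernel[OF monotone_conjugate]

lemma line_conv_kernels:
  assumes "t \<le> T"
  shows "line_conv (cutoff T k) (cutoff T l) t = (if 0 < t then 1 else 0)"
  using assms line_conv_conjugate[OF k l, of t T T] line_conv_eq_0_of_causal[of "cutoff T k" "cutoff T l" t] by auto

text \<open>Associativity replaces the two kernels by their convolution, which is the Heaviside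
  function up to time \<open>T\<close>.\<close>

lemma line_conv_kernels_left:
  fixes f :: "real \<Rightarrow> real"
  assumes f: "integrable lborel f" "\<And>s. s \<le> 0 \<Longrightarrow> f s = 0"
  shows "AE t in lborel. 0 < t \<and> t < T \<longrightarrow>
    line_conv (cutoff T k) (line_conv (cutoff T l) f) t = (LINT s|lborel. cutoff t f s)"
  using line_conv_assoc_AE[OF cutoff_kernels_integrable(1)[of T] cutoff_kernels_integrable(2)[of T] f(1)]
    AE_integrable_conv[OF integrable_line_conv[OF cutoff_kernels_integrable(1)[of T] cutoff_kernels_integrable(2)[of T]] f(1)]
proof eventually_elim
  case (elim t)
  have [measurable]: "f \<in> borel_measurable borel" using f by simp
  show ?case
  proof
    assume t: "0 < t \<and> t < T"
    have "line_conv (line_conv (cutoff T k) (cutoff T l)) f t = (LINT s|lborel. cutoff t f s)"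
      unfolding line_conv_def[of "line_conv _ _"]
    proof (rule integral_cong_AE)
      show "AE s in lborel. line_conv (cutoff T k) (cutoff T l) (t - s) * f s = cutoff t f s"
        using AE_lborel_neq[of t]
      proof eventually_elim
        case (elim s)
        show ?case
        proof (cases "s \<le> 0")
          case True then show ?thesis using f(2) by simp
        next
          case False
          then have "t - s \<le> T" using t by simp
          then show ?thesis using False elim by (auto simp: line_conv_kernels cutoff_def)
        qed
      qed
    qed measurable
    then show "line_conv (cutoff T k) (line_conv (cutoff T l) f) t = (LINT s|lborel. cutoff t f s)"
      using elim(1) by simp
  qed
qed

text \<open>\<open>f\<close> and the convolution of \<open>l\<close> with \<open>h\<close> have the
  same convolution with \<open>k\<close>. Their difference \<open>x\<close> is thus annihilated by
  \<open>k\<close>, and a further convolution with \<open>l\<close> shows that the primitive of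
  \<open>x\<close> vanishes.\<close>

lemma volterra_inversion:
  fixes f h :: "real \<Rightarrow> real"
  assumes f: "integrable lborel f" "\<And>s. s \<le> 0 \<Longrightarrow> f s = 0" and h: "integrable lborel h" "\<And>s. s \<le> 0 \<Longrightarrow> h s = 0"
    and eq: "AE t in lborel. 0 < t \<and> t < T \<longrightarrow> line_conv (cutoff T k) f t = (LINT s|lborel. cutoff t h s)"
  shows "AE t in lborel. 0 < t \<and> t < T \<longrightarrow> f t = line_conv (cutoff T l) h t"
proof -
  have [measurable]: "f \<in> borel_measurable borel" "h \<in> borel_measurable borel" using f h by auto
  let ?k = "cutoff T k" and ?l = "cutoff T l"
  let ?lh = "line_conv ?l h"
  have lh_int: "integrable lborel ?lh" by (rule integrable_line_conv[OF cutoff_kernels_integrable(2) h(1)])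
  have lh0: "?lh s = 0" if "s \<le> 0" for s
    using that h(2) by (intro line_conv_eq_0_of_causal) auto
  define x where "x s = f s - ?lh s" for s
  have x_int: "integrable lborel x" unfolding x_def using f(1) lh_int by simp
  have x0: "x s = 0" if "s \<le> 0" for s using f(2) lh0 that by (simp add: x_def)
  have [measurable]: "x \<in> borel_measurable borel" using x_int by simp
  have kh: "AE t in lborel. 0 < t \<and> t < T \<longrightarrow> line_conv ?k ?lh t = (LINT s|lborel. cutoff t h s)"
    by (rule line_conv_kernels_left[OF h(1)]) (rule h(2))
  have klx: "AE t in lborel. 0 < t \<and> t < T \<longrightarrow> line_conv ?k (line_conv ?l x) t = (LINT s|lborel. cutoff t x s)"
    by (rule line_conv_kernels_left[OF x_int]) (rule x0)
  have kx: "AE t in lborel. 0 < t \<and> t < T \<longrightarrow> line_conv ?k x t = 0"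
    using kh eq AE_integrable_conv[OF cutoff_kernels_integrable(1)[of T] f(1)]
      AE_integrable_conv[OF cutoff_kernels_integrable(1)[of T] lh_int]
    by eventually_elim (auto simp: x_def[abs_def] line_conv_diff_right)
  have lkx: "line_conv ?l (line_conv ?k x) t = 0" if "t \<le> T" for t
  proof -
    have "line_conv ?l (line_conv ?k x) t = line_conv ?l (\<lambda>_. 0) t"
    proof (rule line_conv_cong_causal[OF _ that])
      show "AE s in lborel. s < T \<longrightarrow> line_conv ?k x s = 0"
        using kx
      proof eventually_elim
        case (elim s)
        then show ?case using line_conv_eq_0_of_causal[of ?k x s] x0 by (cases "0 < s") auto
      qed
    qed auto
    then show ?thesis by (simp add: line_conv_def)
  qed
  have "AE t in lborel. 0 < t \<and> t < T \<longrightarrow> (LINT s|lborel. cutoff t x s) = 0"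
    using klx
      line_conv_assoc_AE[OF cutoff_kernels_integrable(1)[of T] cutoff_kernels_integrable(2)[of T] x_int]
      line_conv_assoc_AE[OF cutoff_kernels_integrable(2)[of T] cutoff_kernels_integrable(1)[of T] x_int]
  proof eventually_elim
    case (elim t)
    have "line_conv ?k ?l = line_conv ?l ?k" by (rule ext) (rule line_conv_commute)
    then show ?case using elim lkx[of t] by auto
  qed
  \<comment> \<open>\<open>AE_zero_of_integrals_zero\<close> asks for a function that vanishes
    beyond \<open>T\<close>; the cutoff leaves the primitive before \<open>T\<close>
    unchanged.\<close>
  moreover have "cutoff t (cutoff T x) = cutoff t x" if "t < T" for t using that by (intro cutoff_cutoff) simp
  ultimately have "AE t in lborel. 0 < t \<and> t < T \<longrightarrow> (LINT s|lborel. cutoff t (cutoff T x) s) = 0"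
    by (auto elim!: eventually_mono)
  then have "AE t in lborel. t < T \<longrightarrow> cutoff T x t = 0"
    by (intro AE_zero_of_integrals_zero integrable_cutoff x_int) auto
  then show ?thesis by eventually_elim (auto simp: x_def)
qed

text \<open>The functional has disappeared: \<open>sub\<close> is the subdifferential inequality
  tested with other values of the solution, \<open>pos\<close> the one tested with the initial
  value. Since \<open>v\<close> and \<Phi> are differences to the initial data, no initial term
  remains.\<close>

lemma convolution_inequality:
  fixes v d g :: "real \<Rightarrow> 'h::real_inner" and \<Phi> :: "real \<Rightarrow> real"
  assumes v: "simple_limit borel v" "integrable lborel (\<lambda>t. norm (v t))" and v0: "\<And>t. t \<le> 0 \<Longrightarrow> v t = 0"
    and d: "simple_limit borel d" "integrable lborel (\<lambda>t. norm (d t))" "integrable lborel (\<lambda>t. (norm (d t))\<^sup>2)"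
    and d0: "\<And>t. t \<le> 0 \<Longrightarrow> d t = 0"
    and g: "simple_limit borel g" "integrable lborel (\<lambda>t. (norm (g t))\<^sup>2)"
    and \<Phi>: "integrable lborel \<Phi>" and \<Phi>0: "\<And>t. t \<le> 0 \<Longrightarrow> \<Phi> t = 0"
    and rel: "\<And>a. AE t in lborel. 0 < t \<and> t < T \<longrightarrow> v t \<bullet> a = line_conv (cutoff T l) (\<lambda>s. d s \<bullet> a) t"
    and pos: "AE t in lborel. 0 < t \<and> t < T \<longrightarrow> \<Phi> t \<le> v t \<bullet> g t"
    and sub: "AE t in lborel. 0 < t \<and> t < T \<longrightarrow>
      (AE s in lborel. 0 < s \<and> s < T \<longrightarrow> v s \<bullet> g t - \<Phi> s \<le> v t \<bullet> g t - \<Phi> t)"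
  shows "AE t in lborel. 0 < t \<and> t < T \<longrightarrow> \<Phi> t \<le> line_conv (cutoff T l) (\<lambda>s. d s \<bullet> g s) t"
proof -
  define L where "L = cutoff T l"
  have L_int: "integrable lborel L" unfolding L_def by (rule cutoff_kernels_integrable)
  have L0: "L s = 0" if "s \<le> 0" for s using that by (simp add: L_def)
  have L_nn: "0 \<le> L s" for s unfolding L_def by (rule cutoff_kernel_nonneg[OF monotone_conjugate])
  obtain c p \<rho> where p_int: "\<And>n::nat. integrable lborel (p n)" and \<rho>_int: "\<And>n. integrable lborel (\<rho> n)"
    and c_nn: "\<And>n. 0 \<le> (c n :: real)"
    and p_nn: "\<And>n s. 0 \<le> p n s" and p0: "\<And>n s. s \<le> 0 \<Longrightarrow> p n s = 0"
    and \<rho>_nn: "\<And>n s. 0 \<le> \<rho> n s" and \<rho>0: "\<And>n s. s \<le> 0 \<or> T < s \<Longrightarrow> \<rho> n s = 0"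
    and \<rho>_eq: "\<And>n t. 0 < t \<Longrightarrow> t \<le> T \<Longrightarrow> \<rho> n t = c n * l t - line_conv (p n) (cutoff T l) t"
    and p_le: "\<And>n t. 0 < t \<Longrightarrow> t \<le> T \<Longrightarrow> (LINT s|lborel. cutoff t (p n) s) \<le> c n"
    and \<rho>_le: "\<And>n. (LINT s|lborel. cutoff T (\<rho> n) s) \<le> 1"
    and \<rho>_lim: "\<And>t. 0 < t \<Longrightarrow> t \<le> T \<Longrightarrow> (\<lambda>n. LINT s|lborel. cutoff t (\<rho> n) s) \<longlonglongrightarrow> 1"
    by (rule regularised_kernels[OF k l T], rule that)
  have [measurable]: "L \<in> borel_measurable borel" "p n \<in> borel_measurable borel" "\<rho> n \<in> borel_measurable borel"
    "\<Phi> \<in> borel_measurable borel" for n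
    using L_int p_int[of n] \<rho>_int[of n] \<Phi> by auto
  have pL_int: "integrable lborel (line_conv (p n) L)" for n by (rule integrable_line_conv[OF p_int L_int])
  \<comment> \<open>The formula \<rho> = c l - p * l holds only up to \<open>T\<close>, so it is
    inserted under a causal convolution before \<open>T\<close>.\<close>
  have \<rho>_conv: "AE t in lborel. t < T \<longrightarrow> line_conv (\<rho> n) f t = c n * line_conv L f t - line_conv (line_conv (p n) L) f t"
    if f: "integrable lborel f" "\<And>s. s \<le> 0 \<Longrightarrow> f s = 0" for f n
    using AE_integrable_conv[OF L_int f(1)] AE_integrable_conv[OF pL_int[of n] f(1)]
  proof eventually_elim
    case (elim t)
    show ?case
    proof
      assume t: "t < T"
      have fm[measurable]: "f \<in> borel_measurable borel" using f(1) by simp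
      have "line_conv f (\<rho> n) t = line_conv f (\<lambda>s. c n * L s - line_conv (p n) L s) t"
      proof (rule line_conv_cong_causal[where T=T])
        show "AE s in lborel. s < T \<longrightarrow> \<rho> n s = c n * L s - line_conv (p n) L s"
        proof (intro AE_I2 impI)
          fix s assume s: "s < T"
          show "\<rho> n s = c n * L s - line_conv (p n) L s"
          proof (cases "0 < s")
            case True then show ?thesis using \<rho>_eq[of s n] s by (simp add: L_def)
          next
            case False
            then have "line_conv (p n) L s = 0" by (intro line_conv_eq_0_of_causal p0 L0) auto
            then show ?thesis using False L0 \<rho>0[of s n] by simp
          qed
        qed
      qed (use t f(2) in auto)
      also have "\<dots> = line_conv f (\<lambda>s. c n * L s) t - line_conv f (line_conv (p n) L) t"
      proof (rule line_conv_diff_right)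
        show "integrable lborel (\<lambda>s. f (t - s) * (c n * L s))"
          using elim(1) integrable_line_conv_commute[of L t f] by (simp add: mult.left_commute)
        show "integrable lborel (\<lambda>s. f (t - s) * line_conv (p n) L s)"
          using elim(2) integrable_line_conv_commute[of "line_conv (p n) L" t f] by simp
      qed
      finally show "line_conv (\<rho> n) f t = c n * line_conv L f t - line_conv (line_conv (p n) L) f t"
        by (simp add: line_conv_cmult_right line_conv_commute[of f])
    qed
  qed

  \<comment> \<open>The chain rule inequality for the regularised kernel\<close>
  have da_int: "integrable lborel (\<lambda>s. d s \<bullet> a)" for a by (rule integrable_inner_const[OF d(1,2)])
  have va_int: "integrable lborel (\<lambda>s. v s \<bullet> a)" for a by (rule integrable_inner_const[OF v])
  \<comment> \<open>The vector \<open>g t\<close> is frozen while the integration runs over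
    \<open>s\<close>, so only scalar integrals occur; this is the two-argument form treated by
    \<open>approximate_identity\<close>.\<close>
  define G where "G n t = (LINT s|lborel. \<rho> n (t - s) * (d s \<bullet> g t))" for n t
  define f where "f t = d t \<bullet> g t" for t

  \<comment> \<open>Substituting v = l * d under the convolution with \<open>p\<close> and
    reassociating collects the kernel c l - p * l. The exceptional null set may depend on
    \<open>a\<close>, so \<open>g t\<close> cannot be inserted directly.\<close>
  have fixed: "AE t in lborel. 0 < t \<and> t < T \<longrightarrow>
      c n * (v t \<bullet> a) - line_conv (p n) (\<lambda>s. v s \<bullet> a) t = line_conv (\<rho> n) (\<lambda>s. d s \<bullet> a) t" for n a
  proof -
    have ae: "AE s in lborel. s < T \<longrightarrow> v s \<bullet> a = line_conv L (\<lambda>s. d s \<bullet> a) s"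
      using rel[of a]
    proof eventually_elim
      case (elim s)
      then show ?case
        using line_conv_eq_0_of_causal[of L "\<lambda>s. d s \<bullet> a" s] L0 d0 v0 by (cases "0 < s") (auto simp: L_def)
    qed
    have dm: "(\<lambda>s. d s \<bullet> a) \<in> borel_measurable borel" using da_int[of a] by simp
    have "line_conv (p n) (\<lambda>s. v s \<bullet> a) t = line_conv (p n) (line_conv L (\<lambda>s. d s \<bullet> a)) t" if "t \<le> T" for t
      by (rule line_conv_cong_causal[OF ae that]) (use p0 va_int[of a] dm in \<open>auto intro!: borel_measurable_line_conv\<close>)
    moreover have "AE t in lborel. t < T \<longrightarrow> line_conv (\<rho> n) (\<lambda>s. d s \<bullet> a) t
        = c n * line_conv L (\<lambda>s. d s \<bullet> a) t - line_conv (line_conv (p n) L) (\<lambda>s. d s \<bullet> a) t"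
      by (rule \<rho>_conv[OF da_int]) (simp add: d0)
    ultimately show ?thesis
      using ae line_conv_assoc_AE[OF p_int[of n] L_int da_int[of a]]
      by (auto elim!: eventually_elim2)
  qed
  have varying: "AE t in lborel. 0 < t \<and> t < T \<longrightarrow>
      c n * (v t \<bullet> g t) - line_conv (p n) (\<lambda>s. v s \<bullet> g t) t = G n t" for n
  proof -
    \<comment> \<open>Both are set to 0 outside (0, T), so that they agree almost everywhere on the
      whole line.\<close>
    define P Q where "P t a = (if 0 < t \<and> t < T then c n * (v t \<bullet> a) - line_conv (p n) (\<lambda>s. v s \<bullet> a) t else 0)"
      and "Q t a = (if 0 < t \<and> t < T then line_conv (\<rho> n) (\<lambda>s. d s \<bullet> a) t else 0)" for t a
    have "AE t in lborel. P t (g t) = Q t (g t)"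
    proof (rule AE_substitute_simple_limit[OF g(1)])
      show "AE t in lborel. P t a = Q t a" for a
        using fixed[of n a] by eventually_elim (simp add: P_def Q_def)
      show "AE t in lborel. \<forall>X a. X \<longlonglongrightarrow> a \<longrightarrow> (\<lambda>i::nat. P t (X i)) \<longlonglongrightarrow> P t a \<and> (\<lambda>i. Q t (X i)) \<longlonglongrightarrow> Q t a"
        using AE_integrable_conv[OF p_int[of n] v(2)] AE_integrable_conv[OF \<rho>_int[of n] d(2)]
      proof eventually_elim
        case (elim t)
        show ?case
        proof (intro allI impI)
          fix X :: "nat \<Rightarrow> 'h" and a assume X: "X \<longlonglongrightarrow> a"
          have "(\<lambda>i. LINT s|lborel. p n (t - s) * (v s \<bullet> X i)) \<longlonglongrightarrow> (LINT s|lborel. p n (t - s) * (v s \<bullet> a))"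
            by (rule tendsto_weighted_inner[OF v(1) _ elim(1) X]) measurable
          moreover have "(\<lambda>i. LINT s|lborel. \<rho> n (t - s) * (d s \<bullet> X i)) \<longlonglongrightarrow> (LINT s|lborel. \<rho> n (t - s) * (d s \<bullet> a))"
            by (rule tendsto_weighted_inner[OF d(1) _ elim(2) X]) measurable
          ultimately show "(\<lambda>i. P t (X i)) \<longlonglongrightarrow> P t a \<and> (\<lambda>i. Q t (X i)) \<longlonglongrightarrow> Q t a"
            using X by (auto simp: P_def Q_def line_conv_def intro!: tendsto_intros)
        qed
      qed
    qed
    then show ?thesis
      by eventually_elim (auto simp: P_def Q_def G_def line_conv_def[of "\<rho> n"])
  qed
  have pointwise: "AE t in lborel. 0 < t \<and> t < T \<longrightarrow> c n * \<Phi> t - line_conv (p n) \<Phi> t \<le> G n t" for n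
    using varying[of n] pos sub AE_integrable_conv[OF p_int[of n] v(2)] AE_integrable_conv[OF p_int[of n] \<Phi>]
  proof eventually_elim
    case (elim t)
    show ?case
    proof
      assume t: "0 < t \<and> t < T"
      \<comment> \<open>By \<open>sub\<close> the function integrated against \<open>p\<close> is at
        most \<open>q\<close>, and the mass of \<open>p\<close> on (0, t] is at most
        \<open>c n\<close>. Since \<open>pos\<close> makes \<open>q\<close> nonnegative, the mass of
        \<open>p\<close> can be replaced by \<open>c n\<close>.\<close>
      define q where "q = v t \<bullet> g t - \<Phi> t"
      have q: "0 \<le> q" using elim(2) t by (simp add: q_def)
      have vg_int: "integrable lborel (\<lambda>s. p n (t - s) * (v s \<bullet> g t))"
      proof (rule Bochner_Integration.integrable_bound)
        show "integrable lborel (\<lambda>s. p n (t - s) * norm (v s) * norm (g t))" using elim(4) by simp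
        show "(\<lambda>s. p n (t - s) * (v s \<bullet> g t)) \<in> borel_measurable lborel"
          using va_int[of "g t"] by measurable
        show "AE s in lborel. norm (p n (t - s) * (v s \<bullet> g t)) \<le> norm (p n (t - s) * norm (v s) * norm (g t))"
        proof (rule AE_I2)
          show "norm (p n (t - s) * (v s \<bullet> g t)) \<le> norm (p n (t - s) * norm (v s) * norm (g t))" for s
            using mult_left_mono[OF Cauchy_Schwarz_ineq2[of "v s" "g t"] p_nn[of n "t - s"]] p_nn[of n "t - s"]
            by (simp add: abs_mult mult.assoc)
        qed
      qed
      have "line_conv (p n) (\<lambda>s. v s \<bullet> g t) t - line_conv (p n) \<Phi> t = line_conv (p n) (\<lambda>s. v s \<bullet> g t - \<Phi> s) t"
        by (rule line_conv_diff_right[symmetric, OF vg_int elim(5)])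
      also have "\<dots> \<le> (LINT s|lborel. cutoff t (p n) (t - s) * q)"
        unfolding line_conv_def
      proof (rule integral_mono_AE)
        show "integrable lborel (\<lambda>s. p n (t - s) * (v s \<bullet> g t - \<Phi> s))"
          using vg_int elim(5) by (simp add: right_diff_distrib)
        show "integrable lborel (\<lambda>s. cutoff t (p n) (t - s) * q)"
          using integrable_cutoff[OF p_int] integrable_reflect_shift by simp
        have "AE s in lborel. 0 < s \<and> s < T \<longrightarrow> v s \<bullet> g t - \<Phi> s \<le> q"
          using elim(3) t by (simp add: q_def)
        then show "AE s in lborel. p n (t - s) * (v s \<bullet> g t - \<Phi> s) \<le> cutoff t (p n) (t - s) * q"
        proof eventually_elim
          case (elim s)
          consider "s \<le> 0" | "0 < s" "s < t" | "t \<le> s" by linarith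
          then show ?case
          proof cases
            case 1
            have "0 \<le> cutoff t (p n) (t - s) * q" using p_nn q by (simp add: cutoff_def)
            then show ?thesis using 1 v0 \<Phi>0 by simp
          next
            case 2
            then have "v s \<bullet> g t - \<Phi> s \<le> q" using elim t by simp
            then show ?thesis using 2 p_nn by (simp add: mult_left_mono)
          next
            case 3
            then show ?thesis using p0[of "t - s" n] by simp
          qed
        qed
      qed
      also have "\<dots> = (LINT s|lborel. cutoff t (p n) s) * q"
        using integral_reflect_shift[of "cutoff t (p n)" t] by simp
      also have "\<dots> \<le> c n * q"
        using p_le[of t n] t q by (intro mult_right_mono) auto
      finally show "c n * \<Phi> t - line_conv (p n) \<Phi> t \<le> G n t"
        using elim(1) t by (simp add: q_def right_diff_distrib)
    qed
  qed

  \<comment> \<open>Passage to the limit\<close>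
  have f_int: "integrable lborel f"
    using integrable_inner_shift[OF d(1,3) g, of 0] by (simp add: f_def[abs_def])
  have F_meas: "(\<lambda>(t, s). d s \<bullet> g t) \<in> borel_measurable (lborel \<Otimes>\<^sub>M lborel)"
    by (rule borel_measurable_inner_pair[OF d(1,3) g])
  have G_int: "integrable lborel (G n)" for n
    unfolding G_def[abs_def]
    by (rule approximate_identity_integrable[OF T \<rho>_int \<rho>_nn \<rho>0 \<rho>_le \<rho>_lim F_meas
        integrable_inner_shift[OF d(1,3) g] integral_inner_shift_le[OF d(1,3) g] inner_translate_tendsto[OF d(1,3) g d(2)]])
  have G_lim: "(\<lambda>n. LINT t|lborel. \<bar>G n t - f t\<bar>) \<longlonglongrightarrow> 0"
    unfolding G_def f_def
    by (rule approximate_identity_tendsto[OF T \<rho>_int \<rho>_nn \<rho>0 \<rho>_le \<rho>_lim F_meas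
        integrable_inner_shift[OF d(1,3) g] integral_inner_shift_le[OF d(1,3) g] inner_translate_tendsto[OF d(1,3) g d(2)]])
  \<comment> \<open>The same approximate identity, now with an integrand independent of the outer
    time.\<close>
  have \<Phi>_lim: "(\<lambda>n. LINT t|lborel. \<bar>line_conv (\<rho> n) \<Phi> t - \<Phi> t\<bar>) \<longlonglongrightarrow> 0"
    unfolding line_conv_def
  proof (rule approximate_identity_tendsto[OF T \<rho>_int \<rho>_nn \<rho>0 \<rho>_le \<rho>_lim, where F="\<lambda>t s. \<Phi> s" and W="LINT s|lborel. \<bar>\<Phi> s\<bar>"])
    show "integrable lborel (\<lambda>t. \<Phi> (t - r))" for r using \<Phi> integrable_shift by blast
    show "(LINT t|lborel. \<bar>\<Phi> (t - r)\<bar>) \<le> (LINT s|lborel. \<bar>\<Phi> s\<bar>)" for r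
      using integral_shift[of "\<lambda>t. \<bar>\<Phi> t\<bar>" r] by simp
    show "((\<lambda>r. LINT t|lborel. \<bar>\<Phi> (t - r) - \<Phi> t\<bar>) \<longlongrightarrow> 0) (at 0)"
      using translate_continuous_integrable[OF measurable_simple_limit, of \<Phi>] \<Phi> by simp
  qed auto
  have G0: "G n t = 0" if "t \<le> 0" for n t
  proof -
    have "\<rho> n (t - s) * (d s \<bullet> g t) = 0" for s
      using that d0[of s] \<rho>0[of "t - s" n] by (cases "s \<le> 0") auto
    then show ?thesis unfolding G_def by (intro integral_eq_zero_AE AE_I2)
  qed
  \<comment> \<open>Commutativity and associativity regroup the convolution of \<open>L\<close> with
    c \<Phi> - p * \<Phi> into that of \<rho> with \<Phi>; the sign of \<open>L\<close> preserves
    the inequality.\<close>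
  have convolved: "AE t in lborel. 0 < t \<and> t < T \<longrightarrow> line_conv (\<rho> n) \<Phi> t \<le> line_conv L (G n) t" for n
  proof -
    define h where "h s = c n * \<Phi> s - line_conv (p n) \<Phi> s" for s
    have p\<Phi>_int: "integrable lborel (line_conv (p n) \<Phi>)" by (rule integrable_line_conv[OF p_int \<Phi>])
    have h_int: "integrable lborel h" unfolding h_def[abs_def] using \<Phi> p\<Phi>_int by simp
    have h0: "h s = 0" if "s \<le> 0" for s
      using that \<Phi>0 line_conv_eq_0_of_causal[of "p n" \<Phi> s] p0 by (simp add: h_def)
    have comm: "line_conv (p n) L = line_conv L (p n)" by (rule ext) (rule line_conv_commute)
    have \<rho>\<Phi>: "AE t in lborel. t < T \<longrightarrow> line_conv (\<rho> n) \<Phi> t = c n * line_conv L \<Phi> t - line_conv (line_conv (p n) L) \<Phi> t"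
      by (rule \<rho>_conv[OF \<Phi>]) (rule \<Phi>0)
    show ?thesis
      using \<rho>\<Phi> AE_integrable_conv[OF L_int \<Phi>] AE_integrable_conv[OF L_int p\<Phi>_int]
        AE_integrable_conv[OF L_int h_int] AE_integrable_conv[OF L_int G_int[of n]]
        line_conv_assoc_AE[OF L_int p_int[of n] \<Phi>]
    proof eventually_elim
      case (elim t)
      show ?case
      proof
        assume t: "0 < t \<and> t < T"
        have "line_conv (\<rho> n) \<Phi> t = c n * line_conv L \<Phi> t - line_conv L (line_conv (p n) \<Phi>) t"
          using elim(1,6) t comm by simp
        also have "\<dots> = line_conv L h t"
          unfolding h_def[abs_def] line_conv_cmult_right[symmetric]
          using elim(2,3) by (intro line_conv_diff_right[symmetric]) (simp_all add: mult.left_commute)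
        also have "\<dots> \<le> line_conv L (G n) t"
          by (rule line_conv_mono_causal[OF L_nn L0 _ _ h0 G0 elim(4,5)])
            (use pointwise[of n] t in \<open>auto simp: h_def\<close>)
        finally show "line_conv (\<rho> n) \<Phi> t \<le> line_conv L (G n) t" .
      qed
    qed
  qed

  \<comment> \<open>\<open>D\<close> measures the violation of the claim. For every \<open>n\<close>
    its integral is bounded by the two L^1 errors, the second one multiplied by the integral of
    \<open>L\<close>. Both tend to 0, so the claim follows without extracting subsequences that
    converge almost everywhere.\<close>
  define D where "D t = indicator {0<..<T} t * max 0 (\<Phi> t - line_conv L f t)" for t
  have Lf_int: "integrable lborel (line_conv L f)" by (rule integrable_line_conv[OF L_int f_int])
  have D_int: "integrable lborel D"
    unfolding D_def[abs_def]
    using integrable_mult_indicator[of "{0<..<T}" lborel "\<lambda>t. max 0 (\<Phi> t - line_conv L f t)"] \<Phi> Lf_int by simp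
  have Gf_int: "integrable lborel (\<lambda>t. \<bar>G n t - f t\<bar>)" for n using G_int[of n] f_int by simp
  have \<Phi>\<rho>_int: "integrable lborel (\<lambda>t. \<bar>line_conv (\<rho> n) \<Phi> t - \<Phi> t\<bar>)" for n
    using integrable_line_conv[OF \<rho>_int \<Phi>] \<Phi> by simp
  have D_le: "(LINT t|lborel. D t) \<le> (LINT t|lborel. \<bar>line_conv (\<rho> n) \<Phi> t - \<Phi> t\<bar>)
      + (LINT t|lborel. L t) * (LINT t|lborel. \<bar>G n t - f t\<bar>)" for n
  proof -
    have LGf_int: "integrable lborel (line_conv L (\<lambda>t. \<bar>G n t - f t\<bar>))"
      by (rule integrable_line_conv[OF L_int Gf_int])
    have "(LINT t|lborel. D t) \<le> (LINT t|lborel. \<bar>line_conv (\<rho> n) \<Phi> t - \<Phi> t\<bar> + line_conv L (\<lambda>t. \<bar>G n t - f t\<bar>) t)"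
    proof (rule integral_mono_AE[OF D_int])
      show "integrable lborel (\<lambda>t. \<bar>line_conv (\<rho> n) \<Phi> t - \<Phi> t\<bar> + line_conv L (\<lambda>t. \<bar>G n t - f t\<bar>) t)"
        using \<Phi>\<rho>_int LGf_int by simp
      show "AE t in lborel. D t \<le> \<bar>line_conv (\<rho> n) \<Phi> t - \<Phi> t\<bar> + line_conv L (\<lambda>t. \<bar>G n t - f t\<bar>) t"
        using convolved[of n] AE_integrable_conv[OF L_int G_int[of n]] AE_integrable_conv[OF L_int f_int]
          AE_integrable_conv[OF L_int Gf_int[of n]]
      proof eventually_elim
        case (elim t)
        have nn: "0 \<le> line_conv L (\<lambda>t. \<bar>G n t - f t\<bar>) t" by (rule line_conv_nonneg[OF L_nn]) simp
        have "line_conv L (G n) t - line_conv L f t = line_conv L (\<lambda>s. G n s - f s) t"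
          using elim(2,3) by (rule line_conv_diff_right[symmetric])
        also have "\<dots> \<le> line_conv L (\<lambda>t. \<bar>G n t - f t\<bar>) t"
          using elim(2,3,4) by (intro line_conv_mono L_nn) (simp_all add: right_diff_distrib)
        finally have "line_conv L (G n) t - line_conv L f t \<le> line_conv L (\<lambda>t. \<bar>G n t - f t\<bar>) t" .
        then show ?case using nn elim(1) by (auto simp: D_def indicator_def)
      qed
    qed
    also have "\<dots> = (LINT t|lborel. \<bar>line_conv (\<rho> n) \<Phi> t - \<Phi> t\<bar>) + (LINT t|lborel. L t) * (LINT t|lborel. \<bar>G n t - f t\<bar>)"
      using \<Phi>\<rho>_int LGf_int integral_line_conv[OF L_int Gf_int] by simp
    finally show ?thesis .
  qed
  have "(\<lambda>n. (LINT t|lborel. \<bar>line_conv (\<rho> n) \<Phi> t - \<Phi> t\<bar>)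
      + (LINT t|lborel. L t) * (LINT t|lborel. \<bar>G n t - f t\<bar>)) \<longlonglongrightarrow> 0 + (LINT t|lborel. L t) * 0"
    by (intro tendsto_intros \<Phi>_lim G_lim)
  then have "(LINT t|lborel. D t) \<le> 0 + (LINT t|lborel. L t) * 0"
    by (rule LIMSEQ_le_const) (use D_le in auto)
  moreover have D_nn: "AE t in lborel. 0 \<le> D t" by (simp add: D_def)
  ultimately have "(LINT t|lborel. D t) = 0" using integral_nonneg_AE[OF D_nn] by simp
  then have "AE t in lborel. D t = 0"
    using integral_nonneg_eq_0_iff_AE[OF D_int D_nn] by simp
  then have "AE t in lborel. 0 < t \<and> t < T \<longrightarrow> \<Phi> t \<le> line_conv L f t"
    by eventually_elim (auto simp: D_def)
  then show ?thesis by (simp add: L_def f_def[abs_def])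
qed

end

section \<open>Fractional chain rule for subdifferentials\<close>

text \<open>Strict superlevel sets are open. \<open>Liminf (at x)\<close> ignores the value at
  \<open>x\<close>, so this point is put back into the neighbourhood separately.\<close>

lemma lower_semicontinuous_measurable:
  fixes \<phi> :: "'h::topological_space \<Rightarrow> ereal"
  assumes "lower_semicontinuous \<phi>"
  shows "\<phi> \<in> borel_measurable borel"
proof -
  have "open {x. a < \<phi> x}" for a
  proof (subst open_subopen, intro ballI)
    fix x assume x: "x \<in> {x. a < \<phi> x}"
    then have "a < Liminf (at x) \<phi>"
      using assms by (auto simp: lower_semicontinuous_def intro: less_le_trans)
    then have "eventually (\<lambda>y. a < \<phi> y) (at x)" by (rule less_LiminfD)
    then obtain U where "open U" "x \<in> U" "\<forall>y\<in>U. y \<noteq> x \<longrightarrow> a < \<phi> y"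
      by (auto simp: eventually_at_topological)
    then show "\<exists>U. open U \<and> x \<in> U \<and> U \<subseteq> {x. a < \<phi> x}"
      using x by (intro exI[of _ U]) auto
  qed
  then show ?thesis by (intro borel_measurableI_greater) auto
qed

lemma subdifferential_real:
  assumes \<phi>: "proper_functional \<phi>" and \<xi>: "\<xi> \<in> subdifferential \<phi> z" and w: "w \<in> effective_domain \<phi>"
  shows "\<xi> \<bullet> (w - z) \<le> real_of_ereal (\<phi> w) - real_of_ereal (\<phi> z)"
proof -
  have z: "\<phi> z < \<infinity>" and le: "ereal (\<xi> \<bullet> (w - z)) \<le> \<phi> w - \<phi> z"
    using \<xi> w by (auto simp: subdifferential_def effective_domain_def)
  have "\<phi> z \<noteq> -\<infinity>" "\<phi> w \<noteq> -\<infinity>" using \<phi> by (auto simp: proper_functional_def)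
  then obtain a b where "\<phi> z = ereal a" "\<phi> w = ereal b"
    using z w by (cases "\<phi> z"; cases "\<phi> w") (auto simp: effective_domain_def)
  then show ?thesis using le by simp
qed

lemma AE_lebesgue_on_interval:
  "(AE t in lebesgue_on {0<..<T}. P t) \<longleftrightarrow> (AE t in lborel. 0 < t \<and> t < T \<longrightarrow> P t)" for T :: real
  by (subst AE_restrict_space_iff) (simp_all add: AE_completion_iff)

text \<open>An interval of positive length is not a null set. This supplies a reference time at
  which a property valid almost everywhere does hold.\<close>

lemma AE_interval_ex:
  fixes T :: real
  assumes "AE t in lborel. 0 < t \<and> t < T \<longrightarrow> P t" "0 < T"
  obtains t where "0 < t" "t < T" "P t"
proof -
  have "\<not> (AE t in lborel. \<not> (0 < t \<and> t < T))"
  proof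
    assume "AE t in lborel. \<not> (0 < t \<and> t < T)"
    then have "AE t in lborel. t \<notin> {0<..<T}" by (auto elim!: eventually_mono)
    then have "emeasure lborel {0<..<T} = 0"
      by (subst (asm) AE_iff_measurable[of "{0<..<T}"]) auto
    then show False using \<open>0 < T\<close> by simp
  qed
  moreover have "AE t in lborel. \<not> (0 < t \<and> t < T)" if "\<forall>t. 0 < t \<and> t < T \<longrightarrow> \<not> P t"
    using assms(1) by eventually_elim (use that in blast)
  ultimately show ?thesis using that by blast
qed

lemma integrable_inner_squares:
  fixes f g :: "real \<Rightarrow> 'h::real_inner"
  assumes "simple_limit borel f" "integrable lborel (\<lambda>t. (norm (f t))\<^sup>2)"
    "simple_limit borel g" "integrable lborel (\<lambda>t. (norm (g t))\<^sup>2)"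
  shows "integrable lborel (\<lambda>t. f t \<bullet> g t)"
  using integrable_inner_shift[OF assms, of 0] by simp

text \<open>The initial condition belongs to the continuous representative \<open>z\<close> of k *
  v, so \<open>du_bois_reymond\<close> is applied to \<open>z\<close> paired with \<open>a\<close>.
  The value \<open>z 0 = 0\<close> removes the integration constant and leaves a scalar Volterra
  equation.\<close>

lemma vconv_volterra:
  fixes w d v' d' :: "real \<Rightarrow> 'h::{real_inner, complete_space}"
  assumes k: "monotone_kernel k" and l: "conjugate_kernel k l" and T: "0 < T"
    and v': "simple_limit borel v'" "integrable lborel (\<lambda>t. norm (v' t))" "\<And>t. t \<le> 0 \<Longrightarrow> v' t = 0"
      "AE t in lborel. 0 < t \<and> t < T \<longrightarrow> v t = v' t"
    and w: "L2_on T (vconv k v)" "has_initial_value T (vconv k v) 0" and weak: "is_weak_derivative T (vconv k v) d"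
    and d': "simple_limit borel d'" "integrable lborel (\<lambda>t. norm (d' t))" "\<And>t. t \<notin> {0<..<T} \<Longrightarrow> d' t = 0"
      "AE t in lborel. 0 < t \<and> t < T \<longrightarrow> d t = d' t"
  shows "AE t in lborel. 0 < t \<and> t < T \<longrightarrow> v' t \<bullet> a = line_conv (cutoff T l) (\<lambda>s. d' s \<bullet> a) t"
proof -
  obtain w' where w': "simple_limit borel w'" "AE t in lborel. 0 < t \<and> t < T \<longrightarrow> vconv k v t = w' t"
    "\<And>t. t \<notin> {0<..<T} \<Longrightarrow> w' t = 0" "integrable lborel (\<lambda>t. norm (w' t))"
    by (rule L2_on_borel_representative[OF w(1)], rule that)
  obtain z where z: "continuous_on {0..T} z" "AE t in lborel. 0 < t \<and> t < T \<longrightarrow> z t = vconv k v t" "z 0 = 0"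
    using w(2) unfolding has_initial_value_def AE_lebesgue_on_interval by blast
  have da_int: "integrable lborel (\<lambda>t. d' t \<bullet> a)" by (rule integrable_inner_const[OF d'(1,2)])
  have wa_int: "integrable lborel (\<lambda>t. w' t \<bullet> a)" by (rule integrable_inner_const[OF w'(1,4)])
  have za_cont: "continuous_on {0..T} (\<lambda>t. z t \<bullet> a)" by (intro continuous_intros z(1))
  \<comment> \<open>The point \<open>T\<close> is excluded: the cutoff keeps the value of
    \<open>z\<close> there, whereas \<open>w'\<close> vanishes.\<close>
  have wz: "AE t in lborel. w' t \<bullet> a = cutoff T (\<lambda>t. z t \<bullet> a) t"
    using w'(2) z(2) AE_lborel_neq[of T]
  proof eventually_elim
    case (elim t)
    show ?case
    proof (cases "0 < t \<and> t < T")
      case False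
      then have "t \<le> 0 \<or> T < t" using elim(3) by auto
      then show ?thesis using w'(3)[of t] by auto
    qed (use elim in auto)
  qed
  have z_eq: "z t \<bullet> a = (LINT s|lborel. cutoff t (\<lambda>s. d' s \<bullet> a) s)" if t: "0 < t" "t < T" for t
  proof -
    have "z t \<bullet> a = z 0 \<bullet> a + (LINT s|lborel. cutoff t (\<lambda>s. d' s \<bullet> a) s)"
    proof (rule du_bois_reymond[OF za_cont da_int _ t])
      fix \<psi> assume \<psi>: "test_function T \<psi>"
      have "(LINT t|lborel. deriv \<psi> t * (w' t \<bullet> a)) = - (LINT t|lborel. \<psi> t * (d' t \<bullet> a))"
        by (rule weak_derivative_inner[OF weak \<psi> w'(1,4,3,2) d'])
      moreover have "(LINT t|lborel. deriv \<psi> t * (w' t \<bullet> a)) = (LINT t|lborel. deriv \<psi> t * cutoff T (\<lambda>t. z t \<bullet> a) t)"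
      proof (rule integral_cong_AE)
        have [measurable]: "deriv \<psi> \<in> borel_measurable borel"
        proof -
          have "(deriv ^^ 1) \<psi> field_differentiable at x" for x
            using \<psi> unfolding test_function_def by blast
          then have "continuous_on UNIV (deriv \<psi>)"
            by (auto intro!: continuous_at_imp_continuous_on field_differentiable_imp_continuous_at)
          then show ?thesis by (rule borel_measurable_continuous_onI)
        qed
        have [measurable]: "cutoff T (\<lambda>t. z t \<bullet> a) \<in> borel_measurable borel"
        proof -
          have "(\<lambda>t. indicator {0..T} t *\<^sub>R (z t \<bullet> a)) \<in> borel_measurable borel"
            by (rule borel_measurable_continuous_on_indicator) (use za_cont in auto)
          then have "cutoff T (\<lambda>t. indicator {0..T} t *\<^sub>R (z t \<bullet> a)) \<in> borel_measurable borel" by simp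
          moreover have "cutoff T (\<lambda>t. indicator {0..T} t *\<^sub>R (z t \<bullet> a)) = cutoff T (\<lambda>t. z t \<bullet> a)"
            by (auto simp: cutoff_def fun_eq_iff)
          ultimately show ?thesis by (simp only:)
        qed
        show "(\<lambda>t. deriv \<psi> t * (w' t \<bullet> a)) \<in> borel_measurable lborel"
          using wa_int by measurable
        show "(\<lambda>t. deriv \<psi> t * cutoff T (\<lambda>t. z t \<bullet> a) t) \<in> borel_measurable lborel" by measurable
        show "AE t in lborel. deriv \<psi> t * (w' t \<bullet> a) = deriv \<psi> t * cutoff T (\<lambda>t. z t \<bullet> a) t"
          using wz by eventually_elim (simp only:)
      qed
      ultimately show "(LINT t|lborel. deriv \<psi> t * cutoff T (\<lambda>t. z t \<bullet> a) t) = - (LINT t|lborel. \<psi> t * (d' t \<bullet> a))"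
        by simp
    qed
    then show ?thesis by (simp add: z(3))
  qed
  have va: "AE t in lborel. 0 < t \<and> t < T \<longrightarrow>
    (\<forall>a. vconv k v t \<bullet> a = line_conv (cutoff T k) (\<lambda>s. v' s \<bullet> a) t)"
    by (rule vconv_inner[OF k v'])
  show ?thesis
  proof (rule volterra_inversion[OF k l T])
    show "integrable lborel (\<lambda>t. v' t \<bullet> a)" by (rule integrable_inner_const[OF v'(1,2)])
    show "integrable lborel (\<lambda>t. d' t \<bullet> a)" by (rule da_int)
    show "v' s \<bullet> a = 0" "d' s \<bullet> a = 0" if "s \<le> 0" for s using that v'(3) d'(3) by auto
    show "AE t in lborel. 0 < t \<and> t < T \<longrightarrow> line_conv (cutoff T k) (\<lambda>t. v' t \<bullet> a) t = (LINT s|lborel. cutoff t (\<lambda>t. d' t \<bullet> a) s)"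
      using va z(2)
    proof eventually_elim
      case (elim t)
      then show ?case using z_eq[of t] by metis
    qed
  qed
qed

theorem proposition4p2:
  fixes k l :: "real \<Rightarrow> real"
    and \<phi> :: "'h::{real_inner, complete_space} \<Rightarrow> ereal"
    and T :: real
    and u0 :: 'h
    and u g :: "real \<Rightarrow> 'h"
  assumes "condition_K k" and "conjugate_kernel k l"
    and "proper_functional \<phi>" and "lower_semicontinuous \<phi>" and "convex_functional \<phi>"
    and "0 < T"
    and "u0 \<in> effective_domain \<phi>"
    and "L2_on T u"
    and "W12_on T (vconv k (\<lambda>s. u s - u0))"
    and "has_initial_value T (vconv k (\<lambda>s. u s - u0)) 0"
    and "AE t in lebesgue_on {0<..<T}. u t \<in> subdifferential_domain \<phi>"
    and "L2_on T g"
    and "AE t in lebesgue_on {0<..<T}. g t \<in> subdifferential \<phi> (u t)"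
  shows
    "let d = weak_derivative T (vconv k (\<lambda>s. u s - u0)) in
     (AE t in lebesgue_on {0<..<T}.
        integrable (lebesgue_on {0..t}) (\<lambda>\<tau>. d \<tau> \<bullet> g \<tau>) \<and>
        conv_integrable k (\<lambda>s. functional_diff \<phi> (u s) u0) t \<and>
        (LINT \<tau>|lebesgue_on {0..t}. d \<tau> \<bullet> g \<tau>) \<ge> conv k (\<lambda>s. functional_diff \<phi> (u s) u0) t) \<and>
     (AE t in lebesgue_on {0<..<T}.
        conv_integrable l (\<lambda>\<tau>. d \<tau> \<bullet> g \<tau>) t \<and>
        conv l (\<lambda>\<tau>. d \<tau> \<bullet> g \<tau>) t \<ge> functional_diff \<phi> (u t) u0)"
proof -
  define v where "v s = u s - u0" for s
  define d where "d = weak_derivative T (vconv k v)"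
  have k: "monotone_kernel k" using assms(1) by (simp add: condition_K_def)
  note l = assms(2) and T = assms(6)
  have ml: "monotone_kernel l" using l by (simp add: conjugate_kernel_def)
  have W12: "W12_on T (vconv k v)" and init: "has_initial_value T (vconv k v) 0"
    using assms(9,10) by (simp_all add: v_def[abs_def])
  have W12_L2: "L2_on T (vconv k v)" using W12 by (simp add: W12_on_def)
  have d: "L2_on T d" "is_weak_derivative T (vconv k v) d"
  proof -
    have "\<exists>d. L2_on T d \<and> is_weak_derivative T (vconv k v) d" using W12 by (simp add: W12_on_def)
    then have "L2_on T d \<and> is_weak_derivative T (vconv k v) d"
      unfolding d_def weak_derivative_def by (rule someI_ex)
    then show "L2_on T d" "is_weak_derivative T (vconv k v) d" by auto
  qed
  obtain u' where u': "simple_limit borel u'" "AE t in lborel. 0 < t \<and> t < T \<longrightarrow> u t = u' t"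
    "\<And>t. t \<notin> {0<..<T} \<Longrightarrow> u' t = 0"
    "integrable lborel (\<lambda>t. (norm (u' t))\<^sup>2)" "integrable lborel (\<lambda>t. norm (u' t))"
    by (rule L2_on_borel_representative[OF assms(8)], rule that)
  obtain d' where d': "simple_limit borel d'" "AE t in lborel. 0 < t \<and> t < T \<longrightarrow> d t = d' t"
    "\<And>t. t \<notin> {0<..<T} \<Longrightarrow> d' t = 0"
    "integrable lborel (\<lambda>t. (norm (d' t))\<^sup>2)" "integrable lborel (\<lambda>t. norm (d' t))"
    by (rule L2_on_borel_representative[OF d(1)], rule that)
  obtain g' where g': "simple_limit borel g'" "AE t in lborel. 0 < t \<and> t < T \<longrightarrow> g t = g' t"
    "\<And>t. t \<notin> {0<..<T} \<Longrightarrow> g' t = 0"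
    "integrable lborel (\<lambda>t. (norm (g' t))\<^sup>2)" "integrable lborel (\<lambda>t. norm (g' t))"
    by (rule L2_on_borel_representative[OF assms(12)], rule that)
  \<comment> \<open>The initial value is subtracted on (0, T) only, since a nonzero constant is not
    integrable on the line.\<close>
  define v' where "v' t = (if t \<in> {0<..<T} then u' t - u0 else 0)" for t
  have v'_sl: "simple_limit borel v'"
    unfolding v'_def[abs_def] by (intro simple_limit_if simple_limit_diff u'(1) simple_limit_const) simp
  have one_int: "integrable lborel (\<lambda>t. indicator {0<..<T} t * x :: real)" for x
    using T by (intro integrable_mult_left integrable_real_indicator) auto
  have v'_int: "integrable lborel (\<lambda>t. norm (v' t))"
  proof (rule integrable_norm_bound)
    show "integrable lborel (\<lambda>t. norm (u' t) + indicator {0<..<T} t * norm u0)"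
      by (intro Bochner_Integration.integrable_add u'(5) one_int)
    show "norm (v' t) \<le> norm (u' t) + indicator {0<..<T} t * norm u0" for t
      using norm_triangle_ineq4[of "u' t" u0] by (simp add: v'_def)
  qed (simp add: simple_limit_lborel v'_sl)
  have v'_sq: "integrable lborel (\<lambda>t. (norm (v' t))\<^sup>2)"
  proof (rule Bochner_Integration.integrable_bound)
    show "integrable lborel (\<lambda>t. 2 * (norm (u' t))\<^sup>2 + indicator {0<..<T} t * (2 * (norm u0)\<^sup>2))"
      by (intro Bochner_Integration.integrable_add integrable_mult_right u'(4) one_int)
    have [measurable]: "(\<lambda>t. norm (v' t)) \<in> borel_measurable borel"
      by (rule simple_limit_measurable[OF simple_limit_norm[OF v'_sl]])
    show "(\<lambda>t. (norm (v' t))\<^sup>2) \<in> borel_measurable lborel" by measurable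
    show "AE t in lborel. norm ((norm (v' t))\<^sup>2) \<le> norm (2 * (norm (u' t))\<^sup>2 + indicator {0<..<T} t * (2 * (norm u0)\<^sup>2))"
    proof (rule AE_I2)
      fix t
      have "(norm (u' t - u0))\<^sup>2 \<le> (norm (u' t) + norm u0)\<^sup>2"
        by (intro power_mono norm_triangle_ineq4) simp
      also have "\<dots> \<le> 2 * (norm (u' t))\<^sup>2 + 2 * (norm u0)\<^sup>2"
        using sum_squares_bound[of "norm (u' t)" "norm u0"] by (simp add: power2_sum)
      finally show "norm ((norm (v' t))\<^sup>2) \<le> norm (2 * (norm (u' t))\<^sup>2 + indicator {0<..<T} t * (2 * (norm u0)\<^sup>2))"
        by (simp add: v'_def)
    qed
  qed
  have v'0: "v' t = 0" if "t \<le> 0" for t using that by (simp add: v'_def)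
  have d'0: "d' t = 0" if "t \<le> 0" for t using that d'(3) by simp
  have v_ae: "AE t in lborel. 0 < t \<and> t < T \<longrightarrow> v t = v' t"
    using u'(2) by eventually_elim (simp add: v_def v'_def)
  have rel: "AE t in lborel. 0 < t \<and> t < T \<longrightarrow> v' t \<bullet> a = line_conv (cutoff T l) (\<lambda>s. d' s \<bullet> a) t" for a
    by (rule vconv_volterra[OF k l T v'_sl v'_int v'0 v_ae W12_L2 init d(2) d'(1,5,3,2)])

  \<comment> \<open>The scalar function \<Phi> and its integrability\<close>
  define \<Phi> where "\<Phi> t = (if t \<in> {0<..<T} then functional_diff \<phi> (u' t) u0 else 0)" for t
  have [measurable]: "\<Phi> \<in> borel_measurable borel"
  proof -
    have [measurable]: "u' \<in> borel_measurable borel" "\<phi> \<in> borel_measurable borel"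
      by (intro simple_limit_measurable u'(1) lower_semicontinuous_measurable assms(4))+
    have "(\<lambda>t. real_of_ereal (\<phi> (u' t))) \<in> borel_measurable borel"
      by measurable
    then show ?thesis unfolding \<Phi>_def[abs_def] functional_diff_def by measurable
  qed
  have \<Phi>0: "\<Phi> t = 0" if "t \<le> 0" for t using that by (simp add: \<Phi>_def)
  define good where "good t \<longleftrightarrow> u t = u' t \<and> g' t \<in> subdifferential \<phi> (u' t)" for t
  have good_ae: "AE t in lborel. 0 < t \<and> t < T \<longrightarrow> good t"
    using u'(2) g'(2) assms(13)[unfolded AE_lebesgue_on_interval]
    by eventually_elim (auto simp: good_def)
  have good_dom: "u' t \<in> effective_domain \<phi>" if "good t" for t
    using that by (auto simp: good_def subdifferential_def)
  \<comment> \<open>The subgradient at time \<open>t\<close> is tested with the value at time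
    \<open>s\<close>; the initial value cancels in the difference.\<close>
  have sub: "v' s \<bullet> g' t - \<Phi> s \<le> v' t \<bullet> g' t - \<Phi> t" if "good t" "good s" "0 < t" "t < T" "0 < s" "s < T" for s t
  proof -
    have "g' t \<bullet> (u' s - u' t) \<le> real_of_ereal (\<phi> (u' s)) - real_of_ereal (\<phi> (u' t))"
      using that good_dom by (intro subdifferential_real assms(3)) (auto simp: good_def)
    moreover have "v' s \<bullet> g' t - v' t \<bullet> g' t = g' t \<bullet> (u' s - u' t)"
      using that by (simp add: v'_def inner_diff_left inner_diff_right inner_commute)
    ultimately show ?thesis using that by (simp add: \<Phi>_def functional_diff_def)
  qed
  \<comment> \<open>Here the test vector is \<open>u0\<close>, which lies in the effective
    domain.\<close>
  have pos: "\<Phi> t \<le> v' t \<bullet> g' t" if "good t" "0 < t" "t < T" for t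
  proof -
    have "g' t \<bullet> (u0 - u' t) \<le> real_of_ereal (\<phi> u0) - real_of_ereal (\<phi> (u' t))"
      using that assms(7) by (intro subdifferential_real assms(3)) (auto simp: good_def)
    then show ?thesis
      using that by (simp add: \<Phi>_def functional_diff_def v'_def inner_diff_left inner_diff_right inner_commute)
  qed
  \<comment> \<open>The subgradient at one fixed good time gives an affine minorant of the
    functional, hence a lower bound of \<Phi> that is integrable because \<open>g' t0\<close> does
    not vary. With \<open>pos\<close> as upper bound this makes \<Phi> integrable.\<close>
  obtain t0 where t0: "0 < t0" "t0 < T" "good t0"
    by (rule AE_interval_ex[OF good_ae T], rule that)
  have vg_int: "integrable lborel (\<lambda>t. v' t \<bullet> g' t)" by (rule integrable_inner_squares[OF v'_sl v'_sq g'(1,4)])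
  have vg0_int: "integrable lborel (\<lambda>t. v' t \<bullet> g' t0)" by (rule integrable_inner_const[OF v'_sl v'_int])
  have \<Phi>_int: "integrable lborel \<Phi>"
  proof (rule Bochner_Integration.integrable_bound)
    let ?b = "\<lambda>t. \<bar>v' t \<bullet> g' t\<bar> + \<bar>v' t \<bullet> g' t0\<bar> + indicator {0<..<T} t * \<bar>\<Phi> t0 - v' t0 \<bullet> g' t0\<bar>"
    show "integrable lborel ?b"
      by (intro Bochner_Integration.integrable_add integrable_abs vg_int vg0_int one_int)
    show "AE t in lborel. norm (\<Phi> t) \<le> norm (?b t)"
      using good_ae
    proof eventually_elim
      case (elim t)
      show ?case
      proof (cases "0 < t \<and> t < T")
        case True
        then have "\<Phi> t \<le> v' t \<bullet> g' t" "v' t \<bullet> g' t0 - \<Phi> t \<le> v' t0 \<bullet> g' t0 - \<Phi> t0"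
          using pos[of t] sub[of t0 t] t0 elim by auto
        then show ?thesis using True by simp
      next
        case False
        then have "\<Phi> t = 0" by (auto simp: \<Phi>_def)
        then show ?thesis by simp
      qed
    qed
  qed simp
  have core: "AE t in lborel. 0 < t \<and> t < T \<longrightarrow> \<Phi> t \<le> line_conv (cutoff T l) (\<lambda>s. d' s \<bullet> g' s) t"
  proof (rule convolution_inequality[OF k l T v'_sl v'_int v'0 d'(1,5,4) d'0 g'(1,4) \<Phi>_int \<Phi>0 rel])
    show "AE t in lborel. 0 < t \<and> t < T \<longrightarrow> \<Phi> t \<le> v' t \<bullet> g' t"
      using good_ae by eventually_elim (use pos in auto)
    show "AE t in lborel. 0 < t \<and> t < T \<longrightarrow> (AE s in lborel. 0 < s \<and> s < T \<longrightarrow> v' s \<bullet> g' t - \<Phi> s \<le> v' t \<bullet> g' t - \<Phi> t)"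
      using good_ae
    proof eventually_elim
      case (elim t)
      show ?case
      proof
        assume t: "0 < t \<and> t < T"
        show "AE s in lborel. 0 < s \<and> s < T \<longrightarrow> v' s \<bullet> g' t - \<Phi> s \<le> v' t \<bullet> g' t - \<Phi> t"
          using good_ae by eventually_elim (use elim t sub in auto)
      qed
    qed
  qed

  \<comment> \<open>From the line back to the interval\<close>
  define f where "f s = d' s \<bullet> g' s" for s
  have f_int: "integrable lborel f"
    unfolding f_def[abs_def] by (rule integrable_inner_squares[OF d'(1,4) g'(1,4)])
  have [measurable]: "f \<in> borel_measurable borel" using f_int by simp
  have f0: "f s = 0" if "s \<le> 0" for s using d'0[OF that] by (simp add: f_def)
  have f_ae: "AE s in lborel. 0 < s \<and> s < T \<longrightarrow> d s \<bullet> g s = f s"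
    using d'(2) g'(2) by eventually_elim (simp add: f_def)
  have \<Phi>_ae: "AE s in lborel. 0 < s \<and> s < T \<longrightarrow> functional_diff \<phi> (u s) u0 = \<Phi> s"
    using u'(2) by eventually_elim (simp add: \<Phi>_def)
  note k_int = integrable_kernel[OF k] and l_int = integrable_kernel[OF ml]
  note k_nn = cutoff_kernel_nonneg[OF k]
  have Lf_int: "integrable lborel (line_conv (cutoff T l) f)" by (rule integrable_line_conv[OF l_int f_int])
  have Lf0: "line_conv (cutoff T l) f s = 0" if "s \<le> 0" for s
    using that f0 by (intro line_conv_eq_0_of_causal) auto
  have KLf: "AE t in lborel. 0 < t \<and> t < T \<longrightarrow>
    line_conv (cutoff T k) (line_conv (cutoff T l) f) t = (LINT s|lborel. cutoff t f s)"
    by (rule line_conv_kernels_left[OF k l T f_int]) (rule f0)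

  \<comment> \<open>A convolution at time \<open>t\<close> uses values on (0, t) only, which lets
    the identities on (0, T) serve every earlier time.\<close>
  have restrict: "AE s in lborel. 0 < s \<and> s < t \<longrightarrow> h s = h' s"
    if "AE s in lborel. 0 < s \<and> s < T \<longrightarrow> h s = h' s" "t < T" for h h' :: "real \<Rightarrow> real" and t
    using that(1) by eventually_elim (use that(2) in auto)

  have part2: "AE t in lborel. 0 < t \<and> t < T \<longrightarrow> conv_integrable l (\<lambda>\<tau>. d \<tau> \<bullet> g \<tau>) t \<and>
      conv l (\<lambda>\<tau>. d \<tau> \<bullet> g \<tau>) t \<ge> functional_diff \<phi> (u t) u0"
    using core \<Phi>_ae AE_integrable_conv[OF l_int[of T] f_int]
  proof eventually_elim
    case (elim t)
    show ?case
    proof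
      assume t: "0 < t \<and> t < T"
      have m: "f \<in> borel_measurable borel" by measurable
      have conv: "conv_integrable l (\<lambda>\<tau>. d \<tau> \<bullet> g \<tau>) t \<longleftrightarrow> integrable lborel (\<lambda>s. cutoff T l (t - s) * f s)"
        "conv l (\<lambda>\<tau>. d \<tau> \<bullet> g \<tau>) t = line_conv (cutoff T l) f t"
        using t by (intro conv_line_conv[OF ml m] f0 restrict[OF f_ae]; simp)+
      show "conv_integrable l (\<lambda>\<tau>. d \<tau> \<bullet> g \<tau>) t \<and> conv l (\<lambda>\<tau>. d \<tau> \<bullet> g \<tau>) t \<ge> functional_diff \<phi> (u t) u0"
        using conv t elim by (simp add: f_def[abs_def])
    qed
  qed
  have part1: "AE t in lborel. 0 < t \<and> t < T \<longrightarrow> integrable (lebesgue_on {0..t}) (\<lambda>\<tau>. d \<tau> \<bullet> g \<tau>) \<and>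
        conv_integrable k (\<lambda>s. functional_diff \<phi> (u s) u0) t \<and>
        (LINT \<tau>|lebesgue_on {0..t}. d \<tau> \<bullet> g \<tau>) \<ge> conv k (\<lambda>s. functional_diff \<phi> (u s) u0) t"
    using KLf AE_integrable_conv[OF k_int[of T] \<Phi>_int] AE_integrable_conv[OF k_int[of T] Lf_int]
  proof eventually_elim
    case (elim t)
    show ?case
    proof
      assume t: "0 < t \<and> t < T"
      have m: "\<Phi> \<in> borel_measurable borel" by measurable
      have conv: "conv_integrable k (\<lambda>s. functional_diff \<phi> (u s) u0) t \<longleftrightarrow> integrable lborel (\<lambda>s. cutoff T k (t - s) * \<Phi> s)"
        "conv k (\<lambda>s. functional_diff \<phi> (u s) u0) t = line_conv (cutoff T k) \<Phi> t"
        using t by (intro conv_line_conv[OF k m] \<Phi>0 restrict[OF \<Phi>_ae]; simp)+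
      have fm: "cutoff t f \<in> borel_measurable borel" by measurable
      have "AE s in lborel. (if s \<in> {0..t} then d s \<bullet> g s else 0) = cutoff t f s"
        using f_ae AE_lborel_neq[of 0]
        by eventually_elim (use t in \<open>auto simp: cutoff_def\<close>)
      note int = lebesgue_on_lborel[OF _ fm this]
      have "line_conv (cutoff T k) \<Phi> t \<le> line_conv (cutoff T k) (line_conv (cutoff T l) f) t"
        by (rule line_conv_mono_causal[OF k_nn _ _ _ \<Phi>0 Lf0 elim(2,3)])
          (use core t in \<open>auto simp: f_def[abs_def]\<close>)
      then show "integrable (lebesgue_on {0..t}) (\<lambda>\<tau>. d \<tau> \<bullet> g \<tau>) \<and>
        conv_integrable k (\<lambda>s. functional_diff \<phi> (u s) u0) t \<and>
        (LINT \<tau>|lebesgue_on {0..t}. d \<tau> \<bullet> g \<tau>) \<ge> conv k (\<lambda>s. functional_diff \<phi> (u s) u0) t"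
        using conv int elim t integrable_cutoff[OF f_int, of t] by simp
    qed
  qed
  have "weak_derivative T (vconv k (\<lambda>s. u s - u0)) = d" by (simp add: d_def v_def[abs_def])
  then show ?thesis
    using part1 part2 by (simp only: Let_def AE_lebesgue_on_interval)
qed

end
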